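(* Let $d$ be a positive integer and $m_1,\dots,m_d\in\mathbb{Z}_{\geq0}$, $M=m_1+\cdots+m_d$. Let $(\varepsilon_1,\dots,\varepsilon_d)\in\mathbb{C}^d$ tend to $(0,\dots,0)$ subject to: $\varepsilon_j\neq0$ and $\varepsilon_d(j)\neq0$ for $j=1,\dots,d$; $|\varepsilon_1|+\cdots+|\varepsilon_d|\leq\frac12$; and $|\varepsilon_k/\varepsilon_d(j)|$ remains bounded for all $1\le j\le k\le d$. Then \begin{align*} \zeta_d(-m_1+\varepsilon_1,\dots,-m_d+\varepsilon_d) =&(-1)^{m_d}m_d!\sum_{p_1+\cdots+p_d=d+M}\frac{B_{p_1}\cdots B_{p_d}}{p_1!\cdots p_d!}\prod_{j=2}^{d}\Bigl(h\bigl(-m_d(j)-d+j+p_d(j)-1,\,-m_d(j-1)-d+j+p_d(j)-1\bigr)\\ &\qquad\times\frac{[\varepsilon_d(j)]_{-m_d(j)-d+j+p_d(j)-1}}{[\varepsilon_d(j-1)]_{-m_d(j-1)-d+j+p_d(j)-1}}\Bigr)+\sum_{j=1}^{d}O(\varepsilon_j)\\ =&(-1)^{m_d}m_d!\sum_{\substack{p_1+\cdots+p_d=d+M\\ \text{for all }2\le j\le d:\ -m_d(j)-d+j+p_d(j)<2\ \text{or}\ -m_d(j-1)-d+j+p_d(j)\geq 2}}\frac{B_{p_1}\cdots B_{p_d}}{p_1!\cdots p_d!}\prod_{j=2}^{d}\frac{[\varepsilon_d(j)]_{-m_d(j)-d+j+p_d(j)-1}}{[\varepsilon_d(j-1)]_{-m_d(j-1)-d+j+p_d(j)-1}}+\sum_{j=1}^{d}O(\varepsilon_j).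 \end{align*}
   Context: $\zeta_d(s_1,\dots,s_d)$ is the (meromorphically continued) Euler–Zagier multiple zeta function $\sum_{m_1,\dots,m_d\ge1}m_1^{-s_1}(m_1+m_2)^{-s_2}\cdots(m_1+\cdots+m_d)^{-s_d}$. For tuples write $m_d(n)=m_n+\cdots+m_d$, $p_d(n)=p_n+\cdots+p_d$, $\varepsilon_d(n)=\varepsilon_n+\cdots+\varepsilon_d$. The $p_i$ range over $\mathbb{Z}_{\ge0}$. $B_m$ are Bernoulli numbers with $x/(e^x-1)=\sum_m B_mx^m/m!$. For $a\in\mathbb{C}$ and $n\in\mathbb{Z}$: $[a]_n=a\,(n-1)!$ if $n\ge1$ and $[a]_n=(-1)^n/(-n)!$ if $n\le0$. For $m,n\in\mathbb{Z}$: $h(m,n)=0$ if $m\geq1>n$ and $h(m,n)=1$ otherwise. *)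

theory Defs
  imports
    "HOL-Analysis.Analysis"
    "HOL-Library.Landau_Symbols"
    "HOL-Computational_Algebra.Formal_Power_Series"
begin

text \<open>
  Since the depth \<open>d\<close> is a number, the space of \<open>d\<close>-tuples of complex numbers is
  represented by the extensional functions \<open>{1..d} \<rightarrow>\<^sub>E UNIV\<close>. The topology it inherits
  from the product topology on \<open>nat \<Rightarrow> complex\<close> is the usual one.
\<close>

definition cspace :: "nat \<Rightarrow> (nat \<Rightarrow> complex) set" where
  "cspace d = {1..d} \<rightarrow>\<^sub>E UNIV"

definition polydisc :: "nat \<Rightarrow> (nat \<Rightarrow> complex) \<Rightarrow> real \<Rightarrow> (nat \<Rightarrow> complex) set" where
  "polydisc d a r = (\<Pi>\<^sub>E j\<in>{1..d}. ball (a j) r)"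

text \<open>
  Holomorphy in several variables in the sense of Osgood: continuous, and complex
  differentiable in each variable separately. Meant for sets that are open in \<open>cspace d\<close>.
\<close>

definition mv_holomorphic_on ::
  "nat \<Rightarrow> ((nat \<Rightarrow> complex) \<Rightarrow> complex) \<Rightarrow> (nat \<Rightarrow> complex) set \<Rightarrow> bool" where
  "mv_holomorphic_on d f U \<longleftrightarrow>
     continuous_on U f \<and>
     (\<forall>s\<in>U. \<forall>j\<in>{1..d}. (\<lambda>z. f (s(j := z))) field_differentiable (at (s j)))"

text \<open>
  Meromorphic on the whole of \<open>cspace d\<close>: locally a quotient of holomorphic functions whose
  denominator does not vanish identically (polydiscs are connected). As \<open>F\<close> is a total
  function, its values on the zero set of a local denominator are not constrained.
\<close>

definition mv_meromorphic :: "nat \<Rightarrow> ((nat \<Rightarrow> complex) \<Rightarrow> complex) \<Rightarrow> bool" where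
  "mv_meromorphic d F \<longleftrightarrow>
     (\<forall>a\<in>cspace d. \<exists>r>0. \<exists>P Q.
        mv_holomorphic_on d P (polydisc d a r) \<and>
        mv_holomorphic_on d Q (polydisc d a r) \<and>
        (\<exists>s\<in>polydisc d a r. Q s \<noteq> 0) \<and>
        (\<forall>s\<in>polydisc d a r. Q s \<noteq> 0 \<longrightarrow> F s = P s / Q s))"

definition tail_sum :: "nat \<Rightarrow> (nat \<Rightarrow> 'a::comm_monoid_add) \<Rightarrow> nat \<Rightarrow> 'a" where
  "tail_sum d x n = (\<Sum>i=n..d. x i)"

definition euler_zagier_series :: "nat \<Rightarrow> (nat \<Rightarrow> complex) \<Rightarrow> complex" where
  "euler_zagier_series d s =
     (\<Sum>\<^sub>\<infinity>n\<in>{1..d} \<rightarrow>\<^sub>E {1::nat..}. \<Prod>k=1..d. of_nat (\<Sum>i=1..k. n i) powr (- s k))"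

text \<open>The region in which the series converges absolutely.\<close>

definition euler_zagier_region :: "nat \<Rightarrow> (nat \<Rightarrow> complex) set" where
  "euler_zagier_region d =
     {s \<in> cspace d. \<forall>j\<in>{1..d}. Re (tail_sum d s j) > real d - real j + 1}"

text \<open>
  The value at \<open>s\<close> of the meromorphic continuation of the series; it is meaningful for all
  \<open>s\<close> near which the continuation is holomorphic. The clause on holomorphy near \<open>s\<close> is needed
  because \<open>mv_meromorphic\<close> leaves some values of \<open>F\<close> unconstrained.
\<close>

definition euler_zagier_zeta :: "nat \<Rightarrow> (nat \<Rightarrow> complex) \<Rightarrow> complex" where
  "euler_zagier_zeta d s =
     (THE w. \<exists>F. mv_meromorphic d F \<and>
        (\<forall>t\<in>euler_zagier_region d. F t = euler_zagier_series d t) \<and>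
        (\<exists>r>0. mv_holomorphic_on d F (polydisc d s r)) \<and>
        F s = w)"

definition bernoulli_number :: "nat \<Rightarrow> complex" where
  "bernoulli_number n = fact n * fps_nth (fps_X / (fps_exp 1 - 1)) n"

definition brk :: "complex \<Rightarrow> int \<Rightarrow> complex" where
  "brk a n = (if n \<ge> 1 then a * fact (nat (n - 1)) else (-1) powi n / fact (nat (- n)))"

definition hcut :: "int \<Rightarrow> int \<Rightarrow> complex" where
  "hcut m n = (if m \<ge> 1 \<and> 1 > n then 0 else 1)"

end

theory Submission
  imports Defs "HOL-Complex_Analysis.Complex_Analysis"
begin

text \<open>
  Write \<open>S\<^sub>j\<close> for the tail sums of \<open>s\<close>. Euler--Maclaurin summation of the innermost sum expresses
  \<open>(s\<^sub>d - 1) \<zeta>\<^sub>d(s)\<close> as a finite combination of the values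
  \<open>B\<^sub>p / p! (s\<^sub>d - 1)\<^sub>p \<zeta>\<^sub>d\<^sub>-\<^sub>1(s\<^sub>1, \<dots>, s\<^sub>d\<^sub>-\<^sub>2, s\<^sub>d\<^sub>-\<^sub>1 + s\<^sub>d + p - 1)\<close> plus a remainder series that
  converges on a region growing with the order of the expansion. This yields the continuation
  by induction on \<open>d\<close>; it is holomorphic wherever no \<open>S\<^sub>j\<close> is an integer, and the identity theorem
  on polydiscs, propagated along a line, shows that it is the only one.

  Multiplication by \<open>e\<^sub>d \<Gamma>(s\<^sub>d)\<close>, where \<open>e\<^sub>j\<close> is \<open>S\<^sub>j\<close> minus its limiting integer, turns
  the coefficients into quotients \<open>e\<^sub>d \<Gamma>(n + e\<^sub>d) / (e\<^sub>d\<^sub>-\<^sub>1 \<Gamma>(n' + e\<^sub>d\<^sub>-\<^sub>1))\<close> with \<open>n' \<le> n\<close>. Such a quotient is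
  bounded and equals the quotient of brackets up to \<open>O(e\<^sub>d + e\<^sub>d\<^sub>-\<^sub>1)\<close>; it is itself \<open>O(e\<^sub>d)\<close> when
  \<open>h\<close> vanishes. The remainder is multiplied by \<open>e\<^sub>d \<Gamma>(s\<^sub>d + l)\<close> and hence is \<open>O(e\<^sub>d)\<close>. For \<open>d = 1\<close> the
  same expansion gives the values of the Riemann zeta function at the integers.
\<close>

section \<open>Holomorphic functions on polydiscs\<close>

text \<open>Although all limiting tail sums in the theorem are nonpositive, the expansion shifts the
  last exponent by \<open>p - 1\<close>, so the values of smaller depth lie near tuples with
  positive integer tail sums, where the continuation can grow like the inverse of an infinitesimal.
  An induction on the plain values would not close. The induction is therefore on
  \<open>gam e A\<close> times the value, for arbitrary integers \<open>A j\<close> that are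
  nondecreasing in \<open>j\<close>. Every shift preserves this monotonicity, which excludes the
  quotients of brackets with \<open>n < 1\<close> and \<open>n' \<ge> 1\<close>; these would behave
  like the inverse of \<open>e'\<close>.

  All errors are compared with one scale, the sum of the norms of the \<epsilon>'s, and are
  distributed over the single variables only at the very end.

  On the analytic side, a meromorphic \<open>F\<close> is arbitrary where its local denominators
  vanish, so equality on open sets cannot be propagated; agreement at points arbitrarily close to
  every point can. The order of the expansion has to grow from place to place, so the continuation
  becomes one global function only because its value does not depend on the order.\<close>

lemma polydisc_iff:
  "s \<in> polydisc d a r \<longleftrightarrow> s \<in> cspace d \<and> (\<forall>j\<in>{1..d}. dist (a j) (s j) < r)"
  by (auto simp: polydisc_def cspace_def PiE_iff mem_ball)

lemma cspace_upd: "s \<in> cspace d \<Longrightarrow> j \<in> {1..d} \<Longrightarrow> s(j := z) \<in> cspace d"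
  by (auto simp: cspace_def PiE_iff extensional_def)

lemma polydisc_upd:
  "s \<in> polydisc d a r \<Longrightarrow> j \<in> {1..d} \<Longrightarrow> z \<in> ball (a j) r \<Longrightarrow> s(j := z) \<in> polydisc d a r"
  by (auto simp: polydisc_iff cspace_upd mem_ball)

lemma polydisc_center: "a \<in> cspace d \<Longrightarrow> r > 0 \<Longrightarrow> a \<in> polydisc d a r"
  by (auto simp: polydisc_iff)

lemma polydisc_mono: "r \<le> r' \<Longrightarrow> polydisc d a r \<subseteq> polydisc d a r'"
  by (force simp: polydisc_iff)

text \<open>A basic open box yields one radius per coordinate, and the least of those with index in
  \<open>{1..d}\<close> suffices: outside \<open>{1..d}\<close> both tuples are
  \<open>undefined\<close>. The extra \<open>1\<close> in the minimum covers
  \<open>d = 0\<close>.\<close>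

lemma polydisc_basis:
  assumes "open V" "s \<in> V" "s \<in> cspace d"
  shows "\<exists>r>0. polydisc d s r \<subseteq> V"
proof -
  have "openin (product_topology (\<lambda>i::nat. euclidean :: complex topology) UNIV) V"
    using assms(1) by (simp add: open_fun_def)
  from product_topology_open_contains_basis[OF this assms(2)]
  obtain X where X: "s \<in> (\<Pi>\<^sub>E i\<in>UNIV. X i)" "\<And>i. open (X i)"
    "(\<Pi>\<^sub>E i\<in>UNIV. X i) \<subseteq> V" by auto
  have "\<forall>j. \<exists>e>0. ball (s j) e \<subseteq> X j"
    using X(1,2) by (auto simp: PiE_iff open_contains_ball)
  then obtain e where e: "\<And>j. e j > 0" "\<And>j. ball (s j) (e j) \<subseteq> X j" by metis
  define r where "r = Min (insert 1 (e ` {1..d}))"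
  have r: "r > 0" "\<And>j. j \<in> {1..d} \<Longrightarrow> r \<le> e j"
    using e(1) unfolding r_def by (simp, intro Min_le) auto
  have "polydisc d s r \<subseteq> (\<Pi>\<^sub>E i\<in>UNIV. X i)"
  proof
    fix t assume t: "t \<in> polydisc d s r"
    have "t i \<in> X i" for i
    proof (cases "i \<in> {1..d}")
      case True
      then have "t i \<in> ball (s i) (e i)" using t r(2)[OF True] by (force simp: polydisc_iff)
      then show ?thesis using e(2) by blast
    next
      case False
      then have "t i = s i" using t assms(3) by (auto simp: polydisc_iff cspace_def PiE_iff extensional_def)
      then show ?thesis using X(1) by auto
    qed
    then show "t \<in> (\<Pi>\<^sub>E i\<in>UNIV. X i)" by auto
  qed
  then show ?thesis using r X(3) by blast
qed

lemma polydisc_open_in: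
  obtains V where "open V" "polydisc d a r = cspace d \<inter> V"
proof
  show "open (\<Inter>j\<in>{1..d}. (\<lambda>s::nat \<Rightarrow> complex. s j) -` ball (a j) r)"
    by (intro open_INT ballI open_vimage) auto
  show "polydisc d a r = cspace d \<inter> (\<Inter>j\<in>{1..d}. (\<lambda>s::nat \<Rightarrow> complex. s j) -` ball (a j) r)"
    by (auto simp: polydisc_iff)
qed

lemma polydisc_inner:
  assumes "s \<in> polydisc d a r"
  shows "\<exists>\<rho>>0. polydisc d s \<rho> \<subseteq> polydisc d a r"
proof -
  obtain V where V: "open V" "polydisc d a r = cspace d \<inter> V" using polydisc_open_in .
  then obtain \<rho> where "\<rho> > 0" "polydisc d s \<rho> \<subseteq> V" using polydisc_basis[of V s d] assms by auto
  then show ?thesis using V(2) by (auto simp: polydisc_iff)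
qed

lemma continuous_on_polydisc_nhd:
  assumes "continuous_on (polydisc d a r) f" "s \<in> polydisc d a r" "open W" "f s \<in> W"
  shows "\<exists>\<rho>>0. polydisc d s \<rho> \<subseteq> polydisc d a r \<and> (\<forall>t\<in>polydisc d s \<rho>. f t \<in> W)"
proof -
  obtain A where A: "open A" "A \<inter> polydisc d a r = f -` W \<inter> polydisc d a r"
    using assms(1,3) unfolding continuous_on_open_invariant by blast
  have sc: "s \<in> cspace d" using assms(2) by (simp add: polydisc_iff)
  obtain \<rho>1 where \<rho>1: "\<rho>1 > 0" "polydisc d s \<rho>1 \<subseteq> A"
    using polydisc_basis[OF A(1) _ sc] A(2) assms(2,4) by auto
  obtain \<rho>2 where \<rho>2: "\<rho>2 > 0" "polydisc d s \<rho>2 \<subseteq> polydisc d a r"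
    using polydisc_inner[OF assms(2)] by auto
  have "polydisc d s (min \<rho>1 \<rho>2) \<subseteq> polydisc d s \<rho>1" "polydisc d s (min \<rho>1 \<rho>2) \<subseteq> polydisc d s \<rho>2"
    by (auto intro!: polydisc_mono)
  then show ?thesis using \<rho>1 \<rho>2 A(2) by (intro exI[of _ "min \<rho>1 \<rho>2"]) (auto; blast)
qed

lemma continuous_on_polydisc_nonzero:
  fixes f :: "(nat \<Rightarrow> complex) \<Rightarrow> complex"
  assumes "continuous_on (polydisc d a r) f" "s \<in> polydisc d a r" "f s \<noteq> 0"
  shows "\<exists>\<rho>>0. polydisc d s \<rho> \<subseteq> polydisc d a r \<and> (\<forall>t\<in>polydisc d s \<rho>. f t \<noteq> 0)"
  using continuous_on_polydisc_nhd[OF assms(1,2), of "- {0}"] assms(3)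
  by (auto simp: open_Compl)

lemma mv_holomorphic_on_subset:
  "mv_holomorphic_on d f U \<Longrightarrow> V \<subseteq> U \<Longrightarrow> mv_holomorphic_on d f V"
  unfolding mv_holomorphic_on_def by (auto intro: continuous_on_subset)

lemma mv_holomorphic_const: "mv_holomorphic_on d (\<lambda>_. c) U"
  by (auto simp: mv_holomorphic_on_def)

lemma mv_holomorphic_coord: "mv_holomorphic_on d (\<lambda>s. s k) U"
proof -
  have "(\<lambda>z. (s(j := z)) k) field_differentiable at (s j)" for s :: "nat \<Rightarrow> complex" and j
    by (cases "j = k") auto
  then show ?thesis
    unfolding mv_holomorphic_on_def
    by (auto intro: continuous_on_subset[OF continuous_on_product_coordinates])
qed

lemma mv_holomorphic_add:
  "mv_holomorphic_on d f U \<Longrightarrow> mv_holomorphic_on d g U \<Longrightarrow> mv_holomorphic_on d (\<lambda>s. f s + g s) U"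
  unfolding mv_holomorphic_on_def by (auto intro!: continuous_intros field_differentiable_add)

lemma mv_holomorphic_diff:
  "mv_holomorphic_on d f U \<Longrightarrow> mv_holomorphic_on d g U \<Longrightarrow> mv_holomorphic_on d (\<lambda>s. f s - g s) U"
  unfolding mv_holomorphic_on_def by (auto intro!: continuous_intros field_differentiable_diff)

lemma mv_holomorphic_mult:
  "mv_holomorphic_on d f U \<Longrightarrow> mv_holomorphic_on d g U \<Longrightarrow> mv_holomorphic_on d (\<lambda>s. f s * g s) U"
  unfolding mv_holomorphic_on_def by (auto intro!: continuous_intros field_differentiable_mult)

lemma mv_holomorphic_divide:
  assumes "mv_holomorphic_on d f U" "mv_holomorphic_on d g U" "\<And>s. s \<in> U \<Longrightarrow> g s \<noteq> 0"
  shows "mv_holomorphic_on d (\<lambda>s. f s / g s) U"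
  using assms unfolding mv_holomorphic_on_def
  by (auto intro!: continuous_intros field_differentiable_divide)

lemma mv_holomorphic_sum:
  "finite I \<Longrightarrow> (\<And>i. i \<in> I \<Longrightarrow> mv_holomorphic_on d (f i) U) \<Longrightarrow> mv_holomorphic_on d (\<lambda>s. \<Sum>i\<in>I. f i s) U"
  by (induction I rule: finite_induct) (auto intro: mv_holomorphic_const mv_holomorphic_add)

lemma mv_holomorphic_compose:
  assumes "g holomorphic_on UNIV" "mv_holomorphic_on d f U"
  shows "mv_holomorphic_on d (\<lambda>s. g (f s)) U"
proof -
  have *: "g field_differentiable at z" for z
    using assms(1) by (simp add: holomorphic_on_def)
  have "(\<lambda>z. g (f (s(j := z)))) field_differentiable at (s j)" if "s \<in> U" "j \<in> {1..d}" for s j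
    using field_differentiable_compose[of "\<lambda>z. f (s(j := z))" "s j" g] that assms(2) *
    by (auto simp: mv_holomorphic_on_def o_def)
  then show ?thesis
    using assms(2) continuous_on_compose2[OF holomorphic_on_imp_continuous_on[OF assms(1)]]
    by (auto simp: mv_holomorphic_on_def)
qed

text \<open>Differentiability is only postulated at the coordinate of the base point; moving the
  base point to \<open>s(j := z)\<close>, still in the polydisc, gives it on the whole disc.\<close>

lemma mv_holomorphic_slice:
  assumes "mv_holomorphic_on d f (polydisc d a r)" "s \<in> polydisc d a r" "j \<in> {1..d}"
  shows "(\<lambda>z. f (s(j := z))) holomorphic_on ball (a j) r"
proof -
  have "(\<lambda>z. f (s(j := z))) field_differentiable at z" if "z \<in> ball (a j) r" for z
  proof -
    have "(\<lambda>z'. f ((s(j := z))(j := z'))) field_differentiable at ((s(j := z)) j)"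
      using assms polydisc_upd[OF assms(2,3) that] unfolding mv_holomorphic_on_def by blast
    then show ?thesis by simp
  qed
  then show ?thesis by (auto simp: holomorphic_on_def intro: field_differentiable_at_within)
qed

text \<open>The coordinates are freed one at a time. If \<open>f\<close> vanishes whenever the
  coordinates beyond \<open>k\<close> are within \<rho> of \<open>b\<close>, the identity theorem in
  the single variable \<open>Suc k\<close> removes the condition on that variable as well.\<close>

lemma mv_holomorphic_identity:
  assumes f: "mv_holomorphic_on d f (polydisc d a r)" and b: "b \<in> polydisc d a r" and "\<rho> > 0"
    and z: "\<And>s. s \<in> polydisc d b \<rho> \<Longrightarrow> s \<in> polydisc d a r \<Longrightarrow> f s = 0"
    and s: "s \<in> polydisc d a r"
  shows "f s = 0"
proof -
  have "\<forall>s\<in>polydisc d a r. (\<forall>j\<in>{k<..d}. dist (b j) (s j) < \<rho>) \<longrightarrow> f s = 0" if "k \<le> d" for k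
    using that
  proof (induction k)
    case 0
    then show ?case using z by (auto simp: polydisc_iff)
  next
    case (Suc k)
    let ?j = "Suc k"
    have j: "?j \<in> {1..d}" using Suc.prems by auto
    show ?case
    proof (intro ballI impI)
      fix s assume s: "s \<in> polydisc d a r" "\<forall>j\<in>{Suc k<..d}. dist (b j) (s j) < \<rho>"
      have zero: "f (s(?j := z)) = 0" if "z \<in> ball (a ?j) r \<inter> ball (b ?j) \<rho>" for z
      proof -
        have "\<forall>j\<in>{k<..d}. dist (b j) ((s(?j := z)) j) < \<rho>"
          using s(2) that by (auto simp: mem_ball)
        then show ?thesis using Suc polydisc_upd[OF s(1) j, of z] that by auto
      qed
      have "f (s(?j := s ?j)) = 0"
      proof (rule analytic_continuation_open[where f = "\<lambda>z. f (s(?j := z))" and g = "\<lambda>_. 0"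
            and s = "ball (a ?j) r \<inter> ball (b ?j) \<rho>" and s' = "ball (a ?j) r"])
        show "ball (a ?j) r \<inter> ball (b ?j) \<rho> \<noteq> {}"
          using b j \<open>\<rho> > 0\<close>
          by (intro ex_in_conv[THEN iffD1] exI[of _ "b ?j"]) (auto simp: polydisc_iff)
        show "s ?j \<in> ball (a ?j) r" using s(1) j by (auto simp: polydisc_iff)
      qed (use mv_holomorphic_slice[OF f s(1) j] zero in auto)
      then show "f s = 0" by simp
    qed
  qed
  from this[of d] s show ?thesis by auto
qed

text \<open>The M-test is used twice: on the whole polydisc for joint continuity, and on closed
  discs in each slice for differentiability.\<close>

lemma mv_holomorphic_suminf:
  fixes f :: "nat \<Rightarrow> (nat \<Rightarrow> complex) \<Rightarrow> complex"
  assumes f: "\<And>n. mv_holomorphic_on d (f n) (polydisc d a r)"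
    and M: "\<And>n s. s \<in> polydisc d a r \<Longrightarrow> norm (f n s) \<le> M n" "summable M"
  shows "mv_holomorphic_on d (\<lambda>s. \<Sum>n. f n s) (polydisc d a r)"
proof -
  have u: "uniform_limit (polydisc d a r) (\<lambda>n s. \<Sum>i<n. f i s) (\<lambda>s. \<Sum>n. f n s) sequentially"
    using M by (intro Weierstrass_m_test)
  have hs: "mv_holomorphic_on d (\<lambda>s. \<Sum>i<n. f i s) (polydisc d a r)" for n
    by (intro mv_holomorphic_sum f) auto
  have "continuous_on (polydisc d a r) (\<lambda>s. \<Sum>n. f n s)"
    by (rule uniform_limit_theorem[OF _ u]) (use hs in \<open>auto simp: mv_holomorphic_on_def\<close>)
  moreover have "(\<lambda>z. \<Sum>n. f n (s(j := z))) field_differentiable at (s j)"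
    if s: "s \<in> polydisc d a r" and j: "j \<in> {1..d}" for s j
  proof -
    have sj: "s j \<in> ball (a j) r" using s j by (auto simp: polydisc_iff)
    have "(\<lambda>z. \<Sum>n. f n (s(j := z))) holomorphic_on ball (a j) r"
    proof (rule holomorphic_uniform_sequence[where f = "\<lambda>n z. \<Sum>i<n. f i (s(j := z))"])
      show "(\<lambda>z. \<Sum>i<n. f i (s(j := z))) holomorphic_on ball (a j) r" for n
        using mv_holomorphic_slice[OF hs s j] .
      show "\<exists>e>0. cball x e \<subseteq> ball (a j) r \<and>
          uniform_limit (cball x e) (\<lambda>n z. \<Sum>i<n. f i (s(j := z))) (\<lambda>z. \<Sum>n. f n (s(j := z))) sequentially"
        if x: "x \<in> ball (a j) r" for x
      proof -
        obtain e where e: "e > 0" "cball x e \<subseteq> ball (a j) r"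
          using x open_contains_cball_eq[OF open_ball] by meson
        have "uniform_limit (cball x e) (\<lambda>n z. \<Sum>i<n. f i (s(j := z))) (\<lambda>z. \<Sum>n. f n (s(j := z))) sequentially"
          using M polydisc_upd[OF s j] e(2) by (intro Weierstrass_m_test) auto
        then show ?thesis using e by blast
      qed
    qed auto
    then show ?thesis using sj by (meson holomorphic_on_imp_differentiable_at open_ball)
  qed
  ultimately show ?thesis by (auto simp: mv_holomorphic_on_def)
qed

section \<open>Meromorphic functions of several variables\<close>

lemma nonvanishing_dense:
  assumes "mv_holomorphic_on d Q (polydisc d a r)" "\<exists>s\<in>polydisc d a r. Q s \<noteq> 0"
    "b \<in> polydisc d a r" "\<rho> > 0"
  shows "\<exists>t\<in>polydisc d b \<rho>. t \<in> polydisc d a r \<and> Q t \<noteq> 0"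
  using mv_holomorphic_identity[OF assms(1,3,4)] assms(2) by blast

text \<open>Nonvanishing of each factor is an open and dense condition: a point with
  \<open>Q1\<close> nonzero is found first, and then one with \<open>Q2\<close> nonzero inside a
  polydisc on which \<open>Q1\<close> has no zero.\<close>

lemma nonvanishing_mult:
  assumes "mv_holomorphic_on d Q1 (polydisc d a r)" "mv_holomorphic_on d Q2 (polydisc d a r)"
    and "\<exists>s\<in>polydisc d a r. Q1 s \<noteq> 0" "\<exists>s\<in>polydisc d a r. Q2 s \<noteq> 0"
    and "b \<in> polydisc d a r" "\<rho> > 0"
  shows "\<exists>t \<sigma>. \<sigma> > 0 \<and> t \<in> polydisc d b \<rho> \<and> polydisc d t \<sigma> \<subseteq> polydisc d a r \<inter> polydisc d b \<rho> \<and>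
    (\<forall>u\<in>polydisc d t \<sigma>. Q1 u \<noteq> 0 \<and> Q2 u \<noteq> 0)"
proof -
  obtain t1 where t1: "t1 \<in> polydisc d b \<rho>" "t1 \<in> polydisc d a r" "Q1 t1 \<noteq> 0"
    using nonvanishing_dense[OF assms(1,3,5,6)] by blast
  obtain \<rho>1 where \<rho>1: "\<rho>1 > 0" "polydisc d t1 \<rho>1 \<subseteq> polydisc d a r" "\<And>t. t \<in> polydisc d t1 \<rho>1 \<Longrightarrow> Q1 t \<noteq> 0"
    using continuous_on_polydisc_nonzero[of d a r Q1 t1] assms(1) t1 by (auto simp: mv_holomorphic_on_def)
  obtain \<rho>2 where \<rho>2: "\<rho>2 > 0" "polydisc d t1 \<rho>2 \<subseteq> polydisc d b \<rho>"
    using polydisc_inner[OF t1(1)] by blast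
  define \<rho>' where "\<rho>' = min \<rho>1 \<rho>2"
  have \<rho>': "\<rho>' > 0" "polydisc d t1 \<rho>' \<subseteq> polydisc d t1 \<rho>1" "polydisc d t1 \<rho>' \<subseteq> polydisc d t1 \<rho>2"
    unfolding \<rho>'_def using \<rho>1 \<rho>2 by (auto intro!: polydisc_mono)
  obtain t where t: "t \<in> polydisc d t1 \<rho>'" "t \<in> polydisc d a r" "Q2 t \<noteq> 0"
    using nonvanishing_dense[OF assms(2,4) t1(2) \<rho>'(1)] by blast
  obtain \<rho>3 where \<rho>3: "\<rho>3 > 0" "polydisc d t \<rho>3 \<subseteq> polydisc d a r" "\<And>u. u \<in> polydisc d t \<rho>3 \<Longrightarrow> Q2 u \<noteq> 0"
    using continuous_on_polydisc_nonzero[of d a r Q2 t] assms(2) t by (auto simp: mv_holomorphic_on_def)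
  obtain \<rho>4 where \<rho>4: "\<rho>4 > 0" "polydisc d t \<rho>4 \<subseteq> polydisc d t1 \<rho>'"
    using polydisc_inner[OF t(1)] by blast
  have "polydisc d t (min \<rho>3 \<rho>4) \<subseteq> polydisc d t \<rho>3" "polydisc d t (min \<rho>3 \<rho>4) \<subseteq> polydisc d t \<rho>4"
    by (auto intro!: polydisc_mono)
  moreover have "t \<in> polydisc d b \<rho>" using t \<rho>' \<rho>2 by blast
  ultimately show ?thesis
    using \<rho>1 \<rho>2 \<rho>3 \<rho>4 \<rho>' by (intro exI[of _ t] exI[of _ "min \<rho>3 \<rho>4"]) (auto; blast)
qed

definition mv_quotient_on ::
  "nat \<Rightarrow> ((nat \<Rightarrow> complex) \<Rightarrow> complex) \<Rightarrow> (nat \<Rightarrow> complex) set \<Rightarrow>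
    ((nat \<Rightarrow> complex) \<Rightarrow> complex) \<Rightarrow> ((nat \<Rightarrow> complex) \<Rightarrow> complex) \<Rightarrow> bool" where
  "mv_quotient_on d F U P Q \<longleftrightarrow>
     mv_holomorphic_on d P U \<and> mv_holomorphic_on d Q U \<and>
     (\<exists>s\<in>U. Q s \<noteq> 0) \<and> (\<forall>s\<in>U. Q s \<noteq> 0 \<longrightarrow> F s = P s / Q s)"

definition mv_meromorphic_at :: "nat \<Rightarrow> ((nat \<Rightarrow> complex) \<Rightarrow> complex) \<Rightarrow> (nat \<Rightarrow> complex) \<Rightarrow> bool" where
  "mv_meromorphic_at d F a \<longleftrightarrow> a \<in> cspace d \<and> (\<exists>r>0. \<exists>P Q. mv_quotient_on d F (polydisc d a r) P Q)"

lemma mv_meromorphic_iff: "mv_meromorphic d F \<longleftrightarrow> (\<forall>a\<in>cspace d. mv_meromorphic_at d F a)"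
  by (auto simp: mv_meromorphic_def mv_meromorphic_at_def mv_quotient_on_def)

text \<open>The point at issue is that \<open>Q\<close> does not vanish identically on the smaller
  polydisc, which is the identity theorem. Two local quotients can thus be moved to a common
  radius.\<close>

lemma mv_quotient_on_shrink:
  assumes "mv_quotient_on d F (polydisc d a r) P Q" "a \<in> cspace d" "0 < r'" "r' \<le> r"
  shows "mv_quotient_on d F (polydisc d a r') P Q"
proof -
  have sub: "polydisc d a r' \<subseteq> polydisc d a r" using assms polydisc_mono by blast
  have "a \<in> polydisc d a r" using assms by (auto intro: polydisc_center)
  then have "\<exists>t\<in>polydisc d a r'. Q t \<noteq> 0"
    using nonvanishing_dense[of d Q a r a r'] assms by (auto simp: mv_quotient_on_def)
  then show ?thesis
    using assms(1) sub unfolding mv_quotient_on_def by (blast intro: mv_holomorphic_on_subset)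
qed

lemma mv_meromorphic_at_radius:
  assumes "mv_meromorphic_at d F a"
  shows "\<exists>r0>0. \<exists>P Q. \<forall>r. 0 < r \<longrightarrow> r \<le> r0 \<longrightarrow> mv_quotient_on d F (polydisc d a r) P Q"
  using assms mv_quotient_on_shrink unfolding mv_meromorphic_at_def by metis

lemma mv_meromorphic_at_cong:
  assumes "mv_meromorphic_at d F a" "r1 > 0" "\<And>s. s \<in> polydisc d a r1 \<Longrightarrow> F s = G s"
  shows "mv_meromorphic_at d G a"
proof -
  obtain r0 P Q where r0: "r0 > 0"
    "\<And>r. 0 < r \<Longrightarrow> r \<le> r0 \<Longrightarrow> mv_quotient_on d F (polydisc d a r) P Q"
    using mv_meromorphic_at_radius[OF assms(1)] by blast
  have "mv_quotient_on d F (polydisc d a (min r0 r1)) P Q" using r0 assms(2) by auto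
  moreover have "polydisc d a (min r0 r1) \<subseteq> polydisc d a r1" by (auto intro!: polydisc_mono)
  ultimately have "mv_quotient_on d G (polydisc d a (min r0 r1)) P Q"
    using assms(3) unfolding mv_quotient_on_def by fastforce
  then show ?thesis using r0 assms unfolding mv_meromorphic_at_def
    by (meson min_less_iff_conj)
qed

lemma mv_meromorphic_at_holomorphic:
  assumes "mv_holomorphic_on d F (polydisc d a r)" "r > 0" "a \<in> cspace d"
  shows "mv_meromorphic_at d F a"
  unfolding mv_meromorphic_at_def mv_quotient_on_def
  using assms polydisc_center[of a d r]
  by (intro conjI exI[of _ r] exI[of _ F] exI[of _ "\<lambda>_. 1"] mv_holomorphic_const) auto

lemma mv_meromorphic_at_binary:
  assumes "mv_meromorphic_at d F a" "mv_meromorphic_at d G a"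
  shows mv_meromorphic_at_add: "mv_meromorphic_at d (\<lambda>s. F s + G s) a"
    and mv_meromorphic_at_mult: "mv_meromorphic_at d (\<lambda>s. F s * G s) a"
proof -
  have a: "a \<in> cspace d" using assms by (simp add: mv_meromorphic_at_def)
  obtain r1 P1 Q1 where 1: "r1 > 0"
    "\<And>r. 0 < r \<Longrightarrow> r \<le> r1 \<Longrightarrow> mv_quotient_on d F (polydisc d a r) P1 Q1"
    using mv_meromorphic_at_radius[OF assms(1)] by blast
  obtain r2 P2 Q2 where 2: "r2 > 0"
    "\<And>r. 0 < r \<Longrightarrow> r \<le> r2 \<Longrightarrow> mv_quotient_on d G (polydisc d a r) P2 Q2"
    using mv_meromorphic_at_radius[OF assms(2)] by blast
  define r where "r = min r1 r2"
  have r: "r > 0" and q: "mv_quotient_on d F (polydisc d a r) P1 Q1" "mv_quotient_on d G (polydisc d a r) P2 Q2"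
    using 1 2 by (auto simp: r_def)
  have "\<exists>s\<in>polydisc d a r. Q1 s * Q2 s \<noteq> 0"
  proof -
    obtain t \<sigma> where t: "\<sigma> > 0" "t \<in> polydisc d a r" "\<forall>u\<in>polydisc d t \<sigma>. Q1 u \<noteq> 0 \<and> Q2 u \<noteq> 0"
      using nonvanishing_mult[of d Q1 a r Q2 a r] q r a polydisc_center[OF a r]
      by (auto simp: mv_quotient_on_def)
    have "t \<in> polydisc d t \<sigma>" using t by (auto intro!: polydisc_center simp: polydisc_iff)
    with t show ?thesis by auto
  qed
  then have "mv_quotient_on d (\<lambda>s. F s + G s) (polydisc d a r) (\<lambda>s. P1 s * Q2 s + P2 s * Q1 s) (\<lambda>s. Q1 s * Q2 s)"
    "mv_quotient_on d (\<lambda>s. F s * G s) (polydisc d a r) (\<lambda>s. P1 s * P2 s) (\<lambda>s. Q1 s * Q2 s)"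
    using q unfolding mv_quotient_on_def
    by (auto intro!: mv_holomorphic_add mv_holomorphic_mult simp: field_simps)
  then show "mv_meromorphic_at d (\<lambda>s. F s + G s) a" "mv_meromorphic_at d (\<lambda>s. F s * G s) a"
    using a r unfolding mv_meromorphic_at_def by blast+
qed

lemma mv_meromorphic_at_sum:
  assumes "finite I" "a \<in> cspace d" "\<And>i. i \<in> I \<Longrightarrow> mv_meromorphic_at d (F i) a"
  shows "mv_meromorphic_at d (\<lambda>s. \<Sum>i\<in>I. F i s) a"
  using assms
  by (induction I rule: finite_induct)
    (auto intro: mv_meromorphic_at_add mv_meromorphic_at_holomorphic[OF mv_holomorphic_const, of 1])

lemma mv_meromorphic_at_inverse_coord:
  assumes "a \<in> cspace d" "k \<in> {1..d}"
  shows "mv_meromorphic_at d (\<lambda>s. 1 / (s k - c)) a"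
proof -
  have "\<exists>s\<in>polydisc d a 1. s k - c \<noteq> 0"
  proof (cases "a k = c")
    case True
    have "a(k := a k + 1/2) \<in> polydisc d a 1"
      using assms by (auto simp: polydisc_iff cspace_upd dist_norm)
    then show ?thesis using True by (intro bexI[of _ "a(k := a k + 1/2)"]) auto
  next
    case False
    then show ?thesis using polydisc_center[OF assms(1), of 1] by auto
  qed
  then have "mv_quotient_on d (\<lambda>s. 1 / (s k - c)) (polydisc d a 1) (\<lambda>_. 1) (\<lambda>s. s k - c)"
    unfolding mv_quotient_on_def
    by (auto intro!: mv_holomorphic_const mv_holomorphic_diff mv_holomorphic_coord)
  then show ?thesis using assms(1) unfolding mv_meromorphic_at_def by (meson zero_less_one)
qed

section \<open>Merging the last two variables\<close>

text \<open>
  The tuple \<open>(s\<^sub>1, \<dots>, s\<^sub>d\<^sub>-\<^sub>1, s\<^sub>d + s\<^sub>d\<^sub>+\<^sub>1 + v)\<close> at which the depth \<open>d\<close> function is evaluated when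
  the innermost sum of depth \<open>d + 1\<close> is expanded.
\<close>

definition merge_last :: "nat \<Rightarrow> complex \<Rightarrow> (nat \<Rightarrow> complex) \<Rightarrow> nat \<Rightarrow> complex" where
  "merge_last d v s = (\<lambda>j\<in>{1..d}. if j = d then s d + s (Suc d) + v else s j)"

lemma merge_last_cspace: "merge_last d v s \<in> cspace d"
  by (auto simp: merge_last_def cspace_def)

text \<open>The radius doubles because the last coordinate of the merged tuple is a sum of two
  coordinates.\<close>

lemma merge_last_polydisc:
  assumes "s \<in> polydisc (Suc d) a r"
  shows "merge_last d v s \<in> polydisc d (merge_last d v a) (2 * r)"
proof -
  have *: "dist (a j) (s j) < r" if "j \<in> {1..Suc d}" for j
    using assms that by (auto simp: polydisc_iff)
  have "dist (merge_last d v a j) (merge_last d v s j) < 2 * r" if j: "j \<in> {1..d}" for j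
  proof (cases "j = d")
    case True
    have "dist (merge_last d v a j) (merge_last d v s j) = norm ((a d - s d) + (a (Suc d) - s (Suc d)))"
      using True j by (simp add: merge_last_def dist_norm algebra_simps)
    also have "\<dots> \<le> dist (a d) (s d) + dist (a (Suc d)) (s (Suc d))"
      unfolding dist_norm by (rule norm_triangle_ineq)
    also have "\<dots> < r + r" using True j by (intro add_strict_mono *) auto
    finally show ?thesis by simp
  next
    case False
    have "dist (a j) (s j) < 2 * r" using *[of j] j zero_le_dist[of "a j" "s j"] by (simp del: zero_le_dist)
    with False j show ?thesis by (simp add: merge_last_def)
  qed
  then show ?thesis by (auto simp: polydisc_iff merge_last_cspace)
qed

lemma continuous_on_merge_last: "continuous_on U (merge_last d v)"
proof (rule continuous_on_coordinatewise_then_product)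
  fix i
  have [continuous_intros]: "continuous_on U (\<lambda>x::nat \<Rightarrow> complex. x k)" for k
    by (rule continuous_on_subset[OF continuous_on_product_coordinates]) auto
  show "continuous_on U (\<lambda>x. merge_last d v x i)"
    by (cases "i \<in> {1..d}"; cases "i = d") (auto simp: merge_last_def intro!: continuous_intros)
qed

text \<open>Changing a single coordinate of \<open>s\<close> either changes the same coordinate of
  the merged tuple or translates its last one, so the chain rule with a translation suffices. For
  \<open>d = 0\<close> the merged tuple is constant.\<close>

lemma mv_holomorphic_merge_last:
  assumes "mv_holomorphic_on d f V" "\<And>s. s \<in> U \<Longrightarrow> merge_last d v s \<in> V"
  shows "mv_holomorphic_on (Suc d) (\<lambda>s. f (merge_last d v s)) U"
proof -
  have "continuous_on U (\<lambda>s. f (merge_last d v s))"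
    using assms by (intro continuous_on_compose2[OF _ continuous_on_merge_last])
      (auto simp: mv_holomorphic_on_def)
  moreover have "(\<lambda>z. f (merge_last d v (s(j := z)))) field_differentiable at (s j)"
    if s: "s \<in> U" and j: "j \<in> {1..Suc d}" for s j
  proof -
    have fd: "(\<lambda>z. f ((merge_last d v s)(k := z))) field_differentiable at (merge_last d v s k)"
      if "k \<in> {1..d}" for k
      using assms s that by (auto simp: mv_holomorphic_on_def)
    have tr: "(\<lambda>z. z + c) field_differentiable at x" for c x :: complex
      by (intro derivative_intros)
    consider "j \<in> {1..d}" "j \<noteq> d" | "j = d" "d \<ge> 1" | "j = Suc d" "d \<ge> 1" | "j = Suc d" "d = 0"
      using j by force
    then show ?thesis
    proof cases
      case 1
      have "merge_last d v (s(j := z)) = (merge_last d v s)(j := z)" for z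
        using 1 by (auto simp: merge_last_def)
      then show ?thesis using fd[OF 1(1)] 1 by (simp add: merge_last_def)
    next
      case 2
      have "merge_last d v (s(j := z)) = (merge_last d v s)(d := z + (s (Suc d) + v))" for z
        using 2 by (auto simp: merge_last_def)
      moreover have "merge_last d v s d = s d + (s (Suc d) + v)" using 2 by (simp add: merge_last_def)
      ultimately show ?thesis
        using field_differentiable_compose[of "\<lambda>z. z + (s (Suc d) + v)" "s d"
            "\<lambda>z. f ((merge_last d v s)(d := z))"] fd[of d] 2
        by (auto simp: o_def tr)
    next
      case 3
      have "merge_last d v (s(j := z)) = (merge_last d v s)(d := z + (s d + v))" for z
        using 3 by (auto simp: merge_last_def)
      moreover have "merge_last d v s d = s (Suc d) + (s d + v)" using 3 by (simp add: merge_last_def)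
      ultimately show ?thesis
        using field_differentiable_compose[of "\<lambda>z. z + (s d + v)" "s (Suc d)"
            "\<lambda>z. f ((merge_last d v s)(d := z))"] fd[of d] 3
        by (auto simp: o_def tr)
    next
      case 4
      then have "merge_last d v t = (\<lambda>_. undefined)" for t by (auto simp: merge_last_def)
      then show ?thesis by simp
    qed
  qed
  ultimately show ?thesis by (auto simp: mv_holomorphic_on_def)
qed

lemma mv_meromorphic_at_merge_last:
  assumes "mv_meromorphic_at d F (merge_last d v a)" "a \<in> cspace (Suc d)"
  shows "mv_meromorphic_at (Suc d) (\<lambda>s. F (merge_last d v s)) a"
proof -
  obtain r P Q where r: "r > 0"
    "\<And>r'. 0 < r' \<Longrightarrow> r' \<le> r \<Longrightarrow> mv_quotient_on d F (polydisc d (merge_last d v a) r') P Q"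
    using mv_meromorphic_at_radius[OF assms(1)] by blast
  let ?U = "polydisc (Suc d) a (r / 2)" and ?V = "polydisc d (merge_last d v a) r"
  have UV: "merge_last d v s \<in> ?V" if "s \<in> ?U" for s
    using merge_last_polydisc[OF that] by simp
  have q: "mv_quotient_on d F ?V P Q" using r by simp
  have "\<exists>s\<in>?U. Q (merge_last d v s) \<noteq> 0"
  proof -
    obtain t where t: "t \<in> polydisc d (merge_last d v a) (r / 2)" "Q t \<noteq> 0"
      using r(2)[of "r / 2"] r(1) by (auto simp: mv_quotient_on_def)
    \<comment> \<open>A preimage of \<open>t\<close> under \<open>merge_last d v\<close>: the
      coordinate \<open>Suc d\<close> stays at \<open>a\<close> and coordinate \<open>d\<close>
      absorbs the whole difference. It shows that the pulled-back denominator does not vanish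
      identically.\<close>
    define s where "s = (\<lambda>j. if j \<in> {1..<d} then t j else if j = d \<and> d \<ge> 1 then t d - a (Suc d) - v else a j)"
    have m: "merge_last d v s = t"
      using t(1) by (auto simp: merge_last_def s_def polydisc_iff cspace_def PiE_iff extensional_def fun_eq_iff)
    have "dist (a j) (s j) < r / 2" if j: "j \<in> {1..Suc d}" for j
    proof (cases "j \<in> {1..d}")
      case True
      then have "dist (merge_last d v a j) (t j) < r / 2" using t(1) by (auto simp: polydisc_iff)
      moreover have "dist (merge_last d v a j) (t j) = dist (a j) (s j)"
        using True by (auto simp: merge_last_def s_def dist_norm algebra_simps)
      ultimately show ?thesis by simp
    next
      case False
      then show ?thesis using r(1) j by (auto simp: s_def)
    qed
    moreover have "s \<in> cspace (Suc d)"
      using assms(2) by (auto simp: cspace_def PiE_iff extensional_def s_def)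
    ultimately have "s \<in> ?U" by (auto simp: polydisc_iff)
    then show ?thesis using m t(2) by auto
  qed
  then have "mv_quotient_on (Suc d) (\<lambda>s. F (merge_last d v s)) ?U
      (\<lambda>s. P (merge_last d v s)) (\<lambda>s. Q (merge_last d v s))"
    using q UV unfolding mv_quotient_on_def by (auto intro!: mv_holomorphic_merge_last)
  then show ?thesis using r(1) assms(2) unfolding mv_meromorphic_at_def by (meson half_gt_zero)
qed

text \<open>Weaker than equality on \<open>U\<close>, since meromorphic functions may take arbitrary
  values where their denominators vanish.\<close>

definition agree_densely ::
  "nat \<Rightarrow> ((nat \<Rightarrow> complex) \<Rightarrow> complex) \<Rightarrow> ((nat \<Rightarrow> complex) \<Rightarrow> complex) \<Rightarrow> (nat \<Rightarrow> complex) set \<Rightarrow> bool" where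
  "agree_densely d F G U \<longleftrightarrow> (\<forall>b\<in>U. \<forall>\<rho>>0. \<exists>t\<in>polydisc d b \<rho>. F t = G t)"

text \<open>The cross difference \<open>P * Q' - P' * Q\<close> is holomorphic. If it were nonzero
  somewhere near \<open>c\<close>, it would be nonzero on a small polydisc on which both
  denominators have no zeros, hence \<open>F\<close> and \<open>G\<close> would differ throughout
  it. So it vanishes near \<open>c\<close>, and everywhere by the identity theorem.\<close>

lemma agree_densely_propagate:
  assumes F: "mv_quotient_on d F (polydisc d a r) P Q" and G: "mv_quotient_on d G (polydisc d a r) P' Q'"
    and c: "c \<in> polydisc d a r" "\<rho> > 0" "agree_densely d F G (polydisc d c \<rho>)"
  shows "agree_densely d F G (polydisc d a r)"
proof -
  let ?N = "\<lambda>s. P s * Q' s - P' s * Q s"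
  have hol: "mv_holomorphic_on d Q (polydisc d a r)" "mv_holomorphic_on d Q' (polydisc d a r)"
    and nz: "\<exists>s\<in>polydisc d a r. Q s \<noteq> 0" "\<exists>s\<in>polydisc d a r. Q' s \<noteq> 0"
    using F G by (auto simp: mv_quotient_on_def)
  have N: "mv_holomorphic_on d ?N (polydisc d a r)"
    using F G by (auto simp: mv_quotient_on_def intro!: mv_holomorphic_diff mv_holomorphic_mult)
  have N0: "?N s = 0" if s: "s \<in> polydisc d c \<rho>" "s \<in> polydisc d a r" for s
  proof (rule ccontr)
    assume "?N s \<noteq> 0"
    then obtain \<sigma> where \<sigma>: "\<sigma> > 0" "\<And>t. t \<in> polydisc d s \<sigma> \<Longrightarrow> ?N t \<noteq> 0"
      using continuous_on_polydisc_nonzero[of d a r ?N s] N s by (auto simp: mv_holomorphic_on_def)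
    obtain \<sigma>' where \<sigma>': "\<sigma>' > 0" "polydisc d s \<sigma>' \<subseteq> polydisc d c \<rho>" using polydisc_inner[OF s(1)] by blast
    have sub: "polydisc d s (min \<sigma> \<sigma>') \<subseteq> polydisc d s \<sigma>" "polydisc d s (min \<sigma> \<sigma>') \<subseteq> polydisc d s \<sigma>'"
      by (auto intro!: polydisc_mono)
    obtain t \<tau> where t: "\<tau> > 0" "t \<in> polydisc d s (min \<sigma> \<sigma>')"
      "polydisc d t \<tau> \<subseteq> polydisc d a r \<inter> polydisc d s (min \<sigma> \<sigma>')"
      "\<forall>u\<in>polydisc d t \<tau>. Q u \<noteq> 0 \<and> Q' u \<noteq> 0"
      using nonvanishing_mult[OF hol nz s(2), of "min \<sigma> \<sigma>'"] \<sigma> \<sigma>' by auto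
    have "t \<in> polydisc d c \<rho>" using t(2) sub \<sigma>' by blast
    then obtain u where u: "u \<in> polydisc d t \<tau>" "F u = G u"
      using c(3) t(1) unfolding agree_densely_def by blast
    then have "P u / Q u = P' u / Q' u" "Q u \<noteq> 0" "Q' u \<noteq> 0"
      using F G t(3,4) by (auto simp: mv_quotient_on_def subset_iff)
    then have "?N u = 0" by (simp add: field_simps)
    then show False using \<sigma>(2) u(1) t(3) sub by blast
  qed
  have N0': "?N s = 0" if "s \<in> polydisc d a r" for s
    using mv_holomorphic_identity[OF N c(1,2) N0 that] .
  show ?thesis unfolding agree_densely_def
  proof (intro ballI allI impI)
    fix b \<sigma> assume b: "b \<in> polydisc d a r" "(\<sigma>::real) > 0"
    obtain t \<tau> where t: "\<tau> > 0" "t \<in> polydisc d b \<sigma>"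
      "polydisc d t \<tau> \<subseteq> polydisc d a r \<inter> polydisc d b \<sigma>"
      "\<forall>u\<in>polydisc d t \<tau>. Q u \<noteq> 0 \<and> Q' u \<noteq> 0"
      using nonvanishing_mult[OF hol nz b] by auto
    have "t \<in> polydisc d t \<tau>" using t by (auto intro!: polydisc_center simp: polydisc_iff)
    then have "Q t \<noteq> 0" "Q' t \<noteq> 0" "t \<in> polydisc d a r" using t by auto
    moreover from this have "F t = P t / Q t" "G t = P' t / Q' t" using F G by (auto simp: mv_quotient_on_def)
    ultimately have "F t = G t" using N0'[of t] by (simp add: frac_eq_eq)
    then show "\<exists>t\<in>polydisc d b \<sigma>. F t = G t" using t(2) by blast
  qed
qed

text \<open>Along the segment from \<open>a\<close> to \<open>b\<close>, dense agreement near the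
  current point is a locally constant property, and the parameter line is connected.\<close>

lemma mv_meromorphic_unique:
  assumes F: "mv_meromorphic d F" and G: "mv_meromorphic d G"
    and a: "a \<in> cspace d" "r > 0" "\<And>t. t \<in> polydisc d a r \<Longrightarrow> F t = G t"
    and b: "b \<in> cspace d" "\<rho> > 0" "mv_holomorphic_on d F (polydisc d b \<rho>)"
    "\<rho>' > 0" "mv_holomorphic_on d G (polydisc d b \<rho>')"
  shows "F b = G b"
proof -
  define \<gamma> :: "real \<Rightarrow> nat \<Rightarrow> complex" where
    "\<gamma> = (\<lambda>\<tau>. \<lambda>j\<in>{1..d}. a j + of_real \<tau> * (b j - a j))"
  have \<gamma>c: "\<gamma> \<tau> \<in> cspace d" for \<tau> by (auto simp: \<gamma>_def cspace_def)
  have \<gamma>0: "\<gamma> 0 = a" and \<gamma>1: "\<gamma> 1 = b"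
    using a(1) b(1) by (auto simp: \<gamma>_def cspace_def PiE_iff extensional_def fun_eq_iff)
  have \<gamma>cont: "continuous_on UNIV \<gamma>"
  proof (rule continuous_on_coordinatewise_then_product)
    fix i show "continuous_on UNIV (\<lambda>\<tau>. \<gamma> \<tau> i)"
      by (cases "i \<in> {1..d}") (auto simp: \<gamma>_def intro!: continuous_intros)
  qed
  define A where "A \<tau> \<longleftrightarrow> (\<exists>\<rho>>0. agree_densely d F G (polydisc d (\<gamma> \<tau>) \<rho>))" for \<tau>
  have "A 1"
  proof (rule connected_induction_simple[of "UNIV :: real set" 0 1 A])
    show "A 0" unfolding A_def \<gamma>0
    proof (intro exI conjI)
      show "agree_densely d F G (polydisc d a r)"
        using a(3) polydisc_center unfolding agree_densely_def by (metis polydisc_iff)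
    qed fact
    show "\<exists>T. openin (top_of_set UNIV) T \<and> \<tau> \<in> T \<and> (\<forall>x\<in>T. \<forall>y\<in>T. A x \<longrightarrow> A y)" for \<tau> :: real
    proof -
      have "mv_meromorphic_at d F (\<gamma> \<tau>)" "mv_meromorphic_at d G (\<gamma> \<tau>)"
        using F G \<gamma>c by (auto simp: mv_meromorphic_iff)
      then obtain r1 P Q r2 P' Q' where 1: "r1 > 0"
        "\<And>r. 0 < r \<Longrightarrow> r \<le> r1 \<Longrightarrow> mv_quotient_on d F (polydisc d (\<gamma> \<tau>) r) P Q"
        and 2: "r2 > 0" "\<And>r. 0 < r \<Longrightarrow> r \<le> r2 \<Longrightarrow> mv_quotient_on d G (polydisc d (\<gamma> \<tau>) r) P' Q'"
        using mv_meromorphic_at_radius by meson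
      define r where "r = min r1 r2"
      have r: "r > 0" and q: "mv_quotient_on d F (polydisc d (\<gamma> \<tau>) r) P Q"
        "mv_quotient_on d G (polydisc d (\<gamma> \<tau>) r) P' Q'"
        using 1 2 by (auto simp: r_def)
      obtain V where V: "open V" "polydisc d (\<gamma> \<tau>) r = cspace d \<inter> V" using polydisc_open_in .
      define T where "T = \<gamma> -` V"
      have "open T" unfolding T_def using V(1) \<gamma>cont by (simp add: open_vimage)
      moreover have "\<tau> \<in> T" using V(2) polydisc_center[OF \<gamma>c r, of \<tau>] by (auto simp: T_def)
      moreover have "A y" if xy: "x \<in> T" "y \<in> T" "A x" for x y
      proof -
        have x: "\<gamma> x \<in> polydisc d (\<gamma> \<tau>) r" and y: "\<gamma> y \<in> polydisc d (\<gamma> \<tau>) r"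
          using xy V(2) \<gamma>c by (auto simp: T_def)
        obtain \<rho> where "\<rho> > 0" "agree_densely d F G (polydisc d (\<gamma> x) \<rho>)" using xy(3) by (auto simp: A_def)
        then have ad: "agree_densely d F G (polydisc d (\<gamma> \<tau>) r)"
          using agree_densely_propagate[OF q x] by blast
        obtain \<sigma> where "\<sigma> > 0" "polydisc d (\<gamma> y) \<sigma> \<subseteq> polydisc d (\<gamma> \<tau>) r" using polydisc_inner[OF y] by blast
        then show ?thesis using ad unfolding A_def agree_densely_def by blast
      qed
      ultimately show ?thesis by auto
    qed
  qed auto
  then obtain \<sigma> where \<sigma>: "\<sigma> > 0" "agree_densely d F G (polydisc d b \<sigma>)" by (auto simp: A_def \<gamma>1)
  define m where "m = min \<rho> \<rho>'"
  have m: "m > 0" using b by (auto simp: m_def)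
  \<comment> \<open>Holomorphy near \<open>b\<close> turns dense agreement into equality at
    \<open>b\<close>: a nonzero difference there would persist on a polydisc.\<close>
  have "continuous_on (polydisc d b m) (\<lambda>s. F s - G s)"
    using mv_holomorphic_on_subset[OF b(3) polydisc_mono, of m] mv_holomorphic_on_subset[OF b(5) polydisc_mono, of m]
    by (auto simp: mv_holomorphic_on_def m_def intro!: continuous_intros)
  then show ?thesis
    using continuous_on_polydisc_nonzero[of d b m "\<lambda>s. F s - G s" b] polydisc_center[OF b(1) m]
      polydisc_center[OF b(1) \<sigma>(1)] \<sigma>(2)
    unfolding agree_densely_def by fastforce
qed

section \<open>Euler--Maclaurin summation and partial sums\<close>

definition bern_coeff :: "nat \<Rightarrow> complex" where
  "bern_coeff p = bernoulli_number p / fact p"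

text \<open>The quotient is exact because \<open>fps_exp 1 - 1\<close> has subdegree 1 and hence
  divides \<open>fps_X\<close>.\<close>

lemma bern_fps_times: "(fps_X / (fps_exp 1 - 1)) * (fps_exp 1 - 1) = (fps_X :: complex fps)"
proof -
  have sd: "subdegree (fps_exp 1 - 1 :: complex fps) = 1" by (rule subdegreeI) auto
  then have "(fps_exp 1 - 1 :: complex fps) \<noteq> 0" by auto
  then have "(fps_exp 1 - 1 :: complex fps) dvd fps_X" using sd by (simp add: fps_dvd_iff)
  then show ?thesis by (rule dvd_div_mult_self)
qed

lemma bern_coeff_nth: "bern_coeff p = fps_nth (fps_X / (fps_exp 1 - 1)) p"
  by (simp add: bern_coeff_def bernoulli_number_def)

text \<open>This compares coefficients in \<open>bern_fps_times\<close>. The extra 1 at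
  \<open>q = 1\<close> is what produces the summand in Euler--Maclaurin summation.\<close>

lemma bern_coeff_conv: "(\<Sum>p\<le>q. bern_coeff p / fact (q - p)) = bern_coeff q + (if q = 1 then 1 else 0)"
proof -
  have "(if q = 1 then 1 else 0) = fps_nth ((fps_X / (fps_exp 1 - 1)) * (fps_exp 1 - 1) :: complex fps) q"
    unfolding bern_fps_times by (simp add: fps_X_def)
  also have "\<dots> = (\<Sum>p=0..q. bern_coeff p * (1 / fact (q - p) - (if q - p = 0 then 1 else 0)))"
    by (simp add: fps_mult_nth bern_coeff_nth)
  also have "\<dots> = (\<Sum>p\<le>q. bern_coeff p / fact (q - p)) - (\<Sum>p\<le>q. if p = q then bern_coeff p else 0)"
    unfolding sum_subtractf[symmetric] atLeast0AtMost
    by (intro sum.cong) (auto simp: algebra_simps)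
  finally show ?thesis by (simp add: algebra_simps)
qed

text \<open>Up to the sign \<open>(-1) ^ p\<close>, this is the \<open>p\<close>-th derivative of
  \<open>z powr - w\<close>.\<close>

definition em_term :: "complex \<Rightarrow> nat \<Rightarrow> complex \<Rightarrow> complex" where
  "em_term w p z = pochhammer w p * z powr (- w - of_nat p)"

text \<open>The Euler--Maclaurin approximation to \<open>w\<close> times the sum of
  \<open>m powr (- w - 1)\<close> over all \<open>m > n\<close>.\<close>

definition em_main :: "nat \<Rightarrow> nat \<Rightarrow> complex \<Rightarrow> complex" where
  "em_main l n w = (\<Sum>p\<le>l. bern_coeff p * em_term w p (of_nat n))"

text \<open>
  Euler--Maclaurin summation of \<open>w (n + 1)\<^sup>-\<^sup>w\<^sup>-\<^sup>1\<close>. Multiplying by \<open>w = s - 1\<close> removes the pole of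
  the term \<open>p = 0\<close>, so that every quantity is entire in \<open>w\<close>.
\<close>

definition em_rem :: "nat \<Rightarrow> nat \<Rightarrow> complex \<Rightarrow> complex" where
  "em_rem l n w = em_main l n w - em_main l (Suc n) w - w * of_nat (Suc n) powr (- w - 1)"

lemma em_term_deriv:
  assumes "Re z > 0"
  shows "(em_term w p has_field_derivative - em_term w (Suc p) z) (at z within S)"
proof -
  have "z \<notin> \<real>\<^sub>\<le>\<^sub>0" using assms complex_nonpos_Reals_iff by fastforce
  then have "((\<lambda>z. pochhammer w p * z powr (- w - of_nat p)) has_field_derivative
      pochhammer w p * ((- w - of_nat p) * z powr (- w - of_nat p - 1))) (at z within S)"
    by (auto intro!: derivative_eq_intros)
  moreover have "pochhammer w p * ((- w - of_nat p) * z powr (- w - of_nat p - 1)) = - em_term w (Suc p) z"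
    by (simp add: em_term_def pochhammer_Suc algebra_simps)
  ultimately show ?thesis by (simp add: em_term_def[abs_def])
qed

text \<open>Taylor expansion at \<open>n + 1\<close> with increment \<open>-1\<close>; the signs of
  the increment cancel those of the derivatives. Stopping at order \<open>l - p\<close> makes every
  error a multiple of the derivative of order \<open>l + 1\<close>, whose norm is decreasing in
  \<open>z\<close> by the condition on \<open>Re w\<close> and so is largest at
  \<open>n\<close>.\<close>

lemma em_term_taylor:
  assumes "n \<ge> 1" "p \<le> l" "Re w + real l + 1 \<ge> 0"
  shows "norm (em_term w p (of_nat n) - (\<Sum>i\<le>l - p. em_term w (p + i) (of_nat (Suc n)) / fact i))
    \<le> norm (pochhammer w (Suc l)) * real n powr (- Re w - real l - 1) / fact (l - p)"
proof -
  let ?S = "closed_segment (of_nat n) (of_nat (Suc n)) :: complex set"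
  define B where "B = norm (pochhammer w (Suc l)) * real n powr (- Re w - real l - 1)"
  have S: "\<exists>x. z = of_real x \<and> real n \<le> x" if "z \<in> ?S" for z
  proof -
    obtain u where u: "z = (1 - u) *\<^sub>R of_nat n + u *\<^sub>R of_nat (Suc n)" "0 \<le> u"
      using \<open>z \<in> ?S\<close> by (auto simp: in_segment)
    have "z = of_real (real n + u)" unfolding u(1) by (simp add: scaleR_conv_of_real algebra_simps)
    then show ?thesis using u(2) by (intro exI[of _ "real n + u"]) auto
  qed
  have "norm ((-1) ^ 0 * em_term w (p + 0) (of_nat n) -
      (\<Sum>i\<le>l - p. ((-1) ^ i * em_term w (p + i) (of_nat (Suc n))) * (of_nat n - of_nat (Suc n)) ^ i / fact i))
    \<le> B * norm (of_nat n - of_nat (Suc n) :: complex) ^ Suc (l - p) / fact (l - p)"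
  proof (rule complex_Taylor[where S = ?S and f = "\<lambda>i z. (-1) ^ i * em_term w (p + i) z"])
    show "convex ?S" by simp
    show "((\<lambda>z. (-1) ^ i * em_term w (p + i) z) has_field_derivative (-1) ^ Suc i * em_term w (p + Suc i) z) (at z within ?S)"
      if "z \<in> ?S" for i z
      using S[OF that] assms(1)
      by (auto intro!: derivative_eq_intros em_term_deriv)
    show "norm ((-1) ^ Suc (l - p) * em_term w (p + Suc (l - p)) z) \<le> B" if z: "z \<in> ?S" for z
    proof -
      obtain x where x: "z = of_real x" "real n \<le> x" using S[OF z] by blast
      have "norm ((-1) ^ Suc (l - p) * em_term w (p + Suc (l - p)) z)
          = norm (pochhammer w (Suc l)) * norm (z powr (- w - of_nat (Suc l)))"
        using assms(2) by (simp add: em_term_def norm_mult norm_power)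
      also have "norm (z powr (- w - of_nat (Suc l))) = x powr (- Re w - real l - 1)"
        using x assms(1) by (simp add: norm_powr_real_powr' norm_powr_real_powr algebra_simps)
      also have "\<dots> \<le> real n powr (- Re w - real l - 1)"
        using x assms by (intro powr_mono2') auto
      finally show ?thesis unfolding B_def by (simp add: mult_left_mono)
    qed
  qed auto
  moreover have "((-1) ^ i * e) * (of_nat n - of_nat (Suc n)) ^ i = (e :: complex)" for i e
    by (simp flip: power_mult_distrib)
  moreover have "norm (of_nat n - of_nat (Suc n) :: complex) = 1" by simp
  ultimately show ?thesis unfolding B_def by (simp del: of_nat_Suc)
qed

definition em_const :: "nat \<Rightarrow> real" where
  "em_const l = (\<Sum>p\<le>l. norm (bern_coeff p) / fact (l - p))"

lemma em_const_nonneg: "em_const l \<ge> 0"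
  by (auto simp: em_const_def intro!: sum_nonneg)

text \<open>
  After Taylor expansion around \<open>n + 1\<close>, all orders up to \<open>l\<close> cancel by the Bernoulli recursion.
  The factor \<open>pochhammer w (Suc l)\<close> has to be kept: it compensates the poles of \<open>Gamma w\<close>.
\<close>

lemma em_rem_bound:
  assumes "n \<ge> 1" "l \<ge> 1" "Re w + real l + 1 \<ge> 0"
  shows "norm (em_rem l n w) \<le> em_const l * norm (pochhammer w (Suc l)) * real n powr (- Re w - real l - 1)"
proof -
  let ?e = "\<lambda>p. em_term w p (of_nat (Suc n))"
  define D where "D p = em_term w p (of_nat n) - (\<Sum>i\<le>l - p. ?e (p + i) / fact i)" for p
  have "(\<Sum>p\<le>l. bern_coeff p * (\<Sum>i\<le>l - p. ?e (p + i) / fact i))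
      = (\<Sum>(p, i)\<in>(SIGMA p:{..l}. {..l - p}). bern_coeff p * (?e (p + i) / fact i))"
    by (simp add: sum_distrib_left sum.Sigma)
  also have "(SIGMA p:{..l}. {..l - p}) = {(i, j). i + j \<le> l}" by auto
  also have "(\<Sum>(p, i)\<in>\<dots>. bern_coeff p * (?e (p + i) / fact i))
      = (\<Sum>q\<le>l. \<Sum>p\<le>q. bern_coeff p * (?e (p + (q - p)) / fact (q - p)))"
    by (rule sum.triangle_reindex_eq)
  also have "\<dots> = (\<Sum>q\<le>l. ?e q * (\<Sum>p\<le>q. bern_coeff p / fact (q - p)))"
    by (auto simp: sum_distrib_left intro!: sum.cong)
  also have "\<dots> = (\<Sum>q\<le>l. bern_coeff q * ?e q) + (\<Sum>q\<le>l. if q = 1 then ?e q else 0)"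
    unfolding bern_coeff_conv sum.distrib[symmetric] by (intro sum.cong) (auto simp: algebra_simps)
  \<comment> \<open>The only term that survives is \<open>w * of_nat (Suc n) powr (- w - 1)\<close>,
    the summand subtracted in \<open>em_rem\<close>; \<open>l \<ge> 1\<close> makes sure that it
    occurs.\<close>
  also have "(\<Sum>q\<le>l. if q = 1 then ?e q else 0) = ?e 1"
    using assms(2) by (subst sum.delta) auto
  finally have "em_rem l n w = (\<Sum>p\<le>l. bern_coeff p * D p)"
    by (simp add: em_rem_def em_main_def D_def algebra_simps sum_subtractf em_term_def)
  then have "norm (em_rem l n w) \<le> (\<Sum>p\<le>l. norm (bern_coeff p * D p))" by (simp add: norm_sum)
  also have "\<dots> \<le> (\<Sum>p\<le>l. norm (bern_coeff p) *
      (norm (pochhammer w (Suc l)) * real n powr (- Re w - real l - 1) / fact (l - p)))"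
    unfolding norm_mult D_def using em_term_taylor[OF assms(1) _ assms(3)]
    by (intro sum_mono mult_left_mono) auto
  also have "\<dots> = em_const l * norm (pochhammer w (Suc l)) * real n powr (- Re w - real l - 1)"
    by (simp add: em_const_def sum_distrib_right mult.assoc)
  finally show ?thesis .
qed

text \<open>
  The sum of \<open>\<Prod> n\<^sub>i\<close> \<open>powr\<close> \<open>- s\<^sub>i\<close> over \<open>1 \<le> n\<^sub>1 < \<dots> < n\<^sub>k \<le> n\<close>, where \<open>n\<^sub>i = m\<^sub>1 + \<dots> + m\<^sub>i\<close>.
\<close>

primrec psum :: "(nat \<Rightarrow> 'a :: {real_normed_field,ln}) \<Rightarrow> nat \<Rightarrow> nat \<Rightarrow> 'a" where
  "psum s 0 n = 1"
| "psum s (Suc k) n = (\<Sum>N<n. of_nat (Suc N) powr (- s (Suc k)) * psum s k N)"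

lemma psum_cong: "(\<And>j. j \<in> {1..k} \<Longrightarrow> s j = t j) \<Longrightarrow> psum s k n = psum t k n"
proof (induction k arbitrary: n)
  case (Suc k)
  then have "psum s k N = psum t k N" for N by auto
  then show ?case using Suc.prems by simp
qed simp

text \<open>Summation by parts: a jump of \<open>psum s d\<close> carries the base
  \<open>Suc M\<close> of its last factor, so weighting it by \<open>of_nat (Suc M) powr - v\<close>
  adds \<open>v\<close> to the exponent \<open>s d\<close>. For \<open>d = 0\<close> the sum
  telescopes. The general type serves the complex sums and their real majorants; \<open>one\<close>
  is needed for the first boundary value.\<close>

lemma psum_abel:
  fixes s :: "nat \<Rightarrow> 'a :: {real_normed_field,ln}"
  assumes one: "\<And>v. (1 :: 'a) powr v = 1"
  shows "(\<Sum>n<M. psum s d (Suc n) * (of_nat (Suc n) powr - v - of_nat (Suc (Suc n)) powr - v))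
    = psum (s(d := s d + v)) d M - psum s d M * of_nat (Suc M) powr - v"
proof (induction M)
  case 0
  then show ?case by (cases d) (auto simp: one)
next
  case (Suc M)
  have "psum (s(d := s d + v)) d (Suc M) - psum (s(d := s d + v)) d M
      = of_nat (Suc M) powr - v * (psum s d (Suc M) - psum s d M)"
  proof (cases d)
    case (Suc k)
    have "psum (s(Suc k := s (Suc k) + v)) k n = psum s k n" for n
      by (rule psum_cong) auto
    moreover have "(of_nat (Suc M) :: 'a) powr - (s (Suc k) + v) = of_nat (Suc M) powr - s (Suc k) * of_nat (Suc M) powr - v"
      by (simp flip: powr_add)
    ultimately show ?thesis using Suc by (simp del: of_nat_Suc minus_add_distrib)
  qed simp
  then have "psum (s(d := s d + v)) d (Suc M) =
      psum (s(d := s d + v)) d M + of_nat (Suc M) powr - v * (psum s d (Suc M) - psum s d M)"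
    by (simp only: diff_eq_eq add.commute)
  then show ?case unfolding sum.lessThan_Suc Suc.IH by (simp only: ring_distribs) simp
qed

section \<open>Real majorants of the partial sums\<close>

lemma norm_of_nat_powr: "norm ((of_nat n :: complex) powr z) = real n powr Re z"
  by (subst norm_powr_real_powr) auto

lemma psum_real_nonneg: "psum (\<sigma> :: nat \<Rightarrow> real) k n \<ge> 0"
  by (induction k arbitrary: n) (auto intro!: sum_nonneg mult_nonneg_nonneg)

lemma psum_real_mono:
  assumes "m \<le> n"
  shows "psum (\<sigma> :: nat \<Rightarrow> real) k m \<le> psum \<sigma> k n"
  using assms psum_real_nonneg by (cases k) (auto intro!: sum_mono2 mult_nonneg_nonneg)

lemma norm_psum_le:
  assumes "\<And>j. j \<in> {1..k} \<Longrightarrow> \<sigma> j \<le> Re (s j)"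
  shows "norm (psum s k n) \<le> psum \<sigma> k n"
  using assms
proof (induction k arbitrary: n)
  case (Suc k)
  have "norm (of_nat (Suc N) powr - s (Suc k) * psum s k N) \<le> real (Suc N) powr - \<sigma> (Suc k) * psum \<sigma> k N" for N
  proof -
    have "norm ((of_nat (Suc N) :: complex) powr - s (Suc k)) = real (Suc N) powr - Re (s (Suc k))"
      by (simp only: norm_of_nat_powr uminus_complex.sel)
    also have "\<dots> \<le> real (Suc N) powr - \<sigma> (Suc k)" using Suc.prems by (intro powr_mono) auto
    finally show ?thesis unfolding norm_mult using Suc.IH Suc.prems by (intro mult_mono) auto
  qed
  then show ?case by (simp del: of_nat_Suc) (intro order_trans[OF norm_sum] sum_mono)
qed simp

text \<open>Comparison with an integral, in mean value form. The right-hand side is a difference to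
  which \<open>psum_abel\<close> applies.\<close>

lemma powr_tail_le:
  fixes \<sigma> :: real
  assumes "\<sigma> > 1" "n \<ge> 1"
  shows "real (Suc n) powr - \<sigma> \<le> (real n powr - (\<sigma> - 1) - real (Suc n) powr - (\<sigma> - 1)) / (\<sigma> - 1)"
proof -
  have "\<exists>z>real n. z < real (Suc n) \<and> real (Suc n) powr (1 - \<sigma>) - real n powr (1 - \<sigma>)
     = (real (Suc n) - real n) * ((1 - \<sigma>) * z powr (1 - \<sigma> - 1))"
    by (rule MVT2[OF _ has_real_derivative_powr]) (use assms in auto)
  then obtain z where z: "z > real n" "z < real (Suc n)"
    "real (Suc n) powr (1 - \<sigma>) - real n powr (1 - \<sigma>) = (1 - \<sigma>) * z powr - \<sigma>" by auto
  have "real (Suc n) powr - \<sigma> \<le> z powr - \<sigma>" using z assms by (intro powr_mono2') auto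
  also have "z powr - \<sigma> = (real n powr (1 - \<sigma>) - real (Suc n) powr (1 - \<sigma>)) / (\<sigma> - 1)"
    using z(3) assms by (simp add: field_simps)
  finally show ?thesis by simp
qed

text \<open>The terms of the outermost sum are dominated by differences with exponent
  \<open>\<tau> - 1\<close>, and summation by parts moves this exponent into \<sigma> at
  \<open>d\<close>. All tail sums then drop by 1, exactly as much as the bound required of them when
  the depth decreases.\<close>

lemma psum_real_bounded:
  fixes \<sigma> :: "nat \<Rightarrow> real"
  assumes "\<And>j. j \<in> {1..d} \<Longrightarrow> (\<Sum>i=j..d. \<sigma> i) > real d - real j + 1"
  shows "\<exists>C. \<forall>n. psum \<sigma> d n \<le> C"
  using assms
proof (induction d arbitrary: \<sigma>)
  case 0
  then show ?case by auto
next
  case (Suc d)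
  define \<tau> where "\<tau> = \<sigma> (Suc d)"
  have \<tau>: "\<tau> > 1" using Suc.prems[of "Suc d"] by (simp add: \<tau>_def)
  let ?\<sigma> = "\<sigma>(d := \<sigma> d + (\<tau> - 1))"
  have "real d - real j + 1 < (\<Sum>i=j..d. ?\<sigma> i)" if j: "j \<in> {1..d}" for j
  proof -
    have "(\<Sum>i=j..d. ?\<sigma> i) = (\<Sum>i=j..d. \<sigma> i + (if i = d then \<tau> - 1 else 0))" by (intro sum.cong) auto
    also have "\<dots> = (\<Sum>i=j..Suc d. \<sigma> i) - 1" using j by (simp add: sum.distrib \<tau>_def)
    finally show ?thesis using Suc.prems[of j] j by auto
  qed
  then obtain C where C: "\<And>n. psum ?\<sigma> d n \<le> C" using Suc.IH[of ?\<sigma>] by blast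
  have "psum \<sigma> (Suc d) M \<le> 1 + C / (\<tau> - 1)" for M
  proof -
    have p0: "psum \<sigma> d 0 \<le> 1" by (cases d) auto
    have "psum \<sigma> (Suc d) M \<le> psum \<sigma> (Suc d) (Suc M)" by (rule psum_real_mono) simp
    also have "\<dots> = psum \<sigma> d 0 + (\<Sum>n<M. real (Suc (Suc n)) powr - \<tau> * psum \<sigma> d (Suc n))"
      by (simp add: \<tau>_def sum.lessThan_Suc_shift del: of_nat_Suc sum.lessThan_Suc) (simp add: powr_one_eq_one)
    also have "(\<Sum>n<M. real (Suc (Suc n)) powr - \<tau> * psum \<sigma> d (Suc n)) \<le>
      (\<Sum>n<M. psum \<sigma> d (Suc n) * (real (Suc n) powr - (\<tau> - 1) - real (Suc (Suc n)) powr - (\<tau> - 1)) / (\<tau> - 1))"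
      using powr_tail_le[OF \<tau>] psum_real_nonneg
      by (intro sum_mono) (auto simp: mult.commute intro!: mult_left_mono simp del: of_nat_Suc simp flip: times_divide_eq_right)
    also have "\<dots> = (psum ?\<sigma> d M - psum \<sigma> d M * real (Suc M) powr - (\<tau> - 1)) / (\<tau> - 1)"
      by (subst psum_abel[symmetric]) (auto simp: sum_divide_distrib)
    also have "\<dots> \<le> C / (\<tau> - 1)"
      using \<tau> C[of M] psum_real_nonneg[of \<sigma> d M] by (intro divide_right_mono) (auto intro: order_trans[rotated])
    finally show ?thesis using p0 by linarith
  qed
  then show ?case by blast
qed

section \<open>Partial sums as finite parts of the multiple series\<close>

definition tuples :: "nat \<Rightarrow> nat \<Rightarrow> (nat \<Rightarrow> nat) set" where
  "tuples d N = {t \<in> {1..d} \<rightarrow>\<^sub>E {1..}. (\<Sum>i=1..d. t i) \<le> N}"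

lemma finite_tuples: "finite (tuples d N)"
proof (rule finite_subset)
  show "tuples d N \<subseteq> {1..d} \<rightarrow>\<^sub>E {..N}"
  proof
    fix t assume t: "t \<in> tuples d N"
    have "t j \<le> N" if "j \<in> {1..d}" for j
    proof -
      have "t j \<le> (\<Sum>i=1..d. t i)" using that by (intro member_le_sum) auto
      then show ?thesis using t by (auto simp: tuples_def)
    qed
    then show "t \<in> {1..d} \<rightarrow>\<^sub>E {..N}" using t by (auto simp: tuples_def PiE_iff)
  qed
qed (auto intro!: finite_PiE)

lemma psum_tuples:
  fixes s :: "nat \<Rightarrow> 'a :: {real_normed_field,ln}"
  shows "psum s d N = (\<Sum>t\<in>tuples d N. \<Prod>k=1..d. of_nat (\<Sum>i=1..k. t i) powr (- s k))"
proof (induction d arbitrary: N)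
  case 0
  have "tuples 0 N = {\<lambda>_. undefined}" by (auto simp: tuples_def)
  then show ?case by simp
next
  case (Suc d)
  let ?A = "SIGMA M:{..<N}. tuples d M"
  \<comment> \<open>A tuple of total \<open>Suc M\<close> is determined by its first
    \<open>d\<close> entries, of total at most \<open>M\<close>; the last entry is then
    positive.\<close>
  let ?f = "\<lambda>(M, t). t(Suc d := Suc M - (\<Sum>i=1..d. t i))"
  let ?g = "\<lambda>t. ((\<Sum>i=1..Suc d. t i) - 1, restrict t {1..d})"
  have sum_eq: "(\<Sum>i=1..k. (t(Suc d := x)) i) = (\<Sum>i=1..k. t i)" if "k \<le> d" for t :: "nat \<Rightarrow> nat" and x k
    using that by (intro sum.cong) auto
  have f: "?f a \<in> tuples (Suc d) N" "?g (?f a) = a" if a: "a \<in> ?A" for a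
  proof -
    obtain M t where Mt: "a = (M, t)" "M < N" "t \<in> tuples d M" using a by auto
    have tot: "(\<Sum>i=1..Suc d. (t(Suc d := Suc M - (\<Sum>i=1..d. t i))) i) = Suc M"
      using Mt(3) sum_eq[of d t] by (simp add: tuples_def)
    show "?f a \<in> tuples (Suc d) N"
      using Mt tot by (auto simp: tuples_def PiE_iff extensional_def le_Suc_eq)
    have "restrict (t(Suc d := Suc M - (\<Sum>i=1..d. t i))) {1..d} = t"
      using Mt(3) by (auto simp: tuples_def PiE_iff extensional_def fun_eq_iff)
    then show "?g (?f a) = a" using tot Mt(1) by simp
  qed
  have g: "?g t \<in> ?A" "?f (?g t) = t" if t: "t \<in> tuples (Suc d) N" for t
  proof -
    have 1: "t (Suc d) \<ge> 1" "(\<Sum>i=1..Suc d. t i) \<le> N" using t by (auto simp: tuples_def)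
    have 2: "(\<Sum>i=1..d. restrict t {1..d} i) = (\<Sum>i=1..d. t i)" by (intro sum.cong) auto
    have "t (Suc d) + sum t {1..d} - 1 < N" "sum t {1..d} \<le> t (Suc d) + sum t {1..d} - 1"
      using 1 by auto
    then show "?g t \<in> ?A" using 2 t by (auto simp: tuples_def PiE_iff add.commute)
    have "Suc ((\<Sum>i=1..Suc d. t i) - 1) - (\<Sum>i=1..d. t i) = t (Suc d)" using 1 by simp
    then show "?f (?g t) = t" using 2 t
      by (auto simp: tuples_def PiE_iff extensional_def fun_eq_iff restrict_def)
  qed
  have bij: "bij_betw ?f ?A (tuples (Suc d) N)"
    using f g by (intro bij_betw_byWitness[where f' = ?g]) auto
    have "psum s (Suc d) N = (\<Sum>M<N. \<Sum>t\<in>tuples d M. of_nat (Suc M) powr - s (Suc d) * (\<Prod>k=1..d. of_nat (\<Sum>i=1..k. t i) powr (- s k)))"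
      using Suc.IH by (simp add: sum_distrib_left)
    also have "\<dots> = (\<Sum>(M, t)\<in>?A. of_nat (Suc M) powr - s (Suc d) * (\<Prod>k=1..d. of_nat (\<Sum>i=1..k. t i) powr (- s k)))"
      by (simp add: sum.Sigma finite_tuples)
    also have "\<dots> = (\<Sum>a\<in>?A. \<Prod>k=1..Suc d. of_nat (\<Sum>i=1..k. ?f a i) powr (- s k))"
    proof (intro sum.cong refl)
      fix a assume a: "a \<in> ?A"
      obtain M t where Mt: "a = (M, t)" "M < N" "t \<in> tuples d M" using a by auto
      let ?t = "t(Suc d := Suc M - (\<Sum>i=1..d. t i))"
      have tot: "(\<Sum>i=1..Suc d. ?t i) = Suc M"
        using Mt(3) sum_eq[of d t] by (simp add: tuples_def)
      have "(\<Prod>k=1..d. of_nat (\<Sum>i=1..k. ?t i) powr (- s k)) = (\<Prod>k=1..d. of_nat (\<Sum>i=1..k. t i) powr (- s k))"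
        using sum_eq by (intro prod.cong) auto
      then have "(\<Prod>k=1..Suc d. of_nat (\<Sum>i=1..k. ?t i) powr (- s k)) =
        of_nat (Suc M) powr - s (Suc d) * (\<Prod>k=1..d. of_nat (\<Sum>i=1..k. t i) powr (- s k))"
        unfolding prod.cl_ivl_Suc tot by (simp only: mult.commute) simp
      then show "(case a of (M, t) \<Rightarrow> of_nat (Suc M) powr - s (Suc d) * (\<Prod>k=1..d. of_nat (\<Sum>i=1..k. t i) powr (- s k)))
        = (\<Prod>k=1..Suc d. of_nat (\<Sum>i=1..k. ?f a i) powr (- s k))"
        unfolding Mt(1) prod.case by (rule sym)
    qed
    also have "\<dots> = (\<Sum>t\<in>tuples (Suc d) N. \<Prod>k=1..Suc d. of_nat (\<Sum>i=1..k. t i) powr (- s k))"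
      by (rule sum.reindex_bij_betw[OF bij])
    finally show ?case .
qed

lemma region_psum_bounded:
  assumes "s \<in> euler_zagier_region d"
  shows "\<exists>C. \<forall>n. psum (\<lambda>j. Re (s j)) d n \<le> C"
  using assms by (intro psum_real_bounded) (auto simp: euler_zagier_region_def tail_sum_def)

text \<open>The series is an unordered sum, whereas the proof truncates by the size of the total.
  Bounded absolute sums give summability, and a monotone exhaustion is cofinal among the finite
  subsets.\<close>

lemma exhaustion_tendsto_infsum:
  fixes g :: "'b \<Rightarrow> complex" and T :: "nat \<Rightarrow> 'b set"
  assumes fin: "\<And>N. finite (T N)" and sub: "\<And>N. T N \<subseteq> X" and mono: "\<And>M N. M \<le> N \<Longrightarrow> T M \<subseteq> T N"
    and cover: "\<And>Y. finite Y \<Longrightarrow> Y \<subseteq> X \<Longrightarrow> \<exists>N. Y \<subseteq> T N"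
    and bound: "\<And>N. (\<Sum>t\<in>T N. norm (g t)) \<le> C"
  shows "(\<lambda>N. sum g (T N)) \<longlonglongrightarrow> infsum g X"
proof -
  have "(\<lambda>t. norm (g t)) summable_on X"
  proof (rule nonneg_bdd_above_summable_on)
    show "bdd_above (sum (\<lambda>t. norm (g t)) ` {Y. Y \<subseteq> X \<and> finite Y})"
    proof (rule bdd_aboveI2)
      fix Y assume "Y \<in> {Y. Y \<subseteq> X \<and> finite Y}"
      then obtain N where N: "Y \<subseteq> T N" using cover by blast
      have "sum (\<lambda>t. norm (g t)) Y \<le> sum (\<lambda>t. norm (g t)) (T N)"
        using N fin by (intro sum_mono2) auto
      also have "\<dots> \<le> C" by (rule bound)
      finally show "sum (\<lambda>t. norm (g t)) Y \<le> C" .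
    qed
  qed auto
  then have "g summable_on X" by (rule abs_summable_summable)
  then have "(sum g \<longlongrightarrow> infsum g X) (finite_subsets_at_top X)"
    using has_sum_infsum has_sum_def by blast
  moreover have "filterlim T (finite_subsets_at_top X) sequentially"
    unfolding filterlim_finite_subsets_at_top
  proof (intro allI impI)
    fix Y assume "finite Y \<and> Y \<subseteq> X"
    then obtain N where N: "Y \<subseteq> T N" using cover by blast
    show "\<forall>\<^sub>F n in sequentially. finite (T n) \<and> Y \<subseteq> T n \<and> T n \<subseteq> X"
      using eventually_ge_at_top[of N]
      by eventually_elim (use N fin sub mono in blast)
  qed
  ultimately show ?thesis by (rule filterlim_compose)
qed

lemma psum_tendsto_series:
  assumes s: "s \<in> euler_zagier_region d"
  shows "(\<lambda>n. psum s d n) \<longlonglongrightarrow> euler_zagier_series d s"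
proof -
  obtain C where C: "\<forall>n. psum (\<lambda>j. Re (s j)) d n \<le> C"
    by (rule exE[OF region_psum_bounded[OF s]])
  show ?thesis
    unfolding psum_tuples euler_zagier_series_def
  proof (rule exhaustion_tendsto_infsum)
    fix Y :: "(nat \<Rightarrow> nat) set" assume Y: "finite Y" "Y \<subseteq> {1..d} \<rightarrow>\<^sub>E {1..}"
    have "t \<in> tuples d (\<Sum>t\<in>Y. \<Sum>i=1..d. t i)" if t: "t \<in> Y" for t
    proof -
      have "(\<Sum>i=1..d. t i) \<le> (\<Sum>t\<in>Y. \<Sum>i=1..d. t i)"
        using Y t by (intro member_le_sum) auto
      then show ?thesis using t Y by (auto simp: tuples_def)
    qed
    then show "\<exists>N. Y \<subseteq> tuples d N" by blast
  next
    fix N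
    have "(\<Sum>t\<in>tuples d N. norm (\<Prod>k=1..d. of_nat (\<Sum>i=1..k. t i) powr (- s k)))
      = psum (\<lambda>j. Re (s j)) d N"
      unfolding psum_tuples
      by (rule sum.cong[OF refl], rule trans[OF prod_norm[symmetric]], rule prod.cong[OF refl])
        (simp only: norm_of_nat_powr uminus_complex.sel)
    also have "\<dots> \<le> C" using C by blast
    finally show "(\<Sum>t\<in>tuples d N. norm (\<Prod>k=1..d. of_nat (\<Sum>i=1..k. t i) powr (- s k))) \<le> C" .
  next
    show "finite (tuples d N)" for N by (rule finite_tuples)
  qed (auto simp: tuples_def)
qed

section \<open>Recursion in the depth\<close>

definition convergent_exps :: "nat \<Rightarrow> (nat \<Rightarrow> real) \<Rightarrow> bool" where
  "convergent_exps d \<sigma> \<longleftrightarrow> (\<forall>j\<in>{1..d}. (\<Sum>i=j..d. \<sigma> i) > real d - real j + 1)"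

lemma region_iff:
  "s \<in> euler_zagier_region d \<longleftrightarrow> s \<in> cspace d \<and> convergent_exps d (\<lambda>j. Re (s j))"
  by (auto simp: euler_zagier_region_def convergent_exps_def tail_sum_def)

lemma convergent_exps_last: "convergent_exps (Suc d) \<sigma> \<Longrightarrow> \<sigma> (Suc d) > 1"
  unfolding convergent_exps_def by (drule bspec[of _ _ "Suc d"]) auto

lemma tail_sum_upd_last:
  fixes s :: "nat \<Rightarrow> 'a :: comm_monoid_add"
  assumes "j \<in> {1..d}"
  shows "tail_sum d (s(d := s d + z)) j = tail_sum d s j + z"
proof -
  have "tail_sum d (s(d := s d + z)) j = (\<Sum>i=j..d. s i + (if i = d then z else 0))"
    unfolding tail_sum_def by (intro sum.cong) auto
  also have "\<dots> = tail_sum d s j + z" using assms by (simp add: sum.distrib tail_sum_def)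
  finally show ?thesis .
qed

lemma tail_sum_merge_last:
  assumes "j \<in> {1..d}"
  shows "tail_sum d (merge_last d v s) j = tail_sum (Suc d) s j + v"
proof -
  have "tail_sum d (merge_last d v s) j = tail_sum d (s(d := s d + (s (Suc d) + v))) j"
    unfolding tail_sum_def using assms by (intro sum.cong) (auto simp: merge_last_def)
  also have "\<dots> = tail_sum d s j + (s (Suc d) + v)" by (rule tail_sum_upd_last[OF assms])
  also have "\<dots> = tail_sum (Suc d) s j + v" using assms by (simp add: tail_sum_def)
  finally show ?thesis .
qed

text \<open>Lowering the depth by one lowers the bound on every tail sum by one, so a loss of 1 in
  the exponent is affordable. The value \<open>v = -1\<close> is the term
  \<open>p = 0\<close>.\<close>

lemma merge_last_region:
  assumes "s \<in> euler_zagier_region (Suc d)" "Re v \<ge> -1"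
  shows "merge_last d v s \<in> euler_zagier_region d"
proof -
  have "Re (tail_sum d (merge_last d v s) j) > real d - real j + 1" if j: "j \<in> {1..d}" for j
  proof -
    have "Re (tail_sum (Suc d) s j) > real (Suc d) - real j + 1"
      using assms(1) j by (auto simp: euler_zagier_region_def)
    then show ?thesis using assms(2) by (simp add: tail_sum_merge_last[OF j])
  qed
  then show ?thesis by (auto simp: euler_zagier_region_def merge_last_cspace)
qed

lemma merge_last_upd: "merge_last d v (s(Suc d := s (Suc d) + z)) = merge_last d (v + z) s"
  by (auto simp: merge_last_def fun_eq_iff)

lemma region_upd_last:
  assumes "s \<in> euler_zagier_region (Suc d)" "Re z \<ge> 0"
  shows "s(Suc d := s (Suc d) + z) \<in> euler_zagier_region (Suc d)"
  using assms tail_sum_upd_last[of _ "Suc d" s z]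
  by (force simp: euler_zagier_region_def intro: cspace_upd)

lemma psum_real_convergent:
  assumes "convergent_exps d \<sigma>"
  shows "convergent (\<lambda>n. psum \<sigma> d n)"
proof -
  obtain C where C: "\<And>n. psum \<sigma> d n \<le> C"
    using psum_real_bounded[of d \<sigma>] assms by (auto simp: convergent_exps_def)
  have "Bseq (\<lambda>n. psum \<sigma> d n)"
    by (rule BseqI'[of _ C]) (use C psum_real_nonneg[of \<sigma> d] in auto)
  then show ?thesis
    by (intro Bseq_mono_convergent) (auto intro: psum_real_mono)
qed

text \<open>
  As \<open>psum \<sigma> d\<close> is increasing, the block \<open>M \<le> N \<le> 2 M\<close> of the convergent series of depth \<open>d + 1\<close>
  dominates the boundary term.
\<close>

lemma psum_boundary_real:
  assumes "convergent_exps (Suc d) \<sigma>"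
  shows "(\<lambda>M. psum \<sigma> d M * real (Suc M) powr (1 - \<sigma> (Suc d))) \<longlonglongrightarrow> 0"
proof -
  define \<tau> where "\<tau> = \<sigma> (Suc d)"
  have \<tau>: "\<tau> > 1" using convergent_exps_last[OF assms] by (simp add: \<tau>_def)
  define U where "U n = psum \<sigma> (Suc d) n" for n
  obtain L where L: "U \<longlonglongrightarrow> L"
    using psum_real_convergent[OF assms] unfolding convergent_def U_def[abs_def] by blast
  have sub: "(\<lambda>M. U (2 * M + 1)) \<longlonglongrightarrow> L"
    by (rule filterlim_compose[OF L]) (rule filterlim_subseq, auto simp: strict_mono_def)
  have lim: "(\<lambda>M. 2 powr \<tau> * (U (2 * M + 1) - U M)) \<longlonglongrightarrow> 0"
    using tendsto_mult_left[OF tendsto_diff[OF sub L], of "2 powr \<tau>"] by simp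
  have bound: "psum \<sigma> d M * real (Suc M) powr (1 - \<tau>) \<le> 2 powr \<tau> * (U (2 * M + 1) - U M)" for M
  proof -
    have "U (2 * M + 1) - U M = (\<Sum>N\<in>{M..<2 * M + 1}. real (Suc N) powr - \<tau> * psum \<sigma> d N)"
      unfolding U_def \<tau>_def psum.simps by (subst sum_diff_nat_ivl[symmetric, of 0]) (auto simp: atLeast0LessThan)
    also have "\<dots> \<ge> (\<Sum>N\<in>{M..<2 * M + 1}. real (2 * Suc M) powr - \<tau> * psum \<sigma> d M)"
      using \<tau> by (intro sum_mono mult_mono powr_mono2' psum_real_mono psum_real_nonneg) auto
    also have "(\<Sum>N\<in>{M..<2 * M + 1}. real (2 * Suc M) powr - \<tau> * psum \<sigma> d M)
        = real (Suc M) * (real (2 * Suc M) powr - \<tau> * psum \<sigma> d M)" by simp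
    finally have *: "real (Suc M) * (real (2 * Suc M) powr - \<tau> * psum \<sigma> d M) \<le> U (2 * M + 1) - U M" .
    have "real (2 * Suc M) powr - \<tau> = 2 powr - \<tau> * real (Suc M) powr - \<tau>"
      unfolding of_nat_mult by (subst powr_mult) auto
    moreover have "real (Suc M) powr (1 - \<tau>) = real (Suc M) * real (Suc M) powr - \<tau>"
      using powr_add[of "real (Suc M)" 1 "- \<tau>"] by simp
    ultimately have "psum \<sigma> d M * real (Suc M) powr (1 - \<tau>) =
        2 powr \<tau> * (real (Suc M) * (real (2 * Suc M) powr - \<tau> * psum \<sigma> d M))"
      by (simp add: powr_minus field_simps)
    also have "\<dots> \<le> 2 powr \<tau> * (U (2 * M + 1) - U M)" using * by (intro mult_left_mono) auto
    finally show ?thesis .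
  qed
  have "(\<lambda>M. psum \<sigma> d M * real (Suc M) powr (1 - \<tau>)) \<longlonglongrightarrow> 0"
    by (rule tendsto_sandwich[OF _ _ tendsto_const lim])
      (use bound psum_real_nonneg[of \<sigma> d] in \<open>auto intro!: always_eventually\<close>)
  then show ?thesis by (simp add: \<tau>_def)
qed

text \<open>The limit of \<open>psum_abel\<close>: the boundary term tends to 0, and adding
  \<open>s (Suc d) - 1\<close> to the exponent \<open>s d\<close> gives the merged tuple.\<close>

lemma psum_abel_sums:
  assumes s: "s \<in> euler_zagier_region (Suc d)"
  defines "v \<equiv> s (Suc d) - 1"
  shows "(\<lambda>n. psum s d (Suc n) * (of_nat (Suc n) powr - v - of_nat (Suc (Suc n)) powr - v))
    sums euler_zagier_series d (merge_last d (-1) s)"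
proof -
  let ?\<sigma> = "\<lambda>j. Re (s j)"
  have "(\<lambda>M. psum s d M * of_nat (Suc M) powr - v) \<longlonglongrightarrow> 0"
  proof (rule Lim_null_comparison)
    have "norm (psum s d M * of_nat (Suc M) powr - v) \<le> psum ?\<sigma> d M * real (Suc M) powr (1 - ?\<sigma> (Suc d))" for M
    proof -
      have "norm ((of_nat (Suc M) :: complex) powr - v) = real (Suc M) powr (1 - ?\<sigma> (Suc d))"
        unfolding norm_of_nat_powr by (simp add: v_def)
      then show ?thesis unfolding norm_mult
        by (simp only:) (intro mult_right_mono norm_psum_le, auto)
    qed
    then show "\<forall>\<^sub>F M in sequentially. norm (psum s d M * of_nat (Suc M) powr - v) \<le> psum ?\<sigma> d M * real (Suc M) powr (1 - ?\<sigma> (Suc d))"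
      by (auto intro: always_eventually)
    show "(\<lambda>M. psum ?\<sigma> d M * real (Suc M) powr (1 - ?\<sigma> (Suc d))) \<longlonglongrightarrow> 0"
      by (rule psum_boundary_real) (use s in \<open>auto simp: region_iff\<close>)
  qed
  moreover have "psum (s(d := s d + v)) d M = psum (merge_last d (-1) s) d M" for M
    by (rule psum_cong) (auto simp: merge_last_def v_def)
  moreover have "(\<lambda>M. psum (merge_last d (-1) s) d M) \<longlonglongrightarrow> euler_zagier_series d (merge_last d (-1) s)"
    using merge_last_region[OF s, of "-1"] by (intro psum_tendsto_series) auto
  ultimately have "(\<lambda>M. psum (s(d := s d + v)) d M - psum s d M * of_nat (Suc M) powr - v)
      \<longlonglongrightarrow> euler_zagier_series d (merge_last d (-1) s) - 0"
    by (intro tendsto_diff) auto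
  then show ?thesis unfolding sums_def by (subst psum_abel) auto
qed

text \<open>The term of order \<open>p\<close> gains \<open>p\<close> powers of decay, so
  convergence is required only for the tuple with raised last exponent; \<open>s\<close> itself may
  lie outside the region.\<close>

lemma psum_abel_sums_shifted:
  assumes "s(Suc d := s (Suc d) + of_nat p) \<in> euler_zagier_region (Suc d)"
  defines "w \<equiv> s (Suc d) - 1"
  shows "(\<lambda>n. psum s d (Suc n) * (em_term w p (of_nat (Suc n)) - em_term w p (of_nat (Suc (Suc n)))))
    sums (pochhammer w p * euler_zagier_series d (merge_last d (of_nat p - 1) s))"
proof -
  let ?t = "s(Suc d := s (Suc d) + of_nat p)"
  have "psum ?t d n = psum s d n" for n by (rule psum_cong) auto
  moreover have "- (?t (Suc d) - 1) = - w - of_nat p" by (simp add: w_def)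
  moreover have "merge_last d (-1) ?t = merge_last d (of_nat p - 1) s" by (simp add: merge_last_upd)
  ultimately have "(\<lambda>n. psum s d (Suc n) * (of_nat (Suc n) powr (- w - of_nat p) - of_nat (Suc (Suc n)) powr (- w - of_nat p)))
      sums euler_zagier_series d (merge_last d (of_nat p - 1) s)"
    using psum_abel_sums[OF assms(1)] by (simp only:)
  from sums_mult[OF this, of "pochhammer w p"] show ?thesis
    by (simp only: em_term_def ring_distribs mult.left_commute)
qed

text \<open>The summand of depth \<open>d + 1\<close> pairs \<open>psum \<sigma> d (Suc n)\<close>
  with the base \<open>n + 2\<close>, not \<open>n + 1\<close>. As \<open>n + 2\<close> is at most
  \<open>2 * (n + 1)\<close>, the change costs only the factor \<open>2 powr \<tau>\<close>.\<close>

lemma majorant_summable: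
  assumes "convergent_exps (Suc d) (\<sigma>(Suc d := \<sigma> (Suc d) + real l))"
  shows "summable (\<lambda>n. psum \<sigma> d (Suc n) * real (Suc n) powr - (\<sigma> (Suc d) + real l))"
proof -
  define \<tau> where "\<tau> = \<sigma> (Suc d) + real l"
  have \<tau>: "\<tau> > 1" using convergent_exps_last[OF assms] by (simp add: \<tau>_def)
  have "psum (\<sigma>(Suc d := \<tau>)) d n = psum \<sigma> d n" for n by (rule psum_cong) auto
  then have "psum (\<sigma>(Suc d := \<tau>)) (Suc d) = (\<lambda>n. \<Sum>N<n. real (Suc N) powr - \<tau> * psum \<sigma> d N)"
    by (auto simp: fun_eq_iff)
  then have "summable (\<lambda>N. real (Suc N) powr - \<tau> * psum \<sigma> d N)"
    using psum_real_convergent[OF assms] by (simp add: summable_iff_convergent \<tau>_def)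
  then have "summable (\<lambda>N. 2 powr \<tau> * (real (Suc (Suc N)) powr - \<tau> * psum \<sigma> d (Suc N)))"
    by (intro summable_mult) (simp only: summable_Suc_iff[of "\<lambda>N. real (Suc N) powr - \<tau> * psum \<sigma> d N"])
  then have "summable (\<lambda>n. psum \<sigma> d (Suc n) * real (Suc n) powr - \<tau>)"
  proof (rule summable_comparison_test_ev[rotated], intro always_eventually allI)
    fix n
    have "real (Suc n) powr - \<tau> = 2 powr \<tau> * real (2 * Suc n) powr - \<tau>"
      unfolding of_nat_mult by (subst powr_mult) (auto simp: powr_minus)
    also have "\<dots> \<le> 2 powr \<tau> * real (Suc (Suc n)) powr - \<tau>"
      using \<tau> by (intro mult_left_mono powr_mono2') auto
    finally have "psum \<sigma> d (Suc n) * real (Suc n) powr - \<tau> \<le> psum \<sigma> d (Suc n) * (2 powr \<tau> * real (Suc (Suc n)) powr - \<tau>)"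
      using psum_real_nonneg[of \<sigma> d "Suc n"] by (intro mult_left_mono) auto
    moreover have "norm (psum \<sigma> d (Suc n) * real (Suc n) powr - \<tau>) = psum \<sigma> d (Suc n) * real (Suc n) powr - \<tau>"
      using psum_real_nonneg[of \<sigma> d "Suc n"] by (simp only: real_norm_def abs_mult abs_of_nonneg powr_ge_zero)
    ultimately show "norm (psum \<sigma> d (Suc n) * real (Suc n) powr - \<tau>) \<le> 2 powr \<tau> * (real (Suc (Suc n)) powr - \<tau> * psum \<sigma> d (Suc n))"
      by (simp only: mult_ac)
  qed
  then show ?thesis by (simp add: \<tau>_def)
qed

lemma rem_term_bound:
  assumes "convergent_exps (Suc d) (\<sigma>(Suc d := \<sigma> (Suc d) + real l))" "l \<ge> 1"
    and \<sigma>: "\<And>j. j \<in> {1..Suc d} \<Longrightarrow> \<sigma> j \<le> Re (s j)"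
  shows "norm (psum s d (Suc n) * em_rem l (Suc n) (s (Suc d) - 1)) \<le>
    em_const l * norm (pochhammer (s (Suc d) - 1) (Suc l)) * (psum \<sigma> d (Suc n) * real (Suc n) powr - (\<sigma> (Suc d) + real l))"
proof -
  define \<tau> where "\<tau> = \<sigma> (Suc d) + real l"
  define K where "K = em_const l * norm (pochhammer (s (Suc d) - 1) (Suc l))"
  have K: "K \<ge> 0" using em_const_nonneg by (simp add: K_def)
  have \<tau>: "\<tau> > 1" using convergent_exps_last[OF assms(1)] by (simp add: \<tau>_def)
  have s: "\<sigma> (Suc d) \<le> Re (s (Suc d))" using \<sigma> by auto
  have "norm (em_rem l (Suc n) (s (Suc d) - 1)) \<le> K * real (Suc n) powr (- Re (s (Suc d) - 1) - real l - 1)"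
    unfolding K_def using \<tau> s assms(2) by (intro em_rem_bound) (auto simp: \<tau>_def)
  also have "\<dots> \<le> K * real (Suc n) powr - \<tau>"
    using s K by (intro mult_left_mono powr_mono) (auto simp: \<tau>_def)
  finally have "norm (psum s d (Suc n) * em_rem l (Suc n) (s (Suc d) - 1)) \<le> psum \<sigma> d (Suc n) * (K * real (Suc n) powr - \<tau>)"
    unfolding norm_mult using \<sigma> psum_real_nonneg by (intro mult_mono norm_psum_le) auto
  then show ?thesis by (simp add: K_def \<tau>_def mult_ac)
qed

definition rem_sum :: "nat \<Rightarrow> nat \<Rightarrow> (nat \<Rightarrow> complex) \<Rightarrow> complex" where
  "rem_sum d l s = (\<Sum>n. psum s d (Suc n) * em_rem l (Suc n) (s (Suc d) - 1))"

text \<open>An Euler--Maclaurin order for which the remainder series converges absolutely at \<open>s\<close>.\<close>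

definition adequate :: "nat \<Rightarrow> nat \<Rightarrow> (nat \<Rightarrow> complex) \<Rightarrow> bool" where
  "adequate d l s \<longleftrightarrow> l \<ge> 1 \<and> s(Suc d := s (Suc d) + of_nat l) \<in> euler_zagier_region (Suc d)"

lemma adequate_mono: "adequate d l s \<Longrightarrow> l \<le> l' \<Longrightarrow> adequate d l' s"
  using region_upd_last[of "s(Suc d := s (Suc d) + of_nat l)" d "of_nat (l' - l)"]
  by (auto simp: adequate_def of_nat_diff)

lemma adequate_exps:
  assumes "adequate d l s"
  shows "convergent_exps (Suc d) ((\<lambda>j. Re (s j))(Suc d := Re (s (Suc d)) + real l))"
proof -
  have "(\<lambda>j. Re ((s(Suc d := s (Suc d) + of_nat l)) j)) = (\<lambda>j. Re (s j))(Suc d := Re (s (Suc d)) + real l)"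
    by (auto simp: fun_eq_iff)
  then show ?thesis using assms by (simp only: adequate_def region_iff)
qed

lemma rem_summable:
  assumes "adequate d l s"
  shows "summable (\<lambda>n. psum s d (Suc n) * em_rem l (Suc n) (s (Suc d) - 1))"
proof (rule summable_comparison_test_ev[OF always_eventually])
  show "\<forall>n. norm (psum s d (Suc n) * em_rem l (Suc n) (s (Suc d) - 1)) \<le>
    em_const l * norm (pochhammer (s (Suc d) - 1) (Suc l)) *
      (psum (\<lambda>j. Re (s j)) d (Suc n) * real (Suc n) powr - (Re (s (Suc d)) + real l))"
    using rem_term_bound[OF adequate_exps[OF assms]] assms by (auto simp: adequate_def)
  show "summable (\<lambda>n. em_const l * norm (pochhammer (s (Suc d) - 1) (Suc l)) *
      (psum (\<lambda>j. Re (s j)) d (Suc n) * real (Suc n) powr - (Re (s (Suc d)) + real l)))"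
    by (intro summable_mult majorant_summable[OF adequate_exps[OF assms]])
qed

text \<open>The expansion covers the summands with largest index at least 2. The summand with index
  1 exists only for \<open>d = 0\<close>, because \<open>psum s d 0 = 0\<close> otherwise; after
  multiplication by \<open>s (Suc d) - 1\<close> it is the first term.\<close>

definition ez_step :: "nat \<Rightarrow> nat \<Rightarrow> ((nat \<Rightarrow> complex) \<Rightarrow> complex) \<Rightarrow> (nat \<Rightarrow> complex) \<Rightarrow> complex" where
  "ez_step d l f s = ((if d = 0 then s (Suc d) - 1 else 0) +
     (\<Sum>p\<le>l. bern_coeff p * pochhammer (s (Suc d) - 1) p * f (merge_last d (of_nat p - 1) s)) -
     rem_sum d l s) / (s (Suc d) - 1)"

lemma em_main_Suc: "em_main (Suc l) n w = em_main l n w + bern_coeff (Suc l) * em_term w (Suc l) (of_nat n)"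
  by (simp add: em_main_def)

text \<open>Adequacy already puts the merged argument of the new term into the region of
  convergence. The new term is therefore a convergent Abel sum, equal to what is added to the
  remainder.\<close>

lemma ez_step_Suc:
  assumes f: "\<And>t. t \<in> euler_zagier_region d \<Longrightarrow> f t = euler_zagier_series d t" and l: "adequate d l s"
  shows "ez_step d (Suc l) f s = ez_step d l f s"
proof -
  define w where "w = s (Suc d) - 1"
  have l': "adequate d (Suc l) s" using adequate_mono[OF l, of "Suc l"] by simp
  then have reg: "s(Suc d := s (Suc d) + of_nat (Suc l)) \<in> euler_zagier_region (Suc d)"
    by (simp only: adequate_def)
  let ?m = "merge_last d (of_nat (Suc l) - 1) s"
  have "merge_last d (-1) (s(Suc d := s (Suc d) + of_nat (Suc l))) = ?m"
    unfolding merge_last_upd by simp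
  then have m: "?m \<in> euler_zagier_region d" using merge_last_region[OF reg, of "-1"] by simp
  have S: "(\<lambda>n. psum s d (Suc n) * (em_term w (Suc l) (of_nat (Suc n)) - em_term w (Suc l) (of_nat (Suc (Suc n)))))
     sums (pochhammer w (Suc l) * euler_zagier_series d ?m)"
    unfolding w_def by (rule psum_abel_sums_shifted[OF reg])
  have "rem_sum d (Suc l) s = (\<Sum>n. psum s d (Suc n) * em_rem l (Suc n) w + bern_coeff (Suc l) *
      (psum s d (Suc n) * (em_term w (Suc l) (of_nat (Suc n)) - em_term w (Suc l) (of_nat (Suc (Suc n))))))"
    unfolding rem_sum_def w_def[symmetric]
    by (intro suminf_cong) (simp only: em_rem_def em_main_Suc, simp add: algebra_simps)
  also have "\<dots> = rem_sum d l s + bern_coeff (Suc l) * (pochhammer w (Suc l) * euler_zagier_series d ?m)"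
    using sums_add[OF summable_sums[OF rem_summable[OF l]] sums_mult[OF S, of "bern_coeff (Suc l)"]]
    unfolding rem_sum_def w_def[symmetric] by (rule sums_unique[symmetric])
  finally show ?thesis unfolding ez_step_def sum.atMost_Suc f[OF m] w_def[symmetric] by simp
qed

lemma ez_step_indep:
  assumes "\<And>t. t \<in> euler_zagier_region d \<Longrightarrow> f t = euler_zagier_series d t" "adequate d l s" "adequate d l' s"
  shows "ez_step d l f s = ez_step d l' f s"
proof -
  have "ez_step d (l + k) f s = ez_step d l f s" if "adequate d l s" for l k
    by (induction k) (use that ez_step_Suc[OF assms(1)] adequate_mono in auto)
  from this[OF assms(2), of "l' - l"] this[OF assms(3), of "l - l'"] show ?thesis
    by (cases "l \<le> l'") auto
qed

lemma sum_mult_diff: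
  fixes b x y :: "'b \<Rightarrow> complex"
  shows "(\<Sum>p\<in>A. b p * (c * (x p - y p))) = c * ((\<Sum>p\<in>A. b p * x p) - (\<Sum>p\<in>A. b p * y p))"
  by (simp add: sum_distrib_left sum_subtractf algebra_simps)

text \<open>Solving the definition of \<open>em_rem\<close> for the summand and summing it against
  \<open>psum s d\<close> gives the expansion, since every part converges here.\<close>

lemma ez_step_series:
  assumes f: "\<And>t. t \<in> euler_zagier_region d \<Longrightarrow> f t = euler_zagier_series d t"
    and s: "s \<in> euler_zagier_region (Suc d)" and l: "l \<ge> 1"
  shows "ez_step d l f s = euler_zagier_series (Suc d) s"
proof -
  define w where "w = s (Suc d) - 1"
  have reg: "s(Suc d := s (Suc d) + of_nat p) \<in> euler_zagier_region (Suc d)" for p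
    by (rule region_upd_last[OF s]) auto
  then have ad: "adequate d l s" using l by (simp add: adequate_def)
  have "Re (s (Suc d)) > 1" using s convergent_exps_last[of d "\<lambda>j. Re (s j)"] by (simp add: region_iff)
  then have w: "w \<noteq> 0" by (auto simp: w_def)
  let ?T = "\<lambda>N. of_nat (Suc N) powr (- s (Suc d)) * psum s d N"
  have "?T sums euler_zagier_series (Suc d) s"
    using psum_tendsto_series[OF s] by (simp add: sums_def)
  then have "(\<lambda>n. ?T (Suc n)) sums (euler_zagier_series (Suc d) s - ?T 0)"
    by (subst sums_Suc_iff) (simp del: of_nat_Suc)
  moreover have "?T 0 = (if d = 0 then 1 else 0)" by (cases d) auto
  ultimately have 1: "(\<lambda>n. w * ?T (Suc n)) sums (w * (euler_zagier_series (Suc d) s - (if d = 0 then 1 else 0)))"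
    by (intro sums_mult) (simp only:)
  have "(\<lambda>n. \<Sum>p\<le>l. bern_coeff p * (psum s d (Suc n) * (em_term w p (of_nat (Suc n)) - em_term w p (of_nat (Suc (Suc n))))))
      sums (\<Sum>p\<le>l. bern_coeff p * (pochhammer w p * euler_zagier_series d (merge_last d (of_nat p - 1) s)))"
    unfolding w_def by (rule sums_sum, rule sums_mult, rule psum_abel_sums_shifted, rule reg)
  moreover have "(\<lambda>n. psum s d (Suc n) * em_rem l (Suc n) (s (Suc d) - 1)) sums rem_sum d l s"
    unfolding rem_sum_def by (rule summable_sums[OF rem_summable[OF ad]])
  ultimately have D: "(\<lambda>n. (\<Sum>p\<le>l. bern_coeff p * (psum s d (Suc n) * (em_term w p (of_nat (Suc n)) - em_term w p (of_nat (Suc (Suc n)))))) -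
       psum s d (Suc n) * em_rem l (Suc n) (s (Suc d) - 1)) sums
     ((\<Sum>p\<le>l. bern_coeff p * (pochhammer w p * euler_zagier_series d (merge_last d (of_nat p - 1) s))) - rem_sum d l s)"
    by (rule sums_diff)
  have "(\<Sum>p\<le>l. bern_coeff p * (psum s d (Suc n) * (em_term w p (of_nat (Suc n)) - em_term w p (of_nat (Suc (Suc n)))))) -
       psum s d (Suc n) * em_rem l (Suc n) (s (Suc d) - 1) = w * ?T (Suc n)" for n
  proof -
    have "(\<Sum>p\<le>l. bern_coeff p * (psum s d (Suc n) * (em_term w p (of_nat (Suc n)) - em_term w p (of_nat (Suc (Suc n))))))
       = psum s d (Suc n) * (em_main l (Suc n) w - em_main l (Suc (Suc n)) w)"
      unfolding em_main_def by (rule sum_mult_diff)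
    moreover have "psum s d (Suc n) * em_rem l (Suc n) (s (Suc d) - 1)
       = psum s d (Suc n) * (em_main l (Suc n) w - em_main l (Suc (Suc n)) w) - w * ?T (Suc n)"
    proof -
      have "em_rem l (Suc n) (s (Suc d) - 1) =
          em_main l (Suc n) w - em_main l (Suc (Suc n)) w - w * of_nat (Suc (Suc n)) powr (- s (Suc d))"
        by (simp add: em_rem_def w_def del: of_nat_Suc)
      then show ?thesis by (simp only: right_diff_distrib mult_ac)
    qed
    ultimately show ?thesis by (simp only: diff_diff_eq2 add_diff_cancel_left')
  qed
  then have 2: "(\<lambda>n. w * ?T (Suc n)) sums ((\<Sum>p\<le>l. bern_coeff p * (pochhammer w p * euler_zagier_series d (merge_last d (of_nat p - 1) s)))
     - rem_sum d l s)"
    using D by (simp only:)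
  have "(\<Sum>p\<le>l. bern_coeff p * pochhammer w p * f (merge_last d (of_nat p - 1) s))
     = (\<Sum>p\<le>l. bern_coeff p * (pochhammer w p * euler_zagier_series d (merge_last d (of_nat p - 1) s)))"
    using merge_last_region[OF s] f by (intro sum.cong refl) auto
  with sums_unique2[OF 1 2] have "(if d = 0 then w else 0) +
     (\<Sum>p\<le>l. bern_coeff p * pochhammer w p * f (merge_last d (of_nat p - 1) s)) -
     rem_sum d l s = w * euler_zagier_series (Suc d) s" by (auto simp: algebra_simps)
  then show ?thesis using w unfolding ez_step_def w_def[symmetric] by (simp add: field_simps)
qed

text \<open>The choice of the order is harmless: by \<open>ez_cont_step\<close> every adequate order
  gives the same value, so the order can be adapted to each neighbourhood.\<close>

primrec ez_cont :: "nat \<Rightarrow> (nat \<Rightarrow> complex) \<Rightarrow> complex" where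
  "ez_cont 0 s = 1"
| "ez_cont (Suc d) s = ez_step d (SOME l. adequate d l s) (ez_cont d) s"

lemma ez_cont_series: "s \<in> euler_zagier_region d \<Longrightarrow> ez_cont d s = euler_zagier_series d s"
proof (induction d arbitrary: s)
  case 0
  have "(\<lambda>n::nat. 1) \<longlonglongrightarrow> euler_zagier_series 0 s" using psum_tendsto_series[OF 0] by simp
  then show ?case by (simp add: LIMSEQ_const_iff)
next
  case (Suc d)
  have "adequate d 1 s" using region_upd_last[OF Suc.prems, of 1] by (simp add: adequate_def)
  then have "adequate d (SOME l. adequate d l s) s" by (rule someI)
  then show ?case using ez_step_series[OF Suc.IH Suc.prems] by (simp add: adequate_def)
qed

lemma ez_cont_step:
  assumes "adequate d l s"
  shows "ez_cont (Suc d) s = ez_step d l (ez_cont d) s"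
  unfolding ez_cont.simps
  by (rule ez_step_indep[OF ez_cont_series someI[of "\<lambda>l. adequate d l s"]]) (use assms in auto)

section \<open>The meromorphic continuation\<close>

lemma norm_pochhammer_le:
  fixes w :: complex
  assumes "norm w \<le> K"
  shows "norm (pochhammer w n) \<le> pochhammer K n"
proof (induction n)
  case (Suc n)
  have "norm (w + of_nat n) \<le> K + real n" using norm_triangle_ineq[of w "of_nat n"] assms by simp
  then show ?case unfolding pochhammer_Suc norm_mult
    using Suc by (intro mult_mono) (auto intro: order_trans[OF norm_ge_zero])
qed simp

text \<open>One order and one real exponent tuple serve the whole unit polydisc, giving uniform
  convergence there. The bound \<open>l0\<close> leaves room for later demands on the order.\<close>

lemma local_majorant:
  fixes a :: "nat \<Rightarrow> complex"
  shows "\<exists>l \<sigma>. l \<ge> l0 \<and> l \<ge> 1 \<and> convergent_exps (Suc d) (\<sigma>(Suc d := \<sigma> (Suc d) + real l)) \<and>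
    (\<forall>s\<in>polydisc (Suc d) a 1. \<forall>j\<in>{1..Suc d}. \<sigma> j \<le> Re (s j))"
proof -
  define \<sigma> where "\<sigma> j = Re (a j) - 1" for j
  define B where "B = (\<Sum>i=1..Suc d. \<bar>\<sigma> i\<bar>)"
  \<comment> \<open>Tail sums of \<sigma> are at least \<open>- B\<close>, and the largest
    threshold, at \<open>j = 1\<close>, is \<open>d + 1\<close>.\<close>
  obtain l1 :: nat where l1: "real l1 > real d + 2 + B" using reals_Archimedean2 by blast
  define l where "l = max l1 (max l0 1)"
  have l: "real l > real d + 2 + B" "l \<ge> 1" "l \<ge> l0" using l1 by (auto simp: l_def)
  have "convergent_exps (Suc d) (\<sigma>(Suc d := \<sigma> (Suc d) + real l))"
    unfolding convergent_exps_def
  proof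
    fix j assume j: "j \<in> {1..Suc d}"
    have "- B \<le> - (\<Sum>i=j..Suc d. \<bar>\<sigma> i\<bar>)"
      unfolding B_def using j by (intro le_imp_neg_le sum_mono2) auto
    also have "\<dots> \<le> (\<Sum>i=j..Suc d. \<sigma> i)"
      unfolding sum_negf[symmetric] by (intro sum_mono) auto
    finally have "- B \<le> (\<Sum>i=j..Suc d. \<sigma> i)" .
    then show "(\<Sum>i=j..Suc d. (\<sigma>(Suc d := \<sigma> (Suc d) + real l)) i) > real (Suc d) - real j + 1"
      using tail_sum_upd_last[OF j, of \<sigma> "real l"] l j unfolding tail_sum_def by (simp only: atLeastAtMost_iff)
  qed
  moreover have "\<sigma> j \<le> Re (s j)" if "s \<in> polydisc (Suc d) a 1" "j \<in> {1..Suc d}" for s j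
  proof -
    have "norm (a j - s j) < 1" using that by (auto simp: polydisc_iff dist_norm)
    then show ?thesis using abs_Re_le_cmod[of "a j - s j"] by (simp add: \<sigma>_def)
  qed
  ultimately show ?thesis using l by blast
qed

lemma majorant_adequate:
  assumes "convergent_exps (Suc d) (\<sigma>(Suc d := \<sigma> (Suc d) + real l))" "l \<ge> 1" "s \<in> cspace (Suc d)"
    "\<And>j. j \<in> {1..Suc d} \<Longrightarrow> \<sigma> j \<le> Re (s j)"
  shows "adequate d l s"
proof -
  let ?t = "s(Suc d := s (Suc d) + of_nat l)"
  have "convergent_exps (Suc d) (\<lambda>j. Re (?t j))"
    unfolding convergent_exps_def
  proof
    fix j assume j: "j \<in> {1..Suc d}"
    have "real (Suc d) - real j + 1 < (\<Sum>i=j..Suc d. (\<sigma>(Suc d := \<sigma> (Suc d) + real l)) i)"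
      using assms(1) j by (auto simp: convergent_exps_def simp del: sum.cl_ivl_Suc)
    also have "\<dots> \<le> (\<Sum>i=j..Suc d. Re (?t i))"
    proof (rule sum_mono)
      fix i assume "i \<in> {j..Suc d}"
      then have "\<sigma> i \<le> Re (s i)" using j assms(4) by auto
      then show "(\<sigma>(Suc d := \<sigma> (Suc d) + real l)) i \<le> Re (?t i)" by auto
    qed
    finally show "real (Suc d) - real j + 1 < (\<Sum>i=j..Suc d. Re (?t i))" .
  qed
  then show ?thesis using assms by (simp add: adequate_def region_iff cspace_upd)
qed

lemma psum_holomorphic: "mv_holomorphic_on D (\<lambda>s. psum s k n) U"
proof (induction k arbitrary: n)
  case 0
  then show ?case by (simp add: mv_holomorphic_const)
next
  case (Suc k)
  have "mv_holomorphic_on D (\<lambda>s. (of_nat (Suc N) :: complex) powr - s (Suc k)) U" for N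
    by (rule mv_holomorphic_compose[of "\<lambda>z. of_nat (Suc N) powr - z", OF _ mv_holomorphic_coord])
      (auto intro!: holomorphic_intros simp del: of_nat_Suc)
  then show ?case unfolding psum.simps
    by (intro mv_holomorphic_sum mv_holomorphic_mult Suc) auto
qed

lemma em_rem_holomorphic: "(\<lambda>w. em_rem l (Suc n) w) holomorphic_on UNIV"
  unfolding em_rem_def em_main_def em_term_def
  by (intro holomorphic_intros) (auto simp del: of_nat_Suc)

lemma rem_sum_holomorphic:
  assumes "convergent_exps (Suc d) (\<sigma>(Suc d := \<sigma> (Suc d) + real l))" "l \<ge> 1"
    "\<And>s j. s \<in> polydisc (Suc d) a 1 \<Longrightarrow> j \<in> {1..Suc d} \<Longrightarrow> \<sigma> j \<le> Re (s j)"
  shows "mv_holomorphic_on (Suc d) (rem_sum d l) (polydisc (Suc d) a 1)"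
proof -
  \<comment> \<open>Bounds \<open>s (Suc d) - 1\<close> on the polydisc: 1 for the radius and 1 for
    the shift.\<close>
  define K where "K = norm (a (Suc d)) + 2"
  have "mv_holomorphic_on (Suc d) (\<lambda>s. \<Sum>n. psum s d (Suc n) * em_rem l (Suc n) (s (Suc d) - 1)) (polydisc (Suc d) a 1)"
  proof (rule mv_holomorphic_suminf)
    show "mv_holomorphic_on (Suc d) (\<lambda>s. psum s d (Suc n) * em_rem l (Suc n) (s (Suc d) - 1)) (polydisc (Suc d) a 1)" for n
      by (intro mv_holomorphic_mult psum_holomorphic mv_holomorphic_compose[OF em_rem_holomorphic]
          mv_holomorphic_diff mv_holomorphic_coord mv_holomorphic_const)
    show "summable (\<lambda>n. em_const l * pochhammer K (Suc l) *
        (psum \<sigma> d (Suc n) * real (Suc n) powr - (\<sigma> (Suc d) + real l)))"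
      by (intro summable_mult majorant_summable assms)
    fix n s assume s: "s \<in> polydisc (Suc d) a 1"
    have "dist (a (Suc d)) (s (Suc d)) < 1" using s by (auto simp: polydisc_iff)
    then have "norm (s (Suc d) - 1) \<le> K"
      using norm_triangle_ineq4[of "s (Suc d)" 1] norm_triangle_ineq3[of "s (Suc d)" "a (Suc d)"]
      by (auto simp: K_def dist_norm norm_minus_commute)
    then have "norm (pochhammer (s (Suc d) - 1) (Suc l)) \<le> pochhammer K (Suc l)"
      by (rule norm_pochhammer_le)
    then have "em_const l * norm (pochhammer (s (Suc d) - 1) (Suc l)) * (psum \<sigma> d (Suc n) * real (Suc n) powr - (\<sigma> (Suc d) + real l))
      \<le> em_const l * pochhammer K (Suc l) * (psum \<sigma> d (Suc n) * real (Suc n) powr - (\<sigma> (Suc d) + real l))"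
      using psum_real_nonneg[of \<sigma> d "Suc n"] em_const_nonneg[of l]
      by (intro mult_right_mono mult_left_mono) auto
    with rem_term_bound[OF assms(1,2) assms(3)[OF s]]
    show "norm (psum s d (Suc n) * em_rem l (Suc n) (s (Suc d) - 1)) \<le>
      em_const l * pochhammer K (Suc l) * (psum \<sigma> d (Suc n) * real (Suc n) powr - (\<sigma> (Suc d) + real l))"
      by (rule order_trans)
  qed
  then show ?thesis by (simp only: rem_sum_def[abs_def])
qed

text \<open>Derivatives are taken at full neighbourhoods of \<open>s j\<close>; equality on the
  polydisc suffices because its slices are open discs.\<close>

lemma mv_holomorphic_polydisc_cong:
  assumes f: "mv_holomorphic_on d f (polydisc d a r)" and eq: "\<And>s. s \<in> polydisc d a r \<Longrightarrow> f s = g s"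
  shows "mv_holomorphic_on d g (polydisc d a r)"
proof -
  have "continuous_on (polydisc d a r) g"
    using f eq by (auto simp: mv_holomorphic_on_def cong: continuous_on_cong)
  moreover have "(\<lambda>z. g (s(j := z))) field_differentiable at (s j)"
    if s: "s \<in> polydisc d a r" and j: "j \<in> {1..d}" for s j
  proof -
    have "(\<lambda>z. g (s(j := z))) holomorphic_on ball (a j) r"
      using mv_holomorphic_slice[OF f s j] by (rule holomorphic_transform) (use polydisc_upd[OF s j] eq in auto)
    moreover have "s j \<in> ball (a j) r" using s j by (auto simp: polydisc_iff)
    ultimately show ?thesis by (meson holomorphic_on_imp_differentiable_at open_ball)
  qed
  ultimately show ?thesis by (auto simp: mv_holomorphic_on_def)
qed

lemma ez_cont_local:
  assumes "a \<in> cspace (Suc d)"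
  shows "\<exists>l. mv_holomorphic_on (Suc d) (rem_sum d l) (polydisc (Suc d) a 1) \<and>
    (\<forall>s\<in>polydisc (Suc d) a 1. ez_cont (Suc d) s = ez_step d l (ez_cont d) s)"
proof -
  obtain l \<sigma> where l: "l \<ge> 1" "convergent_exps (Suc d) (\<sigma>(Suc d := \<sigma> (Suc d) + real l))"
    "\<And>s j. s \<in> polydisc (Suc d) a 1 \<Longrightarrow> j \<in> {1..Suc d} \<Longrightarrow> \<sigma> j \<le> Re (s j)"
    using local_majorant[of 0 d a] by blast
  show ?thesis
  proof (intro exI conjI ballI)
    show "mv_holomorphic_on (Suc d) (rem_sum d l) (polydisc (Suc d) a 1)"
      by (rule rem_sum_holomorphic[OF l(2,1)]) (rule l(3))
    show "ez_cont (Suc d) s = ez_step d l (ez_cont d) s" if "s \<in> polydisc (Suc d) a 1" for s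
      by (rule ez_cont_step[OF majorant_adequate[OF l(2,1) _ l(3)[OF that]]])
        (use that in \<open>auto simp: polydisc_iff\<close>)
  qed
qed

lemma coeff_holomorphic:
  "mv_holomorphic_on D (\<lambda>s. bern_coeff p * pochhammer (s k - 1) p) U"
  by (rule mv_holomorphic_compose[of "\<lambda>z. bern_coeff p * pochhammer (z - 1) p", OF _ mv_holomorphic_coord])
    (intro holomorphic_intros)

lemma unit_term_holomorphic:
  "mv_holomorphic_on D (\<lambda>s. if d = 0 then s k - 1 else 0) U"
  by (cases "d = 0") (simp_all add: mv_holomorphic_diff mv_holomorphic_coord mv_holomorphic_const)

lemma ez_cont_meromorphic: "mv_meromorphic d (ez_cont d)"
proof (induction d)
  case 0
  have "ez_cont 0 = (\<lambda>_. 1)" by auto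
  then show ?case unfolding mv_meromorphic_iff
    by (auto intro!: mv_meromorphic_at_holomorphic[of _ _ _ 1] mv_holomorphic_const)
next
  case (Suc d)
  show ?case unfolding mv_meromorphic_iff
  proof
    fix a :: "nat \<Rightarrow> complex" assume a: "a \<in> cspace (Suc d)"
    obtain l where l: "mv_holomorphic_on (Suc d) (rem_sum d l) (polydisc (Suc d) a 1)"
      "\<And>s. s \<in> polydisc (Suc d) a 1 \<Longrightarrow> ez_cont (Suc d) s = ez_step d l (ez_cont d) s"
      using ez_cont_local[OF a] by blast
    note hol = mv_meromorphic_at_holomorphic[OF _ zero_less_one a]
    let ?N = "\<lambda>s. (((if d = 0 then s (Suc d) - 1 else 0) + (-1) * rem_sum d l s) +
     (\<Sum>p\<le>l. bern_coeff p * pochhammer (s (Suc d) - 1) p * ez_cont d (merge_last d (of_nat p - 1) s)))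
      * (1 / (s (Suc d) - 1))"
    have "mv_meromorphic_at (Suc d) ?N a"
    proof (intro mv_meromorphic_at_mult mv_meromorphic_at_add mv_meromorphic_at_sum
        mv_meromorphic_at_inverse_coord a)
      show "mv_meromorphic_at (Suc d) (\<lambda>s. if d = 0 then s (Suc d) - 1 else 0) a"
        by (rule hol[OF unit_term_holomorphic])
      show "mv_meromorphic_at (Suc d) (\<lambda>s. - 1) a" by (rule hol[OF mv_holomorphic_const])
      show "mv_meromorphic_at (Suc d) (rem_sum d l) a" by (rule hol[OF l(1)])
      show "mv_meromorphic_at (Suc d) (\<lambda>s. bern_coeff i) a" for i by (rule hol[OF mv_holomorphic_const])
      show "mv_meromorphic_at (Suc d) (\<lambda>s. pochhammer (s (Suc d) - 1) i) a" for i
        by (rule hol, rule mv_holomorphic_compose[of "\<lambda>z. pochhammer (z - 1) i", OF _ mv_holomorphic_coord])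
          (intro holomorphic_intros)
      show "mv_meromorphic_at (Suc d) (\<lambda>s. ez_cont d (merge_last d (of_nat i - 1) s)) a" for i
        by (rule mv_meromorphic_at_merge_last) (use Suc a merge_last_cspace in \<open>auto simp: mv_meromorphic_iff\<close>)
    qed auto
    then show "mv_meromorphic_at (Suc d) (ez_cont (Suc d)) a"
    proof (rule mv_meromorphic_at_cong[OF _ zero_less_one])
      fix s assume "s \<in> polydisc (Suc d) a 1"
      then have "ez_cont (Suc d) s = ez_step d l (ez_cont d) s" by (rule l(2))
      moreover have "(u + (-1) * v + z) * (1 / w) = (u + z - v) / w" for u v w z :: complex
        by (simp add: diff_divide_distrib add_divide_distrib)
      ultimately show "?N s = ez_cont (Suc d) s" by (simp only: ez_step_def)
    qed
  qed
qed

text \<open>Merging changes tail sums by the integers \<open>p - 1\<close> only, so the hypothesis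
  passes to smaller depth; the denominator \<open>s (Suc d) - 1\<close> is covered by the tail sum
  at \<open>Suc d\<close>.\<close>

lemma ez_cont_holomorphic:
  assumes "s \<in> cspace d" "\<And>j. j \<in> {1..d} \<Longrightarrow> tail_sum d s j \<notin> \<int>"
  shows "\<exists>r>0. mv_holomorphic_on d (ez_cont d) (polydisc d s r)"
  using assms
proof (induction d arbitrary: s)
  case 0
  have "ez_cont 0 = (\<lambda>_. 1)" by auto
  then show ?case by (auto intro!: exI[of _ 1] mv_holomorphic_const)
next
  case (Suc d a)
  obtain l where l: "mv_holomorphic_on (Suc d) (rem_sum d l) (polydisc (Suc d) a 1)"
    "\<And>s. s \<in> polydisc (Suc d) a 1 \<Longrightarrow> ez_cont (Suc d) s = ez_step d l (ez_cont d) s"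
    using ez_cont_local[OF Suc.prems(1)] by blast
  have "\<exists>r>0. mv_holomorphic_on d (ez_cont d) (polydisc d (merge_last d (of_nat p - 1) a) r)" for p
  proof (rule Suc.IH[OF merge_last_cspace])
    fix j assume j: "j \<in> {1..d}"
    have "tail_sum (Suc d) a j \<notin> \<int>" using Suc.prems(2)[of j] j by auto
    then show "tail_sum d (merge_last d (of_nat p - 1) a) j \<notin> \<int>"
      unfolding tail_sum_merge_last[OF j] using Ints_diff[of "tail_sum (Suc d) a j + (of_nat p - 1)" "of_nat p - 1"]
      by auto
  qed
  then obtain \<rho> where \<rho>: "\<And>p. \<rho> p > 0"
    "\<And>p. mv_holomorphic_on d (ez_cont d) (polydisc d (merge_last d (of_nat p - 1) a) (\<rho> p))" by metis
  have a1: "a (Suc d) \<noteq> 1" using Suc.prems(2)[of "Suc d"] by (auto simp: tail_sum_def)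
  \<comment> \<open>The radius must allow the local expansion (1), avoid the zero of the
    denominator, and keep the merged tuples, whose radius doubles, where the smaller depth is
    holomorphic.\<close>
  define R where "R = insert 1 (insert (norm (a (Suc d) - 1)) ((\<lambda>p. \<rho> p / 2) ` {..l}))"
  define r where "r = Min R"
  have R: "finite R" "R \<noteq> {}" "\<And>x. x \<in> R \<Longrightarrow> x > 0" using \<rho>(1) a1 by (auto simp: R_def)
  have r: "r > 0" "r \<le> 1" "r \<le> norm (a (Suc d) - 1)" "\<And>p. p \<le> l \<Longrightarrow> 2 * r \<le> \<rho> p"
  proof -
    show "r > 0" unfolding r_def using R by simp
    have *: "x \<in> R \<Longrightarrow> r \<le> x" for x unfolding r_def using R by simp
    show "r \<le> 1" "r \<le> norm (a (Suc d) - 1)" by (rule *; simp add: R_def)+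
    show "2 * r \<le> \<rho> p" if "p \<le> l" for p using *[of "\<rho> p / 2"] that by (auto simp: R_def)
  qed
  have sub: "polydisc (Suc d) a r \<subseteq> polydisc (Suc d) a 1" using r polydisc_mono by blast
  have nz: "s (Suc d) - 1 \<noteq> 0" if "s \<in> polydisc (Suc d) a r" for s
  proof
    assume "s (Suc d) - 1 = 0"
    moreover have "dist (a (Suc d)) (s (Suc d)) < r" using that by (auto simp: polydisc_iff)
    ultimately show False using r(3) by (simp add: dist_norm)
  qed
  have m: "mv_holomorphic_on (Suc d) (\<lambda>s. ez_cont d (merge_last d (of_nat p - 1) s)) (polydisc (Suc d) a r)"
    if "p \<le> l" for p
  proof (rule mv_holomorphic_merge_last[OF \<rho>(2)])
    fix s assume "s \<in> polydisc (Suc d) a r"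
    from merge_last_polydisc[OF this]
    show "merge_last d (of_nat p - 1) s \<in> polydisc d (merge_last d (of_nat p - 1) a) (\<rho> p)"
      using polydisc_mono[OF r(4)[OF that]] by blast
  qed
  have "mv_holomorphic_on (Suc d) (ez_step d l (ez_cont d)) (polydisc (Suc d) a r)"
    unfolding ez_step_def[abs_def]
    by (intro mv_holomorphic_divide mv_holomorphic_diff mv_holomorphic_add mv_holomorphic_sum
        mv_holomorphic_mult[OF coeff_holomorphic] m nz mv_holomorphic_on_subset[OF l(1) sub]
        mv_holomorphic_coord mv_holomorphic_const unit_term_holomorphic) auto
  then have "mv_holomorphic_on (Suc d) (ez_cont (Suc d)) (polydisc (Suc d) a r)"
    by (rule mv_holomorphic_polydisc_cong) (use l(2) sub in auto)
  then show ?case using r(1) by blast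
qed

text \<open>An open starting set for the uniqueness argument: all real parts exceed 2 there.\<close>

lemma region_contains_polydisc:
  "polydisc d (\<lambda>j\<in>{1..d}. 3) 1 \<subseteq> euler_zagier_region d"
proof
  fix s :: "nat \<Rightarrow> complex" assume s: "s \<in> polydisc d (\<lambda>j\<in>{1..d}. 3) 1"
  have "Re (s i) > 2" if "i \<in> {1..d}" for i
  proof -
    have "norm (3 - s i) < 1" using s that by (auto simp: polydisc_iff dist_norm)
    then show ?thesis using abs_Re_le_cmod[of "3 - s i"] by simp
  qed
  note re = this
  have "convergent_exps d (\<lambda>j. Re (s j))"
    unfolding convergent_exps_def
  proof
    fix j assume j: "j \<in> {1..d}"
    have "real d - real j + 1 < (\<Sum>i=j..d. 2)" using j by (simp add: of_nat_diff)
    also have "\<dots> \<le> (\<Sum>i=j..d. Re (s i))" using re j by (intro sum_mono) (force intro: less_imp_le)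
    finally show "real d - real j + 1 < (\<Sum>i=j..d. Re (s i))" .
  qed
  then show "s \<in> euler_zagier_region d" using s by (simp add: region_iff polydisc_iff)
qed

lemma euler_zagier_zeta_eq:
  assumes s: "s \<in> cspace d" "\<And>j. j \<in> {1..d} \<Longrightarrow> tail_sum d s j \<notin> \<int>"
  shows "euler_zagier_zeta d s = ez_cont d s"
  unfolding euler_zagier_zeta_def
proof (rule the_equality)
  obtain r where r: "r > 0" "mv_holomorphic_on d (ez_cont d) (polydisc d s r)"
    using ez_cont_holomorphic[OF s] by blast
  show "\<exists>F. mv_meromorphic d F \<and> (\<forall>t\<in>euler_zagier_region d. F t = euler_zagier_series d t) \<and>
      (\<exists>r>0. mv_holomorphic_on d F (polydisc d s r)) \<and> F s = ez_cont d s"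
    using ez_cont_meromorphic ez_cont_series r by blast
  fix w assume "\<exists>F. mv_meromorphic d F \<and> (\<forall>t\<in>euler_zagier_region d. F t = euler_zagier_series d t) \<and>
      (\<exists>r>0. mv_holomorphic_on d F (polydisc d s r)) \<and> F s = w"
  then obtain F r' where F: "mv_meromorphic d F" "\<And>t. t \<in> euler_zagier_region d \<Longrightarrow> F t = euler_zagier_series d t"
    "r' > 0" "mv_holomorphic_on d F (polydisc d s r')" "F s = w" by blast
  have c: "(\<lambda>j\<in>{1..d}. 3) \<in> cspace d" by (auto simp: cspace_def)
  have "F t = ez_cont d t" if "t \<in> polydisc d (\<lambda>j\<in>{1..d}. 3) 1" for t
    using F(2) ez_cont_series that region_contains_polydisc by (metis subsetD)
  from mv_meromorphic_unique[OF F(1) ez_cont_meromorphic c zero_less_one this s(1) F(3,4) r]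
  show "w = ez_cont d s" using F(5) by simp
qed

section \<open>Asymptotics of Gamma factors\<close>

text \<open>Coefficients of \<open>X e\<^sup>-\<^sup>X / (e\<^sup>X - 1) + X e\<^sup>-\<^sup>X = X / (e\<^sup>X - 1)\<close>.\<close>

lemma bern_coeff_reflect:
  "(\<Sum>p\<le>n. bern_coeff p * ((-1) ^ (n - p) / fact (n - p))) +
    (if n \<ge> 1 then (-1) ^ (n - 1) / fact (n - 1) else 0) = bern_coeff n"
proof -
  let ?B = "fps_X / (fps_exp 1 - 1) :: complex fps"
  have "fps_exp 1 * fps_exp (- 1) = (1 :: complex fps)"
    by (simp flip: fps_exp_add_mult)
  then have "?B * (1 - fps_exp (-1)) = ?B * (fps_exp 1 - 1) * fps_exp (-1)"
    by (simp add: algebra_simps)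
  then have "?B * fps_exp (-1) + fps_X * fps_exp (-1) = ?B"
    unfolding bern_fps_times by (simp add: algebra_simps)
  then have "fps_nth (?B * fps_exp (-1) + fps_X * fps_exp (-1)) n = bern_coeff n"
    by (simp add: bern_coeff_nth)
  then show ?thesis
    by (auto simp: fps_mult_nth[of ?B] bern_coeff_nth[symmetric] atLeast0AtMost fps_X_mult_nth)
qed

text \<open>
  The bracket \<open>brk e n\<close> is the leading term of \<open>gam e n\<close> as \<open>e\<close> tends to \<open>0\<close>, both at the poles of
  the Gamma function and away from them.
\<close>

definition gam :: "complex \<Rightarrow> int \<Rightarrow> complex" where
  "gam e n = e * Gamma (of_int n + e)"

lemma shifted_not_Ints:
  assumes "e \<noteq> 0" "norm e < 1"
  shows "of_int n + e \<notin> (\<int> :: complex set)"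
proof
  assume "of_int n + e \<in> \<int>"
  then have "(of_int n + e) - of_int n \<in> \<int>" by (intro Ints_diff) auto
  then obtain k where k: "e = of_int k" by (auto elim: Ints_cases)
  then show False using assms by auto
qed

lemma shifted_not_nonpos_Ints:
  assumes "e \<noteq> 0" "norm e < 1"
  shows "of_int n + e \<notin> (\<int>\<^sub>\<le>\<^sub>0 :: complex set)"
  using shifted_not_Ints[OF assms] nonpos_Ints_subset_Ints by blast

lemma gam_nonzero: "e \<noteq> 0 \<Longrightarrow> norm e < 1 \<Longrightarrow> gam e n \<noteq> 0"
  using shifted_not_nonpos_Ints[of e n] by (simp add: gam_def Gamma_eq_zero_iff)

text \<open>The factor by which \<open>gam\<close> differs from its leading term, written so that it
  is regular at \<open>e = 0\<close>. For \<open>n \<le> 0\<close> the pole is removed through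
  \<open>Gamma (1 + e)\<close> and the functional equation; \<open>brk 0 n\<close> is then the
  bracket for every \<open>e\<close>.\<close>

definition gam_corr :: "int \<Rightarrow> complex \<Rightarrow> complex" where
  "gam_corr n e = (if n \<ge> 1 then Gamma (of_int n + e) / fact (nat (n - 1))
     else Gamma (1 + e) / (pochhammer (of_int n + e) (nat (- n)) * brk 0 n))"

lemma gam_eq:
  assumes "e \<noteq> 0" "norm e < 1"
  shows "gam e n = brk e n * gam_corr n e"
proof (cases "n \<ge> 1")
  case True
  then show ?thesis by (simp add: gam_def brk_def gam_corr_def)
next
  case False
  define k where "k = nat (- n)"
  have n: "n = - int k" using False by (simp add: k_def)
  have nz: "of_int n + e \<notin> \<int>\<^sub>\<le>\<^sub>0" "e \<notin> \<int>\<^sub>\<le>\<^sub>0" "e \<notin> \<int>"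
    using shifted_not_nonpos_Ints[OF assms, of n] shifted_not_nonpos_Ints[OF assms, of 0]
      shifted_not_Ints[OF assms, of 0] by auto
  have "Gamma (of_int n + e) \<noteq> 0" using nz by (simp add: Gamma_eq_zero_iff)
  then have "Gamma e = pochhammer (of_int n + e) k * Gamma (of_int n + e)"
    using pochhammer_Gamma[OF nz(1), of k] by (simp add: n)
  moreover have "Gamma (1 + e) = e * Gamma e" using Gamma_plus1[OF nz(2)] by (simp add: add.commute)
  moreover have "pochhammer (of_int n + e) k \<noteq> 0"
  proof
    assume "pochhammer (of_int n + e) k = 0"
    then obtain i where "of_int n + e = - of_nat i" by (auto simp: pochhammer_eq_0_iff)
    then have "of_int n + e \<in> \<int>" by simp
    then show False using shifted_not_Ints[OF assms] by blast
  qed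
  moreover have "brk 0 n \<noteq> 0" "brk e n = brk 0 n" using False by (auto simp: brk_def)
  ultimately show ?thesis using False
    by (simp add: gam_def gam_corr_def k_def[symmetric])
qed

lemma pochhammer_minus_self: "pochhammer (- of_nat k) k = ((-1) ^ k * fact k :: complex)"
proof -
  have "pochhammer (- of_nat k) k = (-1) ^ k * pochhammer (of_nat k - of_nat k + 1 :: complex) k"
    by (rule pochhammer_minus)
  then show ?thesis by (simp add: pochhammer_fact)
qed

lemma brk_nonpos: "n < 1 \<Longrightarrow> brk e n = (-1) ^ nat (- n) / fact (nat (- n))"
proof -
  assume "n < 1"
  then obtain k where "n = - int k" by (intro that[of "nat (- n)"]) auto
  moreover have "inverse ((-1) ^ k) = ((-1) ^ k :: complex)" by (simp flip: power_inverse)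
  ultimately show ?thesis by (auto simp: brk_def power_int_minus)
qed

lemma gam_corr_0: "gam_corr n 0 = 1"
proof (cases "n \<ge> 1")
  case True
  then show ?thesis by (simp add: gam_corr_def Gamma_of_int)
next
  case False
  then have "n = - int (nat (- n))" by simp
  then have "(of_int n :: complex) = - of_nat (nat (- n))" by (metis of_int_minus of_int_of_nat_eq)
  then have "pochhammer (of_int n :: complex) (nat (- n)) * brk 0 n = 1"
    using False by (simp only: pochhammer_minus_self brk_nonpos) (simp add: power_mult_distrib[symmetric])
  then show ?thesis using False by (simp add: gam_corr_def)
qed

lemma field_differentiable_translate:
  fixes f :: "complex \<Rightarrow> complex"
  assumes "f field_differentiable at c"
  shows "(\<lambda>e. f (c + e)) field_differentiable at 0"
proof -
  have "(\<lambda>e. c + e) field_differentiable at 0" by (intro derivative_intros)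
  from field_differentiable_compose[OF this, of f] show ?thesis using assms by (simp add: o_def)
qed

lemma gam_corr_diff: "gam_corr n field_differentiable at 0"
proof (cases "n \<ge> 1")
  case True
  have "(\<lambda>e. Gamma (of_int n + e) / fact (nat (n - 1))) field_differentiable at (0::complex)"
  proof (intro field_differentiable_divide)
    have "(of_int n :: complex) \<notin> \<int>\<^sub>\<le>\<^sub>0" using True by (auto elim!: nonpos_Ints_cases)
    then show "(\<lambda>e. Gamma (of_int n + e)) field_differentiable at (0::complex)"
      by (intro field_differentiable_translate field_differentiable_Gamma)
  qed auto
  moreover have "gam_corr n = (\<lambda>e. Gamma (of_int n + e) / fact (nat (n - 1)))"
    using True by (auto simp: gam_corr_def)
  ultimately show ?thesis by simp
next
  case False
  have "pochhammer (of_int n :: complex) (nat (- n)) * brk 0 n \<noteq> 0"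
    using gam_corr_0[of n] False by (auto simp: gam_corr_def)
  moreover have "(\<lambda>e. Gamma (1 + e)) field_differentiable at (0::complex)"
    by (intro field_differentiable_translate field_differentiable_Gamma) simp
  moreover have "(\<lambda>e. pochhammer (of_int n + e) (nat (- n)) * brk 0 n) holomorphic_on UNIV"
    by (intro holomorphic_intros)
  then have "(\<lambda>e. pochhammer (of_int n + e) (nat (- n)) * brk 0 n) field_differentiable at 0"
    by (simp add: holomorphic_on_def)
  ultimately have "(\<lambda>e. Gamma (1 + e) / (pochhammer (of_int n + e) (nat (- n)) * brk 0 n)) field_differentiable at 0"
    by (intro field_differentiable_divide) auto
  moreover have "gam_corr n = (\<lambda>e. Gamma (1 + e) / (pochhammer (of_int n + e) (nat (- n)) * brk 0 n))"
    using False by (auto simp: gam_corr_def)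
  ultimately show ?thesis by simp
qed

lemma differentiable_bigo:
  fixes f :: "complex \<Rightarrow> complex" and e \<eta> :: "'a \<Rightarrow> complex"
  assumes f: "f field_differentiable at 0" and e: "(e \<longlongrightarrow> 0) F" "e \<in> O[F](\<eta>)"
  shows "(\<lambda>x. f (e x) - f 0) \<in> O[F](\<eta>)"
proof -
  obtain D where D: "(f has_field_derivative D) (at 0)" using f by (auto simp: field_differentiable_def)
  have "((\<lambda>y. (f y - f 0) / (y - 0)) \<longlongrightarrow> D) (at 0)" using D by (simp add: has_field_derivative_iff)
  then have "((\<lambda>y. norm ((f y - f 0) / (y - 0))) \<longlongrightarrow> norm D) (at 0)" by (rule tendsto_norm)
  then have "\<forall>\<^sub>F y in at 0. norm ((f y - f 0) / (y - 0)) < norm D + 1"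
    by (rule order_tendstoD) simp
  then have "\<forall>\<^sub>F y in nhds 0. y \<noteq> 0 \<longrightarrow> norm ((f y - f 0) / (y - 0)) < norm D + 1"
    by (simp add: eventually_at_filter)
  then have "\<forall>\<^sub>F x in F. e x \<noteq> 0 \<longrightarrow> norm ((f (e x) - f 0) / (e x - 0)) < norm D + 1"
    using e(1) by (rule eventually_compose_filterlim)
  then have "\<forall>\<^sub>F x in F. norm (f (e x) - f 0) \<le> (norm D + 1) * norm (e x)"
    by eventually_elim (auto simp: norm_divide divide_simps split: if_splits)
  then have "(\<lambda>x. f (e x) - f 0) \<in> O[F](e)" by (rule bigoI)
  then show ?thesis using e(2) landau_o.big_trans by blast
qed

lemma gam_corr_bigo:
  assumes "(e \<longlongrightarrow> 0) F" "e \<in> O[F](\<eta>)"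
  shows "(\<lambda>x. gam_corr n (e x) - 1) \<in> O[F](\<eta>)" "(\<lambda>x. 1 / gam_corr n (e x) - 1) \<in> O[F](\<eta>)"
proof -
  show "(\<lambda>x. gam_corr n (e x) - 1) \<in> O[F](\<eta>)"
    using differentiable_bigo[OF gam_corr_diff assms, of n] by (simp add: gam_corr_0)
  have "(\<lambda>z. 1 / gam_corr n z) field_differentiable at 0"
    by (intro field_differentiable_divide gam_corr_diff) (auto simp: gam_corr_0)
  from differentiable_bigo[OF this assms] show "(\<lambda>x. 1 / gam_corr n (e x) - 1) \<in> O[F](\<eta>)"
    by (simp add: gam_corr_0)
qed

section \<open>Error terms relative to a common scale\<close>

text \<open>\<open>\<eta>\<close> is a common scale that dominates all the infinitesimals.\<close>

locale small_scale =
  fixes F :: "'a filter" and \<eta> :: "'a \<Rightarrow> complex"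
  assumes scale: "(\<eta> \<longlongrightarrow> 0) F"
begin

lemma bigo_eta_1: "f \<in> O[F](\<eta>) \<Longrightarrow> f \<in> O[F](\<lambda>_. 1)"
proof -
  have "\<eta> \<in> O[F](\<lambda>_. 1)" using scale by (intro bigoI_tendsto[of _ _ 0]) auto
  then show "f \<in> O[F](\<eta>) \<Longrightarrow> f \<in> O[F](\<lambda>_. 1)" using landau_o.big_trans by blast
qed

lemma bigo_eta_tendsto:
  assumes "f \<in> O[F](\<eta>)"
  shows "(f \<longlongrightarrow> 0) F"
proof -
  obtain C where C: "\<forall>\<^sub>F x in F. norm (f x) \<le> C * norm (\<eta> x)" using assms by (elim landau_o.bigE)
  have "((\<lambda>x. C * norm (\<eta> x)) \<longlongrightarrow> 0) F" using tendsto_mult_right_zero[OF tendsto_norm_zero[OF scale]] .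
  then show ?thesis using C by (rule Lim_null_comparison[rotated])
qed

lemma bigo_mult_1: "f \<in> O[F](\<eta>) \<Longrightarrow> g \<in> O[F](\<lambda>_. 1) \<Longrightarrow> (\<lambda>x. f x * g x) \<in> O[F](\<eta>)"
  using landau_o.big.mult[of f F \<eta> g "\<lambda>_. 1"] by simp

lemma bigo_1_mult: "f \<in> O[F](\<lambda>_. 1) \<Longrightarrow> g \<in> O[F](\<eta>) \<Longrightarrow> (\<lambda>x. f x * g x) \<in> O[F](\<eta>)"
  using landau_o.big.mult[of f F "\<lambda>_. 1" g \<eta>] by simp

lemma bigo_1_mult_1: "f \<in> O[F](\<lambda>_. 1 :: complex) \<Longrightarrow> g \<in> O[F](\<lambda>_. 1) \<Longrightarrow> (\<lambda>x. f x * g x) \<in> O[F](\<lambda>_. 1)"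
  using landau_o.big.mult[of f F "\<lambda>_. 1" g "\<lambda>_. 1"] by simp

lemma bigo_const_1: "(\<lambda>_. c) \<in> O[F](\<lambda>_. 1 :: complex)"
  by (rule bigoI[of _ "norm c"]) auto

lemma bigo_perturb:
  assumes "(\<lambda>x. f x - f' x) \<in> O[F](\<eta>)" "(\<lambda>x. g x - g' x) \<in> O[F](\<eta>)"
    "f' \<in> O[F](\<lambda>_. 1)" "g' \<in> O[F](\<lambda>_. 1)"
  shows "(\<lambda>x. f x * g x - f' x * g' x) \<in> O[F](\<eta>)"
proof -
  have "(\<lambda>x. (g x - g' x) + g' x) \<in> O[F](\<lambda>_. 1)" by (intro sum_in_bigo(1) bigo_eta_1 assms)
  then have "(\<lambda>x. (f x - f' x) * g x + f' x * (g x - g' x)) \<in> O[F](\<eta>)"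
    by (intro sum_in_bigo(1) bigo_mult_1 bigo_1_mult assms) simp
  then show ?thesis by (simp add: algebra_simps)
qed

text \<open>When both indices are positive the quotient is a multiple of \<open>e / e'\<close>; when
  neither is, it is constant. For \<open>n \<ge> 1\<close> and \<open>n' < 1\<close> it is a
  multiple of \<open>e\<close>, so replacing it by 0 through \<open>hcut\<close> costs an admissible
  error.\<close>

lemma brk_ratio_bigo:
  assumes e: "e \<in> O[F](\<eta>)" and r: "(\<lambda>x. e x / e' x) \<in> O[F](\<lambda>_. 1)" and n: "n' \<le> n"
  shows "(\<lambda>x. brk (e x) n / brk (e' x) n') \<in> O[F](\<lambda>_. 1)"
    "(\<lambda>x. hcut n n' * (brk (e x) n / brk (e' x) n')) \<in> O[F](\<lambda>_. 1)"
    "(\<lambda>x. brk (e x) n / brk (e' x) n' - hcut n n' * (brk (e x) n / brk (e' x) n')) \<in> O[F](\<eta>)"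
proof -
  consider "n' \<ge> 1" | "n < 1" | "n \<ge> 1" "n' < 1" by linarith
  then have "(\<lambda>x. brk (e x) n / brk (e' x) n') \<in> O[F](\<lambda>_. 1) \<and>
    (\<lambda>x. brk (e x) n / brk (e' x) n' - hcut n n' * (brk (e x) n / brk (e' x) n')) \<in> O[F](\<eta>)"
  proof cases
    case 1
    have "(\<lambda>x. (e x / e' x) * (fact (nat (n - 1)) / fact (nat (n' - 1)))) \<in> O[F](\<lambda>_. 1)"
      by (intro bigo_1_mult_1 r bigo_const_1)
    then show ?thesis using 1 n by (simp add: brk_def hcut_def)
  next
    case 2
    have "brk (e x) n / brk (e' x) n' = brk 0 n / brk 0 n'" for x using 2 n by (simp add: brk_def)
    then show ?thesis using 2 n bigo_const_1 by (simp add: hcut_def)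
  next
    case 3
    have "brk (e x) n / brk (e' x) n' = e x * (fact (nat (n - 1)) / brk 0 n')" for x using 3 by (simp add: brk_def)
    moreover have "(\<lambda>x. e x * (fact (nat (n - 1)) / brk 0 n')) \<in> O[F](\<eta>)"
      by (intro bigo_mult_1 e bigo_const_1)
    ultimately show ?thesis using 3 bigo_eta_1 by (simp add: hcut_def)
  qed
  moreover from this show "(\<lambda>x. hcut n n' * (brk (e x) n / brk (e' x) n')) \<in> O[F](\<lambda>_. 1)"
    by (intro bigo_1_mult_1 bigo_const_1) auto
  ultimately show "(\<lambda>x. brk (e x) n / brk (e' x) n') \<in> O[F](\<lambda>_. 1)"
    "(\<lambda>x. brk (e x) n / brk (e' x) n' - hcut n n' * (brk (e x) n / brk (e' x) n')) \<in> O[F](\<eta>)"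
    by auto
qed

lemma small_eventually: "f \<in> O[F](\<eta>) \<Longrightarrow> \<forall>\<^sub>F x in F. norm (f x) < 1"
  using order_tendstoD(2)[OF tendsto_norm_zero[OF bigo_eta_tendsto], of f 1] by simp

lemma gam_ratio_bigo:
  assumes e: "e \<in> O[F](\<eta>)" "\<forall>\<^sub>F x in F. e x \<noteq> 0" and e': "e' \<in> O[F](\<eta>)" "\<forall>\<^sub>F x in F. e' x \<noteq> 0"
    and r: "(\<lambda>x. e x / e' x) \<in> O[F](\<lambda>_. 1)" and n: "n' \<le> n"
  shows "(\<lambda>x. gam (e x) n / gam (e' x) n' - hcut n n' * (brk (e x) n / brk (e' x) n')) \<in> O[F](\<eta>)"
proof -
  let ?b = "\<lambda>x. brk (e x) n / brk (e' x) n'"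
  have "(\<lambda>x. gam_corr n (e x) * (1 / gam_corr n' (e' x)) - 1 * 1) \<in> O[F](\<eta>)"
    by (intro bigo_perturb gam_corr_bigo bigo_eta_tendsto e e' bigo_const_1)
  then have "(\<lambda>x. ?b x * (gam_corr n (e x) * (1 / gam_corr n' (e' x)) - 1) + (?b x - hcut n n' * ?b x)) \<in> O[F](\<eta>)"
    by (intro sum_in_bigo(1) bigo_1_mult brk_ratio_bigo[OF e(1) r n]) simp
  moreover have "\<forall>\<^sub>F x in F. ?b x * (gam_corr n (e x) * (1 / gam_corr n' (e' x)) - 1) + (?b x - hcut n n' * ?b x)
      = gam (e x) n / gam (e' x) n' - hcut n n' * ?b x"
    using e(2) e'(2) small_eventually[OF e(1)] small_eventually[OF e'(1)]
    by eventually_elim (simp add: gam_eq algebra_simps)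
  ultimately show ?thesis by (rule landau_o.big.in_cong[THEN iffD1, rotated])
qed

text \<open>The limit is the residue of \<open>Gamma\<close> at \<open>n\<close>, and 0 where
  \<open>Gamma\<close> is regular.\<close>

lemma gam_bigo:
  assumes e: "e \<in> O[F](\<eta>)" "\<forall>\<^sub>F x in F. e x \<noteq> 0"
  shows "(\<lambda>x. gam (e x) n - (if n \<ge> 1 then 0 else (-1) ^ nat (- n) / fact (nat (- n)))) \<in> O[F](\<eta>)"
proof -
  let ?c = "if n \<ge> 1 then 0 else (-1) ^ nat (- n) / fact (nat (- n)) :: complex"
  have "(\<lambda>x. brk (e x) n - ?c) \<in> O[F](\<eta>)"
  proof (cases "n \<ge> 1")
    case True
    then show ?thesis using bigo_mult_1[OF e(1) bigo_const_1, of "fact (nat (n - 1))"] by (simp add: brk_def)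
  next
    case False
    then show ?thesis by (simp add: brk_nonpos)
  qed
  then have "(\<lambda>x. brk (e x) n * gam_corr n (e x) - ?c * 1) \<in> O[F](\<eta>)"
    by (intro bigo_perturb gam_corr_bigo bigo_eta_tendsto e bigo_const_1)
  moreover have "\<forall>\<^sub>F x in F. brk (e x) n * gam_corr n (e x) - ?c * 1 = gam (e x) n - ?c"
    using e(2) small_eventually[OF e(1)] by eventually_elim (simp add: gam_eq)
  ultimately show ?thesis by (rule landau_o.big.in_cong[THEN iffD1, rotated])
qed

text \<open>Undoing the normalisation at the end yields the prefactor
  \<open>(-1) ^ m d * fact (m d)\<close>.\<close>

lemma inverse_gam_bigo:
  assumes e: "e \<in> O[F](\<eta>)" "\<forall>\<^sub>F x in F. e x \<noteq> 0"
  shows "(\<lambda>x. 1 / gam (e x) (- int k) - (-1) ^ k * fact k) \<in> O[F](\<eta>)"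
proof -
  have "(\<lambda>x. (-1) ^ k * fact k * (1 / gam_corr (- int k) (e x) - 1)) \<in> O[F](\<eta>)"
    by (intro bigo_1_mult bigo_const_1 gam_corr_bigo bigo_eta_tendsto e)
  moreover have "\<forall>\<^sub>F x in F. (-1) ^ k * fact k * (1 / gam_corr (- int k) (e x) - 1) = 1 / gam (e x) (- int k) - (-1) ^ k * fact k"
    using e(2) small_eventually[OF e(1)]
  proof eventually_elim
    case (elim x)
    have "1 / brk (e x) (- int k) = (-1) ^ k * fact k"
      by (simp add: brk_nonpos field_simps flip: power_add)
    then show ?case using elim by (simp add: gam_eq right_diff_distrib flip: divide_divide_eq_left)
  qed
  ultimately show ?thesis by (rule landau_o.big.in_cong[THEN iffD1, rotated])
qed

end

section \<open>Asymptotics of the multiple zeta function\<close>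

text \<open>The total is an integer because the induction meets negative totals, for which the set
  is empty.\<close>

definition exponents :: "nat \<Rightarrow> int \<Rightarrow> (nat \<Rightarrow> nat) set" where
  "exponents d N = {p \<in> {1..d} \<rightarrow>\<^sub>E UNIV. int (\<Sum>i=1..d. p i) = N}"

lemma finite_exponents: "finite (exponents d N)"
proof (rule finite_subset)
  show "exponents d N \<subseteq> {1..d} \<rightarrow>\<^sub>E {..nat N}"
  proof
    fix p assume p: "p \<in> exponents d N"
    have "p j \<le> nat N" if "j \<in> {1..d}" for j
    proof -
      have "p j \<le> (\<Sum>i=1..d. p i)" using that by (intro member_le_sum) auto
      also have "\<dots> = nat N" using p by (auto simp: exponents_def simp del: of_nat_sum)
      finally show ?thesis .
    qed
    then show "p \<in> {1..d} \<rightarrow>\<^sub>E {..nat N}" using p by (auto simp: exponents_def PiE_iff)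
  qed
qed (auto intro!: finite_PiE)

definition ratio :: "nat \<Rightarrow> (nat \<Rightarrow> int) \<Rightarrow> (nat \<Rightarrow> complex) \<Rightarrow> (nat \<Rightarrow> nat) \<Rightarrow> nat \<Rightarrow> complex" where
  "ratio d A e p j =
    hcut (A j - int d + int j + int (tail_sum d p j) - 1) (A (j - 1) - int d + int j + int (tail_sum d p j) - 1) *
    (brk (e j) (A j - int d + int j + int (tail_sum d p j) - 1) /
     brk (e (j - 1)) (A (j - 1) - int d + int j + int (tail_sum d p j) - 1))"

text \<open>With \<open>A j\<close> the negative tail sum of \<open>m\<close>, this is the sum of
  the theorem without its prefactor.\<close>

definition main_sum :: "nat \<Rightarrow> (nat \<Rightarrow> int) \<Rightarrow> (nat \<Rightarrow> complex) \<Rightarrow> complex" where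
  "main_sum d A e = (\<Sum>p\<in>exponents d (int d - A 1). (\<Prod>i=1..d. bern_coeff (p i)) * (\<Prod>j=2..d. ratio d A e p j))"

lemma main_sum_1: "main_sum 1 A e = (if A 1 \<le> 1 then bern_coeff (nat (1 - A 1)) else 0)"
proof (cases "A 1 \<le> 1")
  case True
  have "exponents 1 (1 - A 1) = {\<lambda>j\<in>{1}. nat (1 - A 1)}"
    using True by (auto simp: exponents_def PiE_iff extensional_def fun_eq_iff)
  then show ?thesis using True by (simp add: main_sum_def)
next
  case False
  then have "exponents 1 (1 - A 1) = {}" by (auto simp: exponents_def)
  then show ?thesis using False by (simp add: main_sum_def)
qed

text \<open>Splitting off the last exponent \<open>k\<close> lowers all other tail sums by
  \<open>k\<close>, which the shift of \<open>A\<close> by \<open>k - 1\<close> compensates; the 1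
  accounts for the change of depth. The bound on \<open>l\<close> ensures that no possible
  \<open>k\<close> is lost, and larger \<open>k\<close> contribute empty sums.\<close>

lemma main_sum_Suc:
  assumes d: "d \<ge> 1" and l: "int l \<ge> int (Suc d) - A 1"
  shows "main_sum (Suc d) A e = (\<Sum>k\<le>l. bern_coeff k *
    ((hcut (A (Suc d) - 1 + int k) (A d - 1 + int k) *
      (brk (e (Suc d)) (A (Suc d) - 1 + int k) / brk (e d) (A d - 1 + int k))) *
     main_sum d (\<lambda>j. A j - 1 + int k) e))"
proof -
  define N where "N = int (Suc d) - A 1"
  define R where "R k = hcut (A (Suc d) - 1 + int k) (A d - 1 + int k) *
      (brk (e (Suc d)) (A (Suc d) - 1 + int k) / brk (e d) (A d - 1 + int k))" for k
  define t where "t k p = (\<Prod>i=1..d. bern_coeff (p i)) * (\<Prod>j=2..d. ratio d (\<lambda>j. A j - 1 + int k) e p j)" for k p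
  let ?X = "SIGMA k:{..l}. exponents d (N - int k)"
  have "main_sum (Suc d) A e = (\<Sum>(k, p)\<in>?X. bern_coeff k * (R k * t k p))"
    unfolding main_sum_def N_def[symmetric]
  proof (rule sum.reindex_bij_witness[where i = "\<lambda>(k, p). p(Suc d := k)" and j = "\<lambda>p. (p (Suc d), restrict p {1..d})"])
    fix p assume p: "p \<in> exponents (Suc d) N"
    let ?q = "restrict p {1..d}" and ?k = "p (Suc d)"
    have pe: "p \<in> {1..Suc d} \<rightarrow>\<^sub>E UNIV" and ps: "int (\<Sum>i=1..Suc d. p i) = N"
      using p by (auto simp: exponents_def)
    have qs: "(\<Sum>i=1..d. ?q i) = (\<Sum>i=1..d. p i)" by (intro sum.cong) auto
    show "(case (?k, ?q) of (k, p) \<Rightarrow> p(Suc d := k)) = p"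
      using pe by (auto simp: PiE_iff extensional_def fun_eq_iff restrict_def)
    have "int ?k \<le> int (\<Sum>i=1..Suc d. p i)" by (simp del: of_nat_sum)
    then have "?k \<le> l" using ps l unfolding N_def by linarith
    moreover have "int (\<Sum>i=1..d. ?q i) = N - int ?k" unfolding qs using ps by simp
    ultimately show "(?k, ?q) \<in> ?X" by (simp add: exponents_def del: of_nat_sum)
    have tl: "tail_sum (Suc d) p j = tail_sum d ?q j + ?k" if "j \<in> {1..d}" for j
    proof -
      have "tail_sum d ?q j = (\<Sum>i=j..d. p i)" unfolding tail_sum_def using that by (intro sum.cong) auto
      then show ?thesis using that by (simp add: tail_sum_def)
    qed
    have rj: "ratio d (\<lambda>j. A j - 1 + int ?k) e ?q j = ratio (Suc d) A e p j" if "j \<in> {2..d}" for j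
    proof -
      have "A j - 1 + int ?k - int d + int j + int (tail_sum d ?q j) - 1
          = A j - int (Suc d) + int j + int (tail_sum (Suc d) p j) - 1"
        "A (j - 1) - 1 + int ?k - int d + int j + int (tail_sum d ?q j) - 1
          = A (j - 1) - int (Suc d) + int j + int (tail_sum (Suc d) p j) - 1"
        using tl[of j] that by auto
      then show ?thesis unfolding ratio_def by (simp only:)
    qed
    have "ratio (Suc d) A e p (Suc d) = R ?k"
      by (simp add: ratio_def R_def tail_sum_def algebra_simps)
    then have "(\<Prod>j=2..Suc d. ratio (Suc d) A e p j) = (\<Prod>j=2..d. ratio d (\<lambda>j. A j - 1 + int ?k) e ?q j) * R ?k"
      using d rj by simp
    moreover have "(\<Prod>i=1..d. bern_coeff (?q i)) = (\<Prod>i=1..d. bern_coeff (p i))" by (intro prod.cong) auto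
    ultimately show "(case (?k, ?q) of (k, p) \<Rightarrow> bern_coeff k * (R k * t k p)) =
        (\<Prod>i=1..Suc d. bern_coeff (p i)) * (\<Prod>j=2..Suc d. ratio (Suc d) A e p j)"
      unfolding t_def prod.case by simp
  next
    fix kp assume "kp \<in> ?X"
    then obtain k p where kp: "kp = (k, p)" "k \<le> l" "p \<in> exponents d (N - int k)" by auto
    have s: "(\<Sum>i=1..d. (p(Suc d := k)) i) = (\<Sum>i=1..d. p i)" by (intro sum.cong) auto
    show "(\<lambda>p. (p (Suc d), restrict p {1..d})) (case kp of (k, p) \<Rightarrow> p(Suc d := k)) = kp"
      using kp by (auto simp: exponents_def PiE_iff extensional_def fun_eq_iff)
    show "(case kp of (k, p) \<Rightarrow> p(Suc d := k)) \<in> exponents (Suc d) N"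
      using kp s by (auto simp: exponents_def PiE_iff extensional_def)
  qed
  also have "\<dots> = (\<Sum>k\<le>l. \<Sum>p\<in>exponents d (N - int k). bern_coeff k * (R k * t k p))"
    by (simp add: sum.Sigma finite_exponents)
  also have "\<dots> = (\<Sum>k\<le>l. bern_coeff k * (R k * main_sum d (\<lambda>j. A j - 1 + int k) e))"
  proof (intro sum.cong refl)
    fix k
    have "int d - (A 1 - 1 + int k) = N - int k" by (simp add: N_def)
    then show "(\<Sum>p\<in>exponents d (N - int k). bern_coeff k * (R k * t k p)) = bern_coeff k * (R k * main_sum d (\<lambda>j. A j - 1 + int k) e)"
      unfolding main_sum_def t_def by (simp only: sum_distrib_left)
  qed
  finally show ?thesis unfolding R_def .
qed

text \<open>With \<open>w = s (Suc d) - 1\<close>, the denominator \<open>w\<close> is absorbed by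
  \<open>w * Gamma w = Gamma (w + 1)\<close>, and each Pochhammer symbol times
  \<open>Gamma w\<close> is a shifted Gamma value.\<close>

lemma gam_ez_cont:
  assumes ad: "adequate d l s" and s: "s (Suc d) = of_int A + e" and e: "e \<noteq> 0" "norm e < 1"
  shows "gam e A * ez_cont (Suc d) s = (if d = 0 then gam e A else 0) +
    (\<Sum>p\<le>l. bern_coeff p * (gam e (A - 1 + int p) * ez_cont d (merge_last d (of_nat p - 1) s))) -
    e * Gamma (of_int (A - 1) + e) * rem_sum d l s"
proof -
  define w where "w = of_int (A - 1) + e"
  have w: "w \<notin> \<int>\<^sub>\<le>\<^sub>0" unfolding w_def by (rule shifted_not_nonpos_Ints[OF e])
  then have w0: "w \<noteq> 0" and G0: "Gamma w \<noteq> 0" by (auto simp: Gamma_eq_zero_iff)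
  have sw: "s (Suc d) - 1 = w" by (simp add: s w_def)
  have gA: "gam e A = e * (w * Gamma w)"
    using Gamma_plus1[OF w] by (simp add: gam_def w_def)
  have gp: "gam e (A - 1 + int p) = e * (pochhammer w p * Gamma w)" for p
    using pochhammer_Gamma[OF w, of p] G0 by (simp add: gam_def w_def add_ac)
  have "gam e A * ez_cont (Suc d) s = e * Gamma w * ((if d = 0 then w else 0) +
     (\<Sum>p\<le>l. bern_coeff p * pochhammer w p * ez_cont d (merge_last d (of_nat p - 1) s)) - rem_sum d l s)"
    unfolding ez_cont_step[OF ad] ez_step_def sw gA using w0 by simp
  also have "\<dots> = (if d = 0 then gam e A else 0) +
    (\<Sum>p\<le>l. bern_coeff p * (gam e (A - 1 + int p) * ez_cont d (merge_last d (of_nat p - 1) s))) -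
    e * Gamma w * rem_sum d l s"
    unfolding gA gp by (simp add: ring_distribs sum_distrib_left mult_ac)
  finally show ?thesis by (simp add: w_def)
qed

lemma norm_rem_sum_le:
  assumes "convergent_exps (Suc d) (\<sigma>(Suc d := \<sigma> (Suc d) + real l))" "l \<ge> 1"
    and "\<And>j. j \<in> {1..Suc d} \<Longrightarrow> \<sigma> j \<le> Re (s j)"
  shows "norm (rem_sum d l s) \<le> norm (pochhammer (s (Suc d) - 1) (Suc l)) *
    (em_const l * (\<Sum>n. psum \<sigma> d (Suc n) * real (Suc n) powr - (\<sigma> (Suc d) + real l)))"
proof -
  let ?g = "\<lambda>n. psum \<sigma> d (Suc n) * real (Suc n) powr - (\<sigma> (Suc d) + real l)"
  let ?K = "em_const l * norm (pochhammer (s (Suc d) - 1) (Suc l))"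
  have g: "summable ?g" by (rule majorant_summable[OF assms(1)])
  have "norm (rem_sum d l s) \<le> (\<Sum>n. ?K * ?g n)"
    unfolding rem_sum_def by (rule norm_suminf_le[OF rem_term_bound[OF assms] summable_mult[OF g]])
  also have "\<dots> = ?K * (\<Sum>n. ?g n)" by (rule suminf_mult[OF g])
  finally show ?thesis by (simp only: mult_ac)
qed

context small_scale
begin

lemma rem_bigo:
  fixes s :: "'a \<Rightarrow> nat \<Rightarrow> complex"
  assumes \<sigma>: "convergent_exps (Suc d) (\<sigma>(Suc d := \<sigma> (Suc d) + real l))" "l \<ge> 1"
    "\<forall>\<^sub>F x in F. \<forall>j\<in>{1..Suc d}. \<sigma> j \<le> Re (s x j)"
    and s: "\<And>x. s x (Suc d) = of_int A + e x" and e: "e \<in> O[F](\<eta>)" "\<forall>\<^sub>F x in F. e x \<noteq> 0"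
    and A: "A + int l \<ge> 1"
  shows "(\<lambda>x. e x * Gamma (of_int (A - 1) + e x) * rem_sum d l (s x)) \<in> O[F](\<eta>)"
proof -
  define S where "S = em_const l * (\<Sum>n. psum \<sigma> d (Suc n) * real (Suc n) powr - (\<sigma> (Suc d) + real l))"
  have "\<forall>\<^sub>F x in F. norm (e x * Gamma (of_int (A - 1) + e x) * rem_sum d l (s x)) \<le> S * norm (gam (e x) (A + int l))"
    using \<sigma>(3) e(2) small_eventually[OF e(1)]
  proof eventually_elim
    case (elim x)
    define w where "w = of_int (A - 1) + e x"
    have w: "w \<notin> \<int>\<^sub>\<le>\<^sub>0" unfolding w_def by (rule shifted_not_nonpos_Ints[OF elim(2,3)])
    then have G0: "Gamma w \<noteq> 0" by (simp add: Gamma_eq_zero_iff)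
    have sw: "s x (Suc d) - 1 = w" by (simp add: s w_def)
    have "pochhammer w (Suc l) * Gamma w = Gamma (w + of_nat (Suc l))"
      using pochhammer_Gamma[OF w, of "Suc l"] G0 by simp
    also have "w + of_nat (Suc l) = of_int (A + int l) + e x" by (simp add: w_def)
    finally have gl: "gam (e x) (A + int l) = e x * Gamma w * pochhammer w (Suc l)"
      by (simp add: gam_def mult_ac)
    have "norm (rem_sum d l (s x)) \<le> norm (pochhammer w (Suc l)) * S"
      using norm_rem_sum_le[OF \<sigma>(1,2), of "s x"] elim(1) by (simp only: sw S_def)
    then have "norm (e x * Gamma w * rem_sum d l (s x)) \<le> norm (e x * Gamma w) * (norm (pochhammer w (Suc l)) * S)"
      unfolding norm_mult[of _ "rem_sum d l (s x)"] by (rule mult_left_mono) simp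
    also have "\<dots> = S * norm (gam (e x) (A + int l))" unfolding gl norm_mult by (simp only: mult_ac)
    finally show ?case by (simp only: w_def)
  qed
  then have "(\<lambda>x. e x * Gamma (of_int (A - 1) + e x) * rem_sum d l (s x)) \<in> O[F](\<lambda>x. gam (e x) (A + int l))"
    by (rule bigoI)
  moreover have "(\<lambda>x. gam (e x) (A + int l)) \<in> O[F](\<eta>)" using gam_bigo[OF e, of "A + int l"] A by simp
  ultimately show ?thesis using landau_o.big_trans by blast
qed

lemma ez_cont_expand:
  fixes s :: "'a \<Rightarrow> nat \<Rightarrow> complex" and e :: "nat \<Rightarrow> 'a \<Rightarrow> complex" and A :: "nat \<Rightarrow> int"
  assumes s: "\<And>x. s x \<in> cspace (Suc d)"
    and tail: "\<And>x j. j \<in> {1..Suc d} \<Longrightarrow> tail_sum (Suc d) (s x) j = of_int (A j) + e j x"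
    and e: "\<And>j. j \<in> {1..Suc d} \<Longrightarrow> e j \<in> O[F](\<eta>)" "\<forall>\<^sub>F x in F. e (Suc d) x \<noteq> 0"
  shows "\<exists>l. int l \<ge> N \<and>
    (\<lambda>x. gam (e (Suc d) x) (A (Suc d)) * ez_cont (Suc d) (s x) -
      ((if d = 0 then gam (e (Suc d) x) (A (Suc d)) else 0) +
       (\<Sum>p\<le>l. bern_coeff p * (gam (e (Suc d) x) (A (Suc d) - 1 + int p) *
          ez_cont d (merge_last d (of_nat p - 1) (s x)))))) \<in> O[F](\<eta>)"
proof -
  \<comment> \<open>The limit of \<open>s x\<close>, recovered from its limiting tail sums.\<close>
  define a where "a j = (of_int (A j) - (if j = Suc d then 0 else of_int (A (Suc j))) :: complex)" for j
  have sl: "s x (Suc d) = of_int (A (Suc d)) + e (Suc d) x" for x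
    using tail[of "Suc d" x] by (simp add: tail_sum_def)
  have "\<forall>\<^sub>F x in F. dist (a j) (s x j) < 1" if j: "j \<in> {1..Suc d}" for j
  proof (cases "j = Suc d")
    case True
    then have "dist (a j) (s x j) = norm (e (Suc d) x)" for x by (simp add: a_def sl dist_norm)
    then show ?thesis using small_eventually[OF e(1)[of "Suc d"]] by simp
  next
    case False
    then have j': "j \<in> {1..d}" "Suc j \<in> {1..Suc d}" using j by auto
    have "dist (a j) (s x j) = norm (e j x - e (Suc j) x)" for x
    proof -
      have "tail_sum (Suc d) (s x) j = s x j + tail_sum (Suc d) (s x) (Suc j)"
        unfolding tail_sum_def using j' by (intro sum.atLeast_Suc_atMost) auto
      then have "s x j = of_int (A j) + e j x - (of_int (A (Suc j)) + e (Suc j) x)"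
        using tail[OF j, of x] tail[OF j'(2), of x] by simp
      then show ?thesis using False by (simp add: a_def dist_norm norm_minus_commute)
    qed
    then show ?thesis using small_eventually[OF sum_in_bigo(2)[OF e(1)[OF j] e(1)[OF j'(2)]]] by simp
  qed
  then have "\<forall>\<^sub>F x in F. \<forall>j\<in>{1..Suc d}. dist (a j) (s x j) < 1"
    by (intro eventually_ball_finite) auto
  then have pd: "\<forall>\<^sub>F x in F. s x \<in> polydisc (Suc d) a 1"
    by (rule eventually_mono) (use s in \<open>simp add: polydisc_iff\<close>)
  \<comment> \<open>Besides \<open>N\<close>, the order must exceed \<open>- A (Suc d)\<close>, so
    that the Gamma factor of the remainder is regular and the factor \<open>e\<close> makes it
    small.\<close>
  obtain l \<sigma> where l: "l \<ge> nat (max N (1 - A (Suc d)))" "l \<ge> 1"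
    and \<sigma>: "convergent_exps (Suc d) (\<sigma>(Suc d := \<sigma> (Suc d) + real l))"
    "\<forall>s\<in>polydisc (Suc d) a 1. \<forall>j\<in>{1..Suc d}. \<sigma> j \<le> Re (s j)"
    using local_majorant[of "nat (max N (1 - A (Suc d)))" d a] by blast
  have \<sigma>': "\<forall>\<^sub>F x in F. \<forall>j\<in>{1..Suc d}. \<sigma> j \<le> Re (s x j)"
    using pd by (rule eventually_mono) (use \<sigma>(2) in blast)
  have "(\<lambda>x. - (e (Suc d) x * Gamma (of_int (A (Suc d) - 1) + e (Suc d) x) * rem_sum d l (s x))) \<in> O[F](\<eta>)"
    by (subst landau_o.big.uminus_in_iff, rule rem_bigo[OF \<sigma>(1) l(2) \<sigma>' sl e(1) e(2)]) (use l in auto)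
  moreover have "\<forall>\<^sub>F x in F. - (e (Suc d) x * Gamma (of_int (A (Suc d) - 1) + e (Suc d) x) * rem_sum d l (s x)) =
      gam (e (Suc d) x) (A (Suc d)) * ez_cont (Suc d) (s x) -
      ((if d = 0 then gam (e (Suc d) x) (A (Suc d)) else 0) +
       (\<Sum>p\<le>l. bern_coeff p * (gam (e (Suc d) x) (A (Suc d) - 1 + int p) *
          ez_cont d (merge_last d (of_nat p - 1) (s x)))))"
    using \<sigma>' e(2) small_eventually[OF e(1)[of "Suc d"], simplified]
  proof eventually_elim
    case (elim x)
    have "adequate d l (s x)" by (rule majorant_adequate[OF \<sigma>(1) l(2) s]) (use elim(1) in blast)
    from gam_ez_cont[OF this sl elim(2,3)] show ?case by (simp only:) simp
  qed
  ultimately have "(\<lambda>x. gam (e (Suc d) x) (A (Suc d)) * ez_cont (Suc d) (s x) -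
      ((if d = 0 then gam (e (Suc d) x) (A (Suc d)) else 0) +
       (\<Sum>p\<le>l. bern_coeff p * (gam (e (Suc d) x) (A (Suc d) - 1 + int p) *
          ez_cont d (merge_last d (of_nat p - 1) (s x)))))) \<in> O[F](\<eta>)"
    by (rule landau_o.big.in_cong[THEN iffD1, rotated])
  moreover have "int l \<ge> N" using l(1) by linarith
  ultimately show ?thesis by blast
qed

text \<open>Here \<open>b n\<close> is the limit of \<open>gam e n\<close>, so this evaluates the
  expansion of depth 1. With \<open>n = 1 - A\<close> nonnegative it is
  \<open>bern_coeff_reflect\<close>; otherwise every term is 0.\<close>

lemma base_identity:
  fixes A :: int
  defines "b \<equiv> \<lambda>n::int. if n \<ge> 1 then 0 else (-1) ^ nat (- n) / fact (nat (- n)) :: complex"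
  assumes "int l \<ge> 1 - A"
  shows "b A + (\<Sum>p\<le>l. bern_coeff p * b (A - 1 + int p)) = (if A \<le> 1 then bern_coeff (nat (1 - A)) else 0)"
proof (cases "A \<le> 1")
  case True
  define n where "n = nat (1 - A)"
  have A: "A = 1 - int n" and nl: "n \<le> l" using True assms(2) by (auto simp: n_def)
  have "(\<Sum>p\<le>l. bern_coeff p * b (A - 1 + int p)) = (\<Sum>p\<le>n. bern_coeff p * ((-1) ^ (n - p) / fact (n - p)))"
  proof (rule sum.mono_neutral_cong_right)
    fix p assume p: "p \<in> {..n}"
    then have "nat (- (A - 1 + int p)) = n - p" "\<not> A - 1 + int p \<ge> 1" unfolding A by auto
    then show "bern_coeff p * b (A - 1 + int p) = bern_coeff p * ((-1) ^ (n - p) / fact (n - p))" by (simp add: b_def)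
  qed (use nl in \<open>auto simp: b_def A\<close>)
  moreover have "b A = (if n \<ge> 1 then (-1) ^ (n - 1) / fact (n - 1) else 0)"
  proof (cases "n \<ge> 1")
    case True
    then have "nat (- A) = n - 1" "\<not> A \<ge> 1" unfolding A by auto
    then show ?thesis using True by (simp add: b_def)
  qed (simp add: b_def A)
  ultimately show ?thesis using bern_coeff_reflect[of n] True by (simp add: n_def[symmetric] add.commute)
qed (simp add: b_def)

text \<open>The boundedness of \<open>main_sum\<close> is carried along because the induction step
  multiplies the asymptotics of smaller depth by a quotient that is itself only known up to an
  error.\<close>

lemma ez_cont_asymp:
  fixes s :: "'a \<Rightarrow> nat \<Rightarrow> complex" and e :: "nat \<Rightarrow> 'a \<Rightarrow> complex" and A :: "nat \<Rightarrow> int"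
  assumes "d \<ge> 1" and s: "\<And>x. s x \<in> cspace d"
    and tail: "\<And>x j. j \<in> {1..d} \<Longrightarrow> tail_sum d (s x) j = of_int (A j) + e j x"
    and A: "\<And>j. j \<in> {1..<d} \<Longrightarrow> A j \<le> A (Suc j)"
    and e: "\<And>j. j \<in> {1..d} \<Longrightarrow> e j \<in> O[F](\<eta>)" "\<And>j. j \<in> {1..d} \<Longrightarrow> \<forall>\<^sub>F x in F. e j x \<noteq> 0"
    and r: "\<And>j. j \<in> {1..<d} \<Longrightarrow> (\<lambda>x. e (Suc j) x / e j x) \<in> O[F](\<lambda>_. 1)"
  shows "(\<lambda>x. gam (e d x) (A d) * ez_cont d (s x) - main_sum d A (\<lambda>j. e j x)) \<in> O[F](\<eta>) \<and>
    (\<lambda>x. main_sum d A (\<lambda>j. e j x)) \<in> O[F](\<lambda>_. 1)"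
  using assms
proof (induction d arbitrary: A s rule: nat_induct_at_least)
  case base
  define b where "b = (\<lambda>n::int. if n \<ge> 1 then 0 else (-1) ^ nat (- n) / fact (nat (- n)) :: complex)"
  have e1: "e 1 \<in> O[F](\<eta>)" "\<forall>\<^sub>F x in F. e 1 x \<noteq> 0" using base by auto
  obtain l where l: "int l \<ge> 1 - A 1" and ex:
    "(\<lambda>x. gam (e 1 x) (A 1) * ez_cont 1 (s x) -
      (gam (e 1 x) (A 1) + (\<Sum>p\<le>l. bern_coeff p * gam (e 1 x) (A 1 - 1 + int p)))) \<in> O[F](\<eta>)"
    using ez_cont_expand[of s 0 A e "1 - A 1"] base(1,2,4,5) by (auto simp del: ez_cont.simps(2))
  have gb: "(\<lambda>x. gam (e 1 x) n - b n) \<in> O[F](\<eta>)" for n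
    unfolding b_def by (rule gam_bigo[OF e1])
  have "(\<lambda>x. (gam (e 1 x) (A 1) - b (A 1)) +
      (\<Sum>p\<le>l. bern_coeff p * (gam (e 1 x) (A 1 - 1 + int p) - b (A 1 - 1 + int p)))) \<in> O[F](\<eta>)"
    by (intro sum_in_bigo(1) big_sum_in_bigo bigo_1_mult bigo_const_1 gb)
  from sum_in_bigo(1)[OF ex this]
  have "(\<lambda>x. gam (e 1 x) (A 1) * ez_cont 1 (s x) -
      (b (A 1) + (\<Sum>p\<le>l. bern_coeff p * b (A 1 - 1 + int p)))) \<in> O[F](\<eta>)"
    by (simp add: right_diff_distrib sum_subtractf algebra_simps del: ez_cont.simps(2))
  then have "(\<lambda>x. gam (e 1 x) (A 1) * ez_cont 1 (s x) - main_sum 1 A (\<lambda>j. e j x)) \<in> O[F](\<eta>)"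
    unfolding b_def base_identity[OF l] main_sum_1 .
  moreover have "(\<lambda>x. main_sum 1 A (\<lambda>j. e j x)) \<in> O[F](\<lambda>_. 1)" unfolding main_sum_1 by (rule bigo_const_1)
  ultimately show ?case by blast
next
  case (Suc d)
  note d = \<open>d \<ge> 1\<close>
  obtain l where l: "int l \<ge> int (Suc d) - A 1" and ex:
    "(\<lambda>x. gam (e (Suc d) x) (A (Suc d)) * ez_cont (Suc d) (s x) -
       (\<Sum>p\<le>l. bern_coeff p * (gam (e (Suc d) x) (A (Suc d) - 1 + int p) *
          ez_cont d (merge_last d (of_nat p - 1) (s x))))) \<in> O[F](\<eta>)"
    using ez_cont_expand[of s d A e "int (Suc d) - A 1"] Suc.prems(1,2,4,5) d by auto
  have ed: "e d \<in> O[F](\<eta>)" "\<forall>\<^sub>F x in F. e d x \<noteq> 0" "e (Suc d) \<in> O[F](\<eta>)" "\<forall>\<^sub>F x in F. e (Suc d) x \<noteq> 0"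
    "(\<lambda>x. e (Suc d) x / e d x) \<in> O[F](\<lambda>_. 1)"
    using Suc.prems(4,5)[of d] Suc.prems(4,5)[of "Suc d"] Suc.prems(6)[of d] d by auto
  define A' where "A' p j = A j - 1 + int p" for p j
  define R where "R p x = hcut (A (Suc d) - 1 + int p) (A d - 1 + int p) *
      (brk (e (Suc d) x) (A (Suc d) - 1 + int p) / brk (e d x) (A d - 1 + int p))" for p x
  have ih: "(\<lambda>x. gam (e d x) (A' p d) * ez_cont d (merge_last d (of_nat p - 1) (s x)) - main_sum d (A' p) (\<lambda>j. e j x)) \<in> O[F](\<eta>)"
    "(\<lambda>x. main_sum d (A' p) (\<lambda>j. e j x)) \<in> O[F](\<lambda>_. 1)" for p
  proof -
    have "(\<lambda>x. gam (e d x) (A' p d) * ez_cont d (merge_last d (of_nat p - 1) (s x)) - main_sum d (A' p) (\<lambda>j. e j x)) \<in> O[F](\<eta>) \<and>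
      (\<lambda>x. main_sum d (A' p) (\<lambda>j. e j x)) \<in> O[F](\<lambda>_. 1)"
    proof (rule Suc.IH)
      show "tail_sum d (merge_last d (of_nat p - 1) (s x)) j = of_int (A' p j) + e j x" if j: "j \<in> {1..d}" for x j
        unfolding tail_sum_merge_last[OF j] using Suc.prems(2)[of j x] j by (simp add: A'_def)
      show "A' p j \<le> A' p (Suc j)" if "j \<in> {1..<d}" for j using Suc.prems(3)[of j] that by (simp add: A'_def)
    qed (use Suc.prems(4,5,6) merge_last_cspace in auto)
    then show "(\<lambda>x. gam (e d x) (A' p d) * ez_cont d (merge_last d (of_nat p - 1) (s x)) - main_sum d (A' p) (\<lambda>j. e j x)) \<in> O[F](\<eta>)"
      "(\<lambda>x. main_sum d (A' p) (\<lambda>j. e j x)) \<in> O[F](\<lambda>_. 1)" by auto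
  qed
  have AA: "A d - 1 + int p \<le> A (Suc d) - 1 + int p" for p using Suc.prems(3)[of d] d by auto
  have R1: "R p \<in> O[F](\<lambda>_. 1)" for p unfolding R_def by (rule brk_ratio_bigo(2)[OF ed(3,5) AA])
  \<comment> \<open>The coefficient is divided by the normalising factor of the depth
    \<open>d\<close> value, which is multiplied by it in turn. This creates the quotient of Gamma
    factors.\<close>
  have "(\<lambda>x. gam (e (Suc d) x) (A (Suc d) - 1 + int p) / gam (e d x) (A d - 1 + int p) *
      (gam (e d x) (A' p d) * ez_cont d (merge_last d (of_nat p - 1) (s x))) -
      R p x * main_sum d (A' p) (\<lambda>j. e j x)) \<in> O[F](\<eta>)" for p
    by (rule bigo_perturb[OF _ ih(1) R1 ih(2)]) (unfold R_def, rule gam_ratio_bigo[OF ed(3,4,1,2,5) AA])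
  moreover have "\<forall>\<^sub>F x in F. gam (e (Suc d) x) (A (Suc d) - 1 + int p) / gam (e d x) (A d - 1 + int p) *
      (gam (e d x) (A' p d) * ez_cont d (merge_last d (of_nat p - 1) (s x))) -
      R p x * main_sum d (A' p) (\<lambda>j. e j x) =
      gam (e (Suc d) x) (A (Suc d) - 1 + int p) * ez_cont d (merge_last d (of_nat p - 1) (s x)) -
      R p x * main_sum d (A' p) (\<lambda>j. e j x)" for p
    using ed(2) small_eventually[OF ed(1)]
    by eventually_elim (simp add: gam_nonzero A'_def)
  ultimately have "(\<lambda>x. gam (e (Suc d) x) (A (Suc d) - 1 + int p) * ez_cont d (merge_last d (of_nat p - 1) (s x)) -
      R p x * main_sum d (A' p) (\<lambda>j. e j x)) \<in> O[F](\<eta>)" for p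
    by (rule landau_o.big.in_cong[THEN iffD1, rotated])
  then have "(\<lambda>x. \<Sum>p\<le>l. bern_coeff p * (gam (e (Suc d) x) (A (Suc d) - 1 + int p) * ez_cont d (merge_last d (of_nat p - 1) (s x)) -
      R p x * main_sum d (A' p) (\<lambda>j. e j x))) \<in> O[F](\<eta>)"
    by (intro big_sum_in_bigo bigo_1_mult bigo_const_1)
  from sum_in_bigo(1)[OF ex this]
  have "(\<lambda>x. gam (e (Suc d) x) (A (Suc d)) * ez_cont (Suc d) (s x) -
      (\<Sum>p\<le>l. bern_coeff p * (R p x * main_sum d (A' p) (\<lambda>j. e j x)))) \<in> O[F](\<eta>)"
    by (simp add: right_diff_distrib sum_subtractf)
  moreover have ms: "main_sum (Suc d) A (\<lambda>j. e j x) = (\<Sum>p\<le>l. bern_coeff p * (R p x * main_sum d (A' p) (\<lambda>j. e j x)))" for x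
    unfolding main_sum_Suc[of d A l, OF d l] R_def A'_def ..
  moreover have "(\<lambda>x. \<Sum>p\<le>l. bern_coeff p * (R p x * main_sum d (A' p) (\<lambda>j. e j x))) \<in> O[F](\<lambda>_. 1)"
    by (intro big_sum_in_bigo bigo_1_mult_1 bigo_const_1 R1 ih(2))
  ultimately show ?case by (simp only:)
qed

end

text \<open>Splitting the error proportionally to \<open>\<bar>\<epsilon>\<^sub>j\<bar>\<close> turns a bound by \<open>\<Sum>\<bar>\<epsilon>\<^sub>j\<bar>\<close> into a sum of \<open>O(\<epsilon>\<^sub>j)\<close>.\<close>

lemma bigo_sum_split:
  fixes E :: "'a \<Rightarrow> complex" and \<epsilon> :: "'a \<Rightarrow> nat \<Rightarrow> complex"
  assumes E: "E \<in> O[F](\<lambda>x. of_real (\<Sum>j=1..d. norm (\<epsilon> x j)))"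
  shows "\<exists>R. (\<forall>j\<in>{1..d}. R j \<in> O[F](\<lambda>x. \<epsilon> x j)) \<and> (\<forall>\<^sub>F x in F. E x = (\<Sum>j=1..d. R j x))"
proof -
  define S where "S x = (\<Sum>j=1..d. norm (\<epsilon> x j))" for x
  have S0: "S x \<ge> 0" for x by (auto simp: S_def intro!: sum_nonneg)
  obtain C where C0: "C > 0" and C: "\<forall>\<^sub>F x in F. norm (E x) \<le> C * norm (of_real (S x) :: complex)"
    using E unfolding S_def[symmetric] by (elim landau_o.bigE)
  define R where "R j x = E x * of_real (norm (\<epsilon> x j) / S x)" for j x
  have "R j \<in> O[F](\<lambda>x. \<epsilon> x j)" for j
  proof (rule bigoI)
    show "\<forall>\<^sub>F x in F. norm (R j x) \<le> C * norm (\<epsilon> x j)" using C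
    proof eventually_elim
      case (elim x)
      have "norm (E x) \<le> C * S x" using elim S0[of x] by simp
      then have "norm (E x) * (norm (\<epsilon> x j) / S x) \<le> C * S x * (norm (\<epsilon> x j) / S x)"
        using S0[of x] by (intro mult_right_mono) auto
      also have "\<dots> \<le> C * norm (\<epsilon> x j)" using C0 by (cases "S x = 0") auto
      finally show ?case using S0[of x] by (simp add: R_def norm_mult norm_divide)
    qed
  qed
  moreover have "\<forall>\<^sub>F x in F. E x = (\<Sum>j=1..d. R j x)" using C
  proof eventually_elim
    case (elim x)
    have "(\<Sum>j=1..d. R j x) = E x * of_real (S x / S x)"
      unfolding R_def S_def sum_distrib_left[symmetric] of_real_sum[symmetric] sum_divide_distrib ..
    then show ?case using elim by (cases "S x = 0") auto
  qed
  ultimately show ?thesis by blast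
qed

theorem theorem2:
  fixes d :: nat and m :: "nat \<Rightarrow> nat" and M :: nat
    and \<epsilon> :: "'a \<Rightarrow> nat \<Rightarrow> complex" and F :: "'a filter"
  assumes "d \<ge> 1"
    and "M = (\<Sum>j=1..d. m j)"
    and "\<forall>j\<in>{1..d}. ((\<lambda>x. \<epsilon> x j) \<longlongrightarrow> 0) F"
    and "\<forall>\<^sub>F x in F. \<forall>j\<in>{1..d}. \<epsilon> x j \<noteq> 0 \<and> tail_sum d (\<epsilon> x) j \<noteq> 0"
    and "\<forall>\<^sub>F x in F. (\<Sum>j=1..d. norm (\<epsilon> x j)) \<le> 1 / 2"
    and "\<forall>j k. 1 \<le> j \<and> j \<le> k \<and> k \<le> d \<longrightarrow> Bfun (\<lambda>x. \<epsilon> x k / tail_sum d (\<epsilon> x) j) F"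
  shows
    "(\<exists>R. (\<forall>j\<in>{1..d}. R j \<in> O[F](\<lambda>x. \<epsilon> x j)) \<and>
       (\<forall>\<^sub>F x in F.
          euler_zagier_zeta d (\<lambda>j\<in>{1..d}. - of_nat (m j) + \<epsilon> x j) =
          (-1) ^ m d * fact (m d) *
          (\<Sum>p | p \<in> {1..d} \<rightarrow>\<^sub>E (UNIV :: nat set) \<and> (\<Sum>i=1..d. p i) = d + M.
             (\<Prod>i=1..d. bernoulli_number (p i)) / (\<Prod>i=1..d. fact (p i)) *
             (\<Prod>j=2..d.
                hcut (- int (tail_sum d m j) - int d + int j + int (tail_sum d p j) - 1)
                     (- int (tail_sum d m (j - 1)) - int d + int j + int (tail_sum d p j) - 1) *
                (brk (tail_sum d (\<epsilon> x) j)
                     (- int (tail_sum d m j) - int d + int j + int (tail_sum d p j) - 1) /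
                 brk (tail_sum d (\<epsilon> x) (j - 1))
                     (- int (tail_sum d m (j - 1)) - int d + int j + int (tail_sum d p j) - 1))))
          + (\<Sum>j=1..d. R j x)))
     \<and>
     (\<exists>R. (\<forall>j\<in>{1..d}. R j \<in> O[F](\<lambda>x. \<epsilon> x j)) \<and>
       (\<forall>\<^sub>F x in F.
          euler_zagier_zeta d (\<lambda>j\<in>{1..d}. - of_nat (m j) + \<epsilon> x j) =
          (-1) ^ m d * fact (m d) *
          (\<Sum>p | p \<in> {1..d} \<rightarrow>\<^sub>E (UNIV :: nat set) \<and> (\<Sum>i=1..d. p i) = d + M \<and>
               (\<forall>j\<in>{2..d}.
                  - int (tail_sum d m j) - int d + int j + int (tail_sum d p j) < 2 \<or>
                  - int (tail_sum d m (j - 1)) - int d + int j + int (tail_sum d p j) \<ge> 2).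
             (\<Prod>i=1..d. bernoulli_number (p i)) / (\<Prod>i=1..d. fact (p i)) *
             (\<Prod>j=2..d.
                brk (tail_sum d (\<epsilon> x) j)
                    (- int (tail_sum d m j) - int d + int j + int (tail_sum d p j) - 1) /
                brk (tail_sum d (\<epsilon> x) (j - 1))
                    (- int (tail_sum d m (j - 1)) - int d + int j + int (tail_sum d p j) - 1)))
          + (\<Sum>j=1..d. R j x)))"
    (is "(\<exists>R. ?P1 R) \<and> (\<exists>R. ?P2 R)")
proof -
  define s where "s x = (\<lambda>j\<in>{1..d}. - of_nat (m j) + \<epsilon> x j)" for x
  define A where "A j = - int (tail_sum d m j)" for j
  define e where "e j x = tail_sum d (\<epsilon> x) j" for j x
  define c where "c = (-1) ^ m d * (fact (m d) :: complex)"
  define \<eta> where "\<eta> x = (of_real (\<Sum>j=1..d. norm (\<epsilon> x j)) :: complex)" for x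
  have "((\<lambda>x. of_real (\<Sum>j=1..d. norm (\<epsilon> x j)) :: complex) \<longlongrightarrow> of_real (\<Sum>j=1..d. norm (0::complex))) F"
    using assms(3) by (intro tendsto_of_real tendsto_sum tendsto_norm) auto
  then interpret small_scale F \<eta> by unfold_locales (simp add: \<eta>_def[abs_def])
  have sc: "s x \<in> cspace d" for x by (auto simp: s_def cspace_def)
  have tail: "tail_sum d (s x) j = of_int (A j) + e j x" if "j \<in> {1..d}" for x j
  proof -
    have "tail_sum d (s x) j = (\<Sum>i=j..d. - of_nat (m i) + \<epsilon> x i)"
      unfolding tail_sum_def s_def using that by (intro sum.cong) auto
    then show ?thesis by (simp add: A_def e_def tail_sum_def sum_subtractf)
  qed
  have A: "A j \<le> A (Suc j)" if "j \<in> {1..<d}" for j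
    unfolding A_def tail_sum_def using that by (auto intro!: sum_mono2 simp del: of_nat_sum)
  have norm_e: "norm (e j x) \<le> (\<Sum>j=1..d. norm (\<epsilon> x j))" if "j \<in> {1..d}" for j x
  proof -
    have "norm (e j x) \<le> (\<Sum>i=j..d. norm (\<epsilon> x i))" unfolding e_def tail_sum_def by (rule norm_sum)
    also have "\<dots> \<le> (\<Sum>j=1..d. norm (\<epsilon> x j))" using that by (intro sum_mono2) auto
    finally show ?thesis .
  qed
  have e1: "e j \<in> O[F](\<eta>)" if "j \<in> {1..d}" for j
  proof (rule bigoI[of _ 1], intro always_eventually allI)
    fix x
    have "(\<Sum>j=1..d. norm (\<epsilon> x j)) \<ge> 0" by (intro sum_nonneg) auto
    then show "norm (e j x) \<le> 1 * norm (\<eta> x)"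
      using norm_e[OF that, of x] by (simp only: \<eta>_def norm_of_real abs_of_nonneg mult_1)
  qed
  have e2: "\<forall>\<^sub>F x in F. e j x \<noteq> 0" if "j \<in> {1..d}" for j
    using assms(4) by (rule eventually_mono) (use that in \<open>auto simp: e_def\<close>)
  \<comment> \<open>A sum of the quotients whose boundedness is assumed.\<close>
  have r: "(\<lambda>x. e (Suc j) x / e j x) \<in> O[F](\<lambda>_. 1)" if j: "j \<in> {1..<d}" for j
  proof -
    have "(\<lambda>x. \<epsilon> x k / e j x) \<in> O[F](\<lambda>_. 1)" if "k \<in> {Suc j..d}" for k
    proof -
      have "Bfun (\<lambda>x. \<epsilon> x k / e j x) F" using assms(6) j that by (auto simp: e_def)
      then obtain K where "\<forall>\<^sub>F x in F. norm (\<epsilon> x k / e j x) \<le> K" by (auto simp: Bfun_def)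
      then show ?thesis by (intro bigoI[of _ K]) simp
    qed
    then have "(\<lambda>x. \<Sum>k=Suc j..d. \<epsilon> x k / e j x) \<in> O[F](\<lambda>_. 1)" by (intro big_sum_in_bigo)
    then show ?thesis by (simp add: e_def tail_sum_def sum_divide_distrib)
  qed
  have asymp: "(\<lambda>x. gam (e d x) (A d) * ez_cont d (s x) - main_sum d A (\<lambda>j. e j x)) \<in> O[F](\<eta>)"
    "(\<lambda>x. main_sum d A (\<lambda>j. e j x)) \<in> O[F](\<lambda>_. 1)"
    using ez_cont_asymp[of d s A e, OF assms(1) sc tail A e1 e2 r] by auto
  have dd: "d \<in> {1..d}" using assms(1) by simp
  have Ad: "A d = - int (m d)" by (simp add: A_def tail_sum_def)
  have "(\<lambda>x. 1 / gam (e d x) (A d) * (gam (e d x) (A d) * ez_cont d (s x)) - c * main_sum d A (\<lambda>j. e j x)) \<in> O[F](\<eta>)"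
    by (rule bigo_perturb[OF _ asymp(1) bigo_const_1 asymp(2)])
      (unfold Ad c_def, rule inverse_gam_bigo[OF e1[OF dd] e2[OF dd]])
  moreover have "\<forall>\<^sub>F x in F. 1 / gam (e d x) (A d) * (gam (e d x) (A d) * ez_cont d (s x)) - c * main_sum d A (\<lambda>j. e j x)
      = euler_zagier_zeta d (s x) - c * main_sum d A (\<lambda>j. e j x)"
    using e2[OF dd] small_eventually[OF e1[OF dd]] assms(4,5)
  proof eventually_elim
    case (elim x)
    have "euler_zagier_zeta d (s x) = ez_cont d (s x)"
    proof (rule euler_zagier_zeta_eq[OF sc])
      fix j assume j: "j \<in> {1..d}"
      \<comment> \<open>The bound 1/2 keeps each \<open>e j x\<close> inside the unit disc, and it
        is nonzero; this is where the continuation is known to be holomorphic.\<close>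
      show "tail_sum d (s x) j \<notin> \<int>" unfolding tail[OF j]
        by (rule shifted_not_Ints) (use norm_e[OF j, of x] elim(3,4) j in \<open>auto simp: e_def\<close>)
    qed
    then show ?case using gam_nonzero[OF elim(1,2), of "A d"] by simp
  qed
  ultimately have "(\<lambda>x. euler_zagier_zeta d (s x) - c * main_sum d A (\<lambda>j. e j x)) \<in> O[F](\<eta>)"
    by (rule landau_o.big.in_cong[THEN iffD1, rotated])
  from bigo_sum_split[OF this[unfolded \<eta>_def]]
  obtain R where R: "\<forall>j\<in>{1..d}. R j \<in> O[F](\<lambda>x. \<epsilon> x j)"
    "\<forall>\<^sub>F x in F. euler_zagier_zeta d (s x) - c * main_sum d A (\<lambda>j. e j x) = (\<Sum>j=1..d. R j x)" by blast
  have R2: "\<forall>\<^sub>F x in F. euler_zagier_zeta d (s x) = c * main_sum d A (\<lambda>j. e j x) + (\<Sum>j=1..d. R j x)"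
    using R(2) by (rule eventually_mono) (simp only: diff_eq_eq add.commute)
  have idx: "exponents d (int d - A 1) = {p. p \<in> {1..d} \<rightarrow>\<^sub>E UNIV \<and> (\<Sum>i=1..d. p i) = d + M}"
  proof -
    have "int d - A 1 = int (d + M)" by (simp add: A_def tail_sum_def assms(2))
    then show ?thesis unfolding exponents_def by (simp only: of_nat_eq_iff)
  qed
  have bern: "(\<Prod>i=1..d. bern_coeff (p i)) = (\<Prod>i=1..d. bernoulli_number (p i)) / (\<Prod>i=1..d. fact (p i))" for p
    by (simp add: bern_coeff_def prod_dividef)
  have main1: "main_sum d A (\<lambda>j. e j x) = (\<Sum>p | p \<in> {1..d} \<rightarrow>\<^sub>E (UNIV :: nat set) \<and> (\<Sum>i=1..d. p i) = d + M.
      (\<Prod>i=1..d. bernoulli_number (p i)) / (\<Prod>i=1..d. fact (p i)) * (\<Prod>j=2..d. ratio d A (\<lambda>j. e j x) p j))" for x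
    unfolding main_sum_def idx bern ..
  have "?P1 R"
    using R(1) R2[unfolded main1, unfolded ratio_def A_def e_def s_def c_def] by (rule conjI)
  \<comment> \<open>The two forms agree exactly, so the same \<open>R\<close> serves both: excluded
    exponents have a factor with \<open>hcut\<close> equal to 0, and the remaining ones have all
    these factors equal to 1.\<close>
  have main2: "main_sum d A (\<lambda>j. e j x) =
      (\<Sum>p | p \<in> {1..d} \<rightarrow>\<^sub>E (UNIV :: nat set) \<and> (\<Sum>i=1..d. p i) = d + M \<and>
               (\<forall>j\<in>{2..d}.
                  - int (tail_sum d m j) - int d + int j + int (tail_sum d p j) < 2 \<or>
                  - int (tail_sum d m (j - 1)) - int d + int j + int (tail_sum d p j) \<ge> 2).
             (\<Prod>i=1..d. bernoulli_number (p i)) / (\<Prod>i=1..d. fact (p i)) *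
             (\<Prod>j=2..d.
                brk (tail_sum d (\<epsilon> x) j)
                    (- int (tail_sum d m j) - int d + int j + int (tail_sum d p j) - 1) /
                brk (tail_sum d (\<epsilon> x) (j - 1))
                    (- int (tail_sum d m (j - 1)) - int d + int j + int (tail_sum d p j) - 1)))" for x
    unfolding main1
  proof (rule sum.mono_neutral_cong_right)
    show "finite {p. p \<in> {1..d} \<rightarrow>\<^sub>E (UNIV :: nat set) \<and> (\<Sum>i=1..d. p i) = d + M}"
      unfolding idx[symmetric] by (rule finite_exponents)
  next
    show "\<forall>p\<in>{p. p \<in> {1..d} \<rightarrow>\<^sub>E (UNIV :: nat set) \<and> (\<Sum>i=1..d. p i) = d + M} -
        {p. p \<in> {1..d} \<rightarrow>\<^sub>E (UNIV :: nat set) \<and> (\<Sum>i=1..d. p i) = d + M \<and>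
          (\<forall>j\<in>{2..d}. - int (tail_sum d m j) - int d + int j + int (tail_sum d p j) < 2 \<or>
            - int (tail_sum d m (j - 1)) - int d + int j + int (tail_sum d p j) \<ge> 2)}.
      (\<Prod>i=1..d. bernoulli_number (p i)) / (\<Prod>i=1..d. fact (p i)) * (\<Prod>j=2..d. ratio d A (\<lambda>j. e j x) p j) = 0"
    proof
      fix p assume "p \<in> {p. p \<in> {1..d} \<rightarrow>\<^sub>E (UNIV :: nat set) \<and> (\<Sum>i=1..d. p i) = d + M} -
        {p. p \<in> {1..d} \<rightarrow>\<^sub>E (UNIV :: nat set) \<and> (\<Sum>i=1..d. p i) = d + M \<and>
          (\<forall>j\<in>{2..d}. - int (tail_sum d m j) - int d + int j + int (tail_sum d p j) < 2 \<or>
            - int (tail_sum d m (j - 1)) - int d + int j + int (tail_sum d p j) \<ge> 2)}"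
      then obtain j where "j \<in> {2..d}" "\<not> - int (tail_sum d m j) - int d + int j + int (tail_sum d p j) < 2"
        "\<not> - int (tail_sum d m (j - 1)) - int d + int j + int (tail_sum d p j) \<ge> 2" by blast
      then have "j \<in> {2..d}" "ratio d A (\<lambda>j. e j x) p j = 0" by (auto simp: ratio_def hcut_def A_def)
      then have "(\<Prod>j=2..d. ratio d A (\<lambda>j. e j x) p j) = 0" by (meson finite_atLeastAtMost prod_zero)
      then show "(\<Prod>i=1..d. bernoulli_number (p i)) / (\<Prod>i=1..d. fact (p i)) *
          (\<Prod>j=2..d. ratio d A (\<lambda>j. e j x) p j) = 0" by simp
    qed
  next
    fix p assume "p \<in> {p. p \<in> {1..d} \<rightarrow>\<^sub>E (UNIV :: nat set) \<and> (\<Sum>i=1..d. p i) = d + M \<and>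
          (\<forall>j\<in>{2..d}. - int (tail_sum d m j) - int d + int j + int (tail_sum d p j) < 2 \<or>
            - int (tail_sum d m (j - 1)) - int d + int j + int (tail_sum d p j) \<ge> 2)}"
    then have p: "- int (tail_sum d m j) - int d + int j + int (tail_sum d p j) < 2 \<or>
            - int (tail_sum d m (j - 1)) - int d + int j + int (tail_sum d p j) \<ge> 2" if "j \<in> {2..d}" for j
      using that by blast
    have "ratio d A (\<lambda>j. e j x) p j = brk (tail_sum d (\<epsilon> x) j)
                    (- int (tail_sum d m j) - int d + int j + int (tail_sum d p j) - 1) /
                brk (tail_sum d (\<epsilon> x) (j - 1))
                    (- int (tail_sum d m (j - 1)) - int d + int j + int (tail_sum d p j) - 1)" if "j \<in> {2..d}" for j
      using p[OF that] by (auto simp: ratio_def hcut_def A_def e_def)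
    then show "(\<Prod>i=1..d. bernoulli_number (p i)) / (\<Prod>i=1..d. fact (p i)) *
          (\<Prod>j=2..d. ratio d A (\<lambda>j. e j x) p j) = (\<Prod>i=1..d. bernoulli_number (p i)) / (\<Prod>i=1..d. fact (p i)) *
             (\<Prod>j=2..d.
                brk (tail_sum d (\<epsilon> x) j)
                    (- int (tail_sum d m j) - int d + int j + int (tail_sum d p j) - 1) /
                brk (tail_sum d (\<epsilon> x) (j - 1))
                    (- int (tail_sum d m (j - 1)) - int d + int j + int (tail_sum d p j) - 1))"
      by (simp only: cong: prod.cong)
  qed auto
  have "?P2 R"
    using R(1) R2[unfolded main2, unfolded s_def c_def] by (rule conjI)
  with \<open>?P1 R\<close> show ?thesis by blast
qed

end
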